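(* Let $s\ge 1$ and let $(r(n))_{n\in\mathbb Z}$ be a sequence of $s\times s$ matrices with entries in the quaternions $\mathbb H$. (1) The function $K(n,m)=r(n-m)$ on $\mathbb Z\times\mathbb Z$ has a finite number $\kappa$ of negative squares if and only if there exist a right quaternionic Pontryagin space $\mathcal P$, a unitary operator $U\in\mathbf L(\mathcal P)$ and a linear operator $C\in\mathbf L(\mathbb H^s,\mathcal P)$ such that $$r(n)=C^*U^nC,\qquad n\in\mathbb Z. \qquad ( * )$$ (2) The realization $( * )$ is unique up to a unitary map among those for which the linear span of $\bigcup_{n\in\mathbb Z}\operatorname{ran}(U^nC)$ is dense in $\mathcal P$. That is, if $(\mathcal P_1,U_1,C_1)$ and $(\mathcal P_2,U_2,C_2)$ are two triples as in (1), both satisfying $( * )$ for the same sequence $r$ and both satisfying this density condition, then there is a unitary map $S:\mathcal P_1\to\mathcal P_2$ with $SC_1=C_2$ and $SU_1=U_2S$.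
   Context: Pontryagin spaces. A Hermitian form on a right quaternionic vector space $\mathcal P$ is a map $[\cdot,\cdot]:\mathcal P\times\mathcal P\to\mathbb H$, additive in each variable, with $[a,b]=\overline{[b,a]}$ and $[ap,bq]=\overline q[a,b]p$ for $a,b\in\mathcal P$, $p,q\in\mathbb H$. $\mathcal P$ is a right quaternionic Pontryagin space if $\mathcal P=\mathcal P_+\oplus\mathcal P_-$ is a direct sum, orthogonal with respect to $[\cdot,\cdot]$, such that $(\mathcal P_+,[\cdot,\cdot])$ is a (right quaternionic) Hilbert space and $(\mathcal P_-,-[\cdot,\cdot])$ is a finite dimensional Hilbert space. The topology of $\mathcal P$ is that of the Hilbert space inner product $\langle a,b\rangle=[a_+,b_+]-[a_-,b_-]$; it does not depend on the chosen decomposition. $\mathbf L(\cdot,\cdot)$ denotes bounded right-linear operators, and $\mathbf L(\mathcal P)=\mathbf L(\mathcal P,\mathcal P)$. Adjoints are taken with respect to the forms $[\cdot,\cdot]$ and, on $\mathbb H^s$, the standard inner product $\langle c,d\rangle=d^*c$. An operator (or a map between two Pontryagin spaces) is unitary if it is a bounded right-linear bijection that preserves the Hermitian forms. Negative squares. A Hermitian quaternionic matrix $T$ can be written $T=WDW^*$ with $W$ unitary and $D$ real diagonal; the diagonal entries of $D$ are its eigenvalues. The function $K(n,m)=r(n-m)$ is said to have $\kappa$ negative squares if $r(-n)=r(n)^*$ for all $n\in\mathbb Z$ and all the Hermitian block Toeplitz matrices $$\mathbb T_N=\begin{pmatrix}r(0)&r(1)&\cdots&r(N)\\ r(-1)&r(0)&\cdots&r(N-1)\\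 \vdots&&&\vdots\\ r(-N)&r(1-N)&\cdots&r(0)\end{pmatrix},\qquad N=0,1,2,\ldots$$ have at most $\kappa$ strictly negative eigenvalues (counted with multiplicity), with exactly $\kappa$ for some $N$. *)

theory Defs
  imports "HOL-Analysis.Analysis" "HOL-Library.Function_Algebras"
begin

section \<open>Quaternions\<close>

codatatype quat = Quat (qRe: real) (qI: real) (qJ: real) (qK: real)

lemma quat_eq_iff:
  "x = y \<longleftrightarrow> qRe x = qRe y \<and> qI x = qI y \<and> qJ x = qJ y \<and> qK x = qK y"
  by (auto intro: quat.expand)

instantiation quat :: ab_group_add
begin

primcorec zero_quat where
  "qRe 0 = 0" | "qI 0 = 0" | "qJ 0 = 0" | "qK 0 = 0"

primcorec plus_quat where
  "qRe (x + y) = qRe x + qRe y"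
| "qI (x + y) = qI x + qI y"
| "qJ (x + y) = qJ x + qJ y"
| "qK (x + y) = qK x + qK y"

primcorec uminus_quat where
  "qRe (- x) = - qRe x" | "qI (- x) = - qI x" | "qJ (- x) = - qJ x" | "qK (- x) = - qK x"

primcorec minus_quat where
  "qRe (x - y) = qRe x - qRe y"
| "qI (x - y) = qI x - qI y"
| "qJ (x - y) = qJ x - qJ y"
| "qK (x - y) = qK x - qK y"

instance
  by standard (simp_all add: quat_eq_iff)

end

instantiation quat :: ring_1
begin

primcorec one_quat where
  "qRe 1 = 1" | "qI 1 = 0" | "qJ 1 = 0" | "qK 1 = 0"

primcorec times_quat where
  "qRe (x * y) = qRe x * qRe y - qI x * qI y - qJ x * qJ y - qK x * qK y"
| "qI (x * y) = qRe x * qI y + qI x * qRe y + qJ x * qK y - qK x * qJ y"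
| "qJ (x * y) = qRe x * qJ y - qI x * qK y + qJ x * qRe y + qK x * qI y"
| "qK (x * y) = qRe x * qK y + qI x * qJ y - qJ x * qI y + qK x * qRe y"

instance
  by standard (simp_all add: quat_eq_iff algebra_simps)

end

instantiation quat :: real_algebra_1
begin

primcorec scaleR_quat where
  "qRe (r *\<^sub>R x) = r * qRe x"
| "qI (r *\<^sub>R x) = r * qI x"
| "qJ (r *\<^sub>R x) = r * qJ x"
| "qK (r *\<^sub>R x) = r * qK x"

instance
  by standard (simp_all add: quat_eq_iff algebra_simps)

end

primcorec qcnj :: "quat \<Rightarrow> quat" where
  "qRe (qcnj x) = qRe x"
| "qI (qcnj x) = - qI x"
| "qJ (qcnj x) = - qJ x"
| "qK (qcnj x) = - qK x"

lemma qcnj_mult: "qcnj (x * y) = qcnj y * qcnj x"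
  by (simp add: quat_eq_iff algebra_simps)

lemma mult_qcnj: "x * qcnj x = of_real ((qRe x)\<^sup>2 + (qI x)\<^sup>2 + (qJ x)\<^sup>2 + (qK x)\<^sup>2)"
  by (simp add: quat_eq_iff of_real_def power2_eq_square algebra_simps)


section \<open>Right quaternionic spaces with a Hermitian form\<close>

text \<open>The addition is that of the ambient type; the carrier, the right scalar multiplication
  and the form are part of the structure and matter on the carrier only.\<close>

record 'a qspace =
  qcarrier :: "'a set"
  qsmult :: "'a \<Rightarrow> quat \<Rightarrow> 'a"
  qform :: "'a \<Rightarrow> 'a \<Rightarrow> quat"

definition right_qvector_space :: "'a::ab_group_add qspace \<Rightarrow> bool" where
  "right_qvector_space P \<longleftrightarrow>
     0 \<in> qcarrier P \<and>
     (\<forall>a\<in>qcarrier P. \<forall>b\<in>qcarrier P. a + b \<in> qcarrier P) \<and>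
     (\<forall>a\<in>qcarrier P. - a \<in> qcarrier P) \<and>
     (\<forall>a\<in>qcarrier P. \<forall>p. qsmult P a p \<in> qcarrier P) \<and>
     (\<forall>a\<in>qcarrier P. \<forall>b\<in>qcarrier P. \<forall>p.
        qsmult P (a + b) p = qsmult P a p + qsmult P b p) \<and>
     (\<forall>a\<in>qcarrier P. \<forall>p q. qsmult P a (p + q) = qsmult P a p + qsmult P a q) \<and>
     (\<forall>a\<in>qcarrier P. \<forall>p q. qsmult P a (p * q) = qsmult P (qsmult P a p) q) \<and>
     (\<forall>a\<in>qcarrier P. qsmult P a 1 = a)"

definition hermitian_form :: "'a::ab_group_add qspace \<Rightarrow> bool" where
  "hermitian_form P \<longleftrightarrow>
     (\<forall>a\<in>qcarrier P. \<forall>b\<in>qcarrier P. \<forall>c\<in>qcarrier P.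
        qform P (a + b) c = qform P a c + qform P b c \<and>
        qform P a (b + c) = qform P a b + qform P a c) \<and>
     (\<forall>a\<in>qcarrier P. \<forall>b\<in>qcarrier P. qform P a b = qcnj (qform P b a)) \<and>
     (\<forall>a\<in>qcarrier P. \<forall>b\<in>qcarrier P. \<forall>p q.
        qform P (qsmult P a p) (qsmult P b q) = qcnj q * qform P a b * p)"

definition qsubspace :: "'a::ab_group_add qspace \<Rightarrow> 'a set \<Rightarrow> bool" where
  "qsubspace P W \<longleftrightarrow>
     W \<subseteq> qcarrier P \<and> 0 \<in> W \<and> (\<forall>a\<in>W. \<forall>b\<in>W. a + b \<in> W) \<and>
     (\<forall>a\<in>W. \<forall>p. qsmult P a p \<in> W)"

definition qspan :: "'a::ab_group_add qspace \<Rightarrow> 'a set \<Rightarrow> 'a set" where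
  "qspan P A = qsubspace P hull A"

definition finite_qdim :: "'a::ab_group_add qspace \<Rightarrow> bool" where
  "finite_qdim P \<longleftrightarrow> (\<exists>B. finite B \<and> B \<subseteq> qcarrier P \<and> qspan P B = qcarrier P)"

text \<open>The value off the carrier is a dummy: the locale \<^locale>\<open>Metric_space\<close> requires
  symmetry and nonnegativity on the whole type.\<close>

definition norm_dist :: "'a set \<Rightarrow> ('a::ab_group_add \<Rightarrow> real) \<Rightarrow> 'a \<Rightarrow> 'a \<Rightarrow> real" where
  "norm_dist V nrm a b = (if a \<in> V \<and> b \<in> V then nrm (a - b) else 0)"

definition right_qhilbert_space :: "'a::ab_group_add qspace \<Rightarrow> bool" where
  "right_qhilbert_space P \<longleftrightarrow>
     right_qvector_space P \<and> hermitian_form P \<and>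
     (\<forall>a\<in>qcarrier P. a \<noteq> 0 \<longrightarrow> 0 < qRe (qform P a a)) \<and>
     Metric_space.mcomplete (qcarrier P)
       (norm_dist (qcarrier P) (\<lambda>a. sqrt (qRe (qform P a a))))"


section \<open>Pontryagin spaces\<close>

definition fundamental_decomposition ::
    "'a::ab_group_add qspace \<Rightarrow> 'a set \<Rightarrow> 'a set \<Rightarrow> bool" where
  "fundamental_decomposition P Pp Pm \<longleftrightarrow>
     qsubspace P Pp \<and> qsubspace P Pm \<and>
     qcarrier P = {a + b | a b. a \<in> Pp \<and> b \<in> Pm} \<and> Pp \<inter> Pm = {0} \<and>
     (\<forall>a\<in>Pp. \<forall>b\<in>Pm. qform P a b = 0) \<and>
     right_qhilbert_space (P\<lparr>qcarrier := Pp\<rparr>) \<and>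
     right_qhilbert_space (P\<lparr>qcarrier := Pm, qform := \<lambda>a b. - qform P a b\<rparr>) \<and>
     finite_qdim (P\<lparr>qcarrier := Pm\<rparr>)"

definition pontryagin_space :: "'a::ab_group_add qspace \<Rightarrow> bool" where
  "pontryagin_space P \<longleftrightarrow>
     right_qvector_space P \<and> hermitian_form P \<and> (\<exists>Pp Pm. fundamental_decomposition P Pp Pm)"

definition plus_part :: "'a::ab_group_add set \<Rightarrow> 'a set \<Rightarrow> 'a \<Rightarrow> 'a" where
  "plus_part Pp Pm a = (THE x. x \<in> Pp \<and> a - x \<in> Pm)"

definition decomposition_inner ::
    "'a::ab_group_add qspace \<Rightarrow> 'a set \<Rightarrow> 'a set \<Rightarrow> 'a \<Rightarrow> 'a \<Rightarrow> quat" where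
  "decomposition_inner P Pp Pm a b =
     qform P (plus_part Pp Pm a) (plus_part Pp Pm b)
     - qform P (a - plus_part Pp Pm a) (b - plus_part Pp Pm b)"

text \<open>Different decompositions give equivalent norms, so boundedness and the topology do not
  depend on the decomposition picked here.\<close>

definition pontryagin_norm :: "'a::ab_group_add qspace \<Rightarrow> 'a \<Rightarrow> real" where
  "pontryagin_norm P a =
     (let (Pp, Pm) = (SOME D. fundamental_decomposition P (fst D) (snd D))
      in sqrt (qRe (decomposition_inner P Pp Pm a a)))"

definition pontryagin_topology :: "'a::ab_group_add qspace \<Rightarrow> 'a topology" where
  "pontryagin_topology P =
     Metric_space.mtopology (qcarrier P) (norm_dist (qcarrier P) (pontryagin_norm P))"

definition right_linear ::
    "'a::ab_group_add qspace \<Rightarrow> 'b::ab_group_add qspace \<Rightarrow> ('a \<Rightarrow> 'b) \<Rightarrow> bool" where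
  "right_linear P Q T \<longleftrightarrow>
     T \<in> qcarrier P \<rightarrow> qcarrier Q \<and>
     (\<forall>a\<in>qcarrier P. \<forall>b\<in>qcarrier P. T (a + b) = T a + T b) \<and>
     (\<forall>a\<in>qcarrier P. \<forall>p. T (qsmult P a p) = qsmult Q (T a) p)"

definition bounded_operator ::
    "'a::ab_group_add qspace \<Rightarrow> 'b::ab_group_add qspace \<Rightarrow> ('a \<Rightarrow> 'b) \<Rightarrow> bool" where
  "bounded_operator P Q T \<longleftrightarrow>
     right_linear P Q T \<and>
     (\<exists>M. \<forall>a\<in>qcarrier P. pontryagin_norm Q (T a) \<le> M * pontryagin_norm P a)"

definition unitary_operator ::
    "'a::ab_group_add qspace \<Rightarrow> 'b::ab_group_add qspace \<Rightarrow> ('a \<Rightarrow> 'b) \<Rightarrow> bool" where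
  "unitary_operator P Q U \<longleftrightarrow>
     bounded_operator P Q U \<and> bij_betw U (qcarrier P) (qcarrier Q) \<and>
     (\<forall>a\<in>qcarrier P. \<forall>b\<in>qcarrier P. qform Q (U a) (U b) = qform P a b)"

definition qadjoint ::
    "'a::ab_group_add qspace \<Rightarrow> 'b::ab_group_add qspace \<Rightarrow> ('a \<Rightarrow> 'b) \<Rightarrow> 'b \<Rightarrow> 'a" where
  "qadjoint P Q T b =
     (THE x. x \<in> qcarrier P \<and> (\<forall>a\<in>qcarrier P. qform Q (T a) b = qform P a x))"

definition int_power :: "'a qspace \<Rightarrow> ('a \<Rightarrow> 'a) \<Rightarrow> int \<Rightarrow> 'a \<Rightarrow> 'a" where
  "int_power P U n =
     (if n \<ge> 0 then U ^^ nat n else inv_into (qcarrier P) U ^^ nat (- n))"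

definition Hspace :: "(quat ^ 's) qspace" where
  "Hspace = \<lparr>qcarrier = UNIV, qsmult = (\<lambda>c p. \<chi> i. c $ i * p),
             qform = (\<lambda>c d. \<Sum>i\<in>UNIV. qcnj (d $ i) * c $ i)\<rparr>"


section \<open>Negative squares\<close>

text \<open>Matrices whose size varies are functions on a finite index set.\<close>

definition unitary_qmatrix :: "'i set \<Rightarrow> ('i \<Rightarrow> 'i \<Rightarrow> quat) \<Rightarrow> bool" where
  "unitary_qmatrix I W \<longleftrightarrow>
     (\<forall>i\<in>I. \<forall>j\<in>I. (\<Sum>k\<in>I. W i k * qcnj (W j k)) = (if i = j then 1 else 0)) \<and>
     (\<forall>i\<in>I. \<forall>j\<in>I. (\<Sum>k\<in>I. qcnj (W k i) * W k j) = (if i = j then 1 else 0))"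

definition diagonalizes ::
    "'i set \<Rightarrow> ('i \<Rightarrow> 'i \<Rightarrow> quat) \<Rightarrow> ('i \<Rightarrow> 'i \<Rightarrow> quat) \<Rightarrow> ('i \<Rightarrow> real) \<Rightarrow> bool" where
  "diagonalizes I T W d \<longleftrightarrow>
     unitary_qmatrix I W \<and>
     (\<forall>i\<in>I. \<forall>j\<in>I. T i j = (\<Sum>k\<in>I. W i k * of_real (d k) * qcnj (W j k)))"

text \<open>For Hermitian \<open>T\<close> and finite \<open>I\<close> such a multiset exists and is unique.\<close>

definition hermitian_eigenvalues :: "'i set \<Rightarrow> ('i \<Rightarrow> 'i \<Rightarrow> quat) \<Rightarrow> real multiset" where
  "hermitian_eigenvalues I T =
     (SOME E. \<exists>W d. diagonalizes I T W d \<and> E = image_mset d (mset_set I))"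

definition toeplitz_index :: "nat \<Rightarrow> (nat \<times> 's) set" where
  "toeplitz_index N = {0..N} \<times> UNIV"

definition block_toeplitz ::
    "(int \<Rightarrow> quat ^ 's ^ 's) \<Rightarrow> nat \<times> 's \<Rightarrow> nat \<times> 's \<Rightarrow> quat" where
  "block_toeplitz r = (\<lambda>(i, a) (j, b). r (int j - int i) $ a $ b)"

definition negative_eigenvalues :: "(int \<Rightarrow> quat ^ 's ^ 's) \<Rightarrow> nat \<Rightarrow> nat" where
  "negative_eigenvalues r N =
     size (filter_mset (\<lambda>x. x < 0)
       (hermitian_eigenvalues (toeplitz_index N) (block_toeplitz r)))"

definition conj_transpose :: "quat ^ 's ^ 's \<Rightarrow> quat ^ 's ^ 's" where
  "conj_transpose A = (\<chi> i j. qcnj (A $ j $ i))"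

definition negative_squares :: "(int \<Rightarrow> quat ^ 's ^ 's) \<Rightarrow> nat \<Rightarrow> bool" where
  "negative_squares r \<kappa> \<longleftrightarrow>
     (\<forall>n. r (- n) = conj_transpose (r n)) \<and>
     (\<forall>N. negative_eigenvalues r N \<le> \<kappa>) \<and> (\<exists>N. negative_eigenvalues r N = \<kappa>)"


section \<open>Realizations\<close>

definition realization ::
    "'a::ab_group_add qspace \<Rightarrow> ('a \<Rightarrow> 'a) \<Rightarrow> (quat ^ 's \<Rightarrow> 'a) \<Rightarrow>
     (int \<Rightarrow> quat ^ 's ^ 's) \<Rightarrow> bool" where
  "realization P U C r \<longleftrightarrow>
     pontryagin_space P \<and> unitary_operator P P U \<and> bounded_operator Hspace P C \<and>
     (\<forall>n c. r n *v c = qadjoint Hspace P C (int_power P U n (C c)))"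

definition minimal_realization ::
    "'a::ab_group_add qspace \<Rightarrow> ('a \<Rightarrow> 'a) \<Rightarrow> (quat ^ 's \<Rightarrow> 'a) \<Rightarrow>
     (int \<Rightarrow> quat ^ 's ^ 's) \<Rightarrow> bool" where
  "minimal_realization P U C r \<longleftrightarrow>
     realization P U C r \<and>
     pontryagin_topology P closure_of (qspan P (\<Union>n. range (\<lambda>c. int_power P U n (C c))))
       = qcarrier P"

end

theory Submission
  imports Defs
begin

text \<open>A Pontryagin space is handled through a negative orthonormal basis \<open>e\<close> of \<open>P\<^sub>-\<close>: the Hilbert
  norm is \<open>\<parallel>x\<parallel>\<^sup>2 = [x,x] + 2 \<Sum>\<^sub>k |[x,e\<^sub>k]|\<^sup>2\<close>, so an isometry \<open>S\<close> whose range contains the basis of the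
  target is bounded because \<open>[Sx, S g\<^sub>k] = [x, g\<^sub>k]\<close>. No family of mutually orthogonal negative
  vectors is larger than \<open>e\<close>; this bounds the negative eigenvalues of the Toeplitz matrices of
  a realization. Conversely, put \<open>[c,d] = \<Sum> d\<^sub>n\<^sup>* r(m-n) c\<^sub>m\<close> on finitely supported sequences, where
  the bilateral shift is an isometry, and let \<open>e\<close> come from eigenvectors of a Toeplitz matrix with
  the maximal number of negative eigenvalues; the form is nonnegative on the complement of \<open>e\<close>, as
  a further negative vector could be shifted into some larger Toeplitz matrix. The completion
  consists of functions on \<open>\<int>\<close>, on which \<open>U\<close> is again the shift. For uniqueness,
  \<open>\<Sum> U\<^sub>1\<^sup>n C\<^sub>1 c\<^sub>n \<mapsto> \<Sum> U\<^sub>2\<^sup>n C\<^sub>2 c\<^sub>n\<close> is isometric, hence bounded on a dense subspace, and its graph closure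
  is the unitary map.\<close>

section \<open>Quaternions as a Euclidean space\<close>

text \<open>An isometry of an indefinite form need not be bounded, and the norm in the definitions
  comes from an arbitrarily chosen decomposition. A finite basis \<open>e\<close> meets both
  difficulties: norm and projection become explicit finite sums of form values, and any
  decomposition yields a basis with exactly its norm. Such a basis makes sense before definiteness
  and completeness are available, so one theory covers the degenerate sequence space and the final
  space. As entries do not commute, determinants and characteristic polynomials are avoided:
  eigenvectors come from maximizing a Rayleigh quotient, and the dimension counts reduce to the
  solvability of homogeneous systems with more unknowns than equations. Functions on the integers
  serve as the completion because an existence statement must name a type; a function records form
  values against the generators, so isotropic vectors vanish and equivalent Cauchy sequences
  coincide without a quotient. Eigenvalues form a multiset fixed only by a choice, so the arguments
  follow whichever diagonalization realizes that choice.\<close>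

instantiation quat :: real_inner
begin

definition inner_quat :: "quat \<Rightarrow> quat \<Rightarrow> real" where
  "inner_quat x y = qRe x * qRe y + qI x * qI y + qJ x * qJ y + qK x * qK y"

definition norm_quat :: "quat \<Rightarrow> real" where
  "norm_quat x = sqrt (inner x x)"

definition sgn_quat :: "quat \<Rightarrow> quat" where
  "sgn_quat x = x /\<^sub>R norm x"

definition dist_quat :: "quat \<Rightarrow> quat \<Rightarrow> real" where
  "dist_quat x y = norm (x - y)"

definition uniformity_quat :: "(quat \<times> quat) filter" where
  "uniformity_quat = (INF e\<in>{0 <..}. principal {(x, y). dist x y < e})"

definition open_quat :: "quat set \<Rightarrow> bool" where
  "open_quat U \<longleftrightarrow> (\<forall>x\<in>U. eventually (\<lambda>(x', y). x' = x \<longrightarrow> y \<in> U) uniformity)"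

instance
proof
  fix x y z :: quat and a :: real and U :: "quat set"
  show "dist x y = norm (x - y)" "sgn x = x /\<^sub>R norm x" "norm x = sqrt (inner x x)"
    by (simp_all only: dist_quat_def sgn_quat_def norm_quat_def)
  show "uniformity = (INF e\<in>{0 <..}. principal {(x, y :: quat). dist x y < e})"
    by (simp only: uniformity_quat_def)
  show "open U \<longleftrightarrow> (\<forall>x\<in>U. eventually (\<lambda>(x', y). x' = x \<longrightarrow> y \<in> U) uniformity)"
    by (simp only: open_quat_def)
  show "inner x y = inner y x" "inner (x + y) z = inner x z + inner y z"
    "inner (a *\<^sub>R x) y = a * inner x y" "0 \<le> inner x x"
    by (simp_all add: inner_quat_def algebra_simps)
  show "(inner x x = 0) = (x = 0)"
    unfolding inner_quat_def quat_eq_iff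
    by (simp add: add_nonneg_eq_0_iff conj_assoc)
qed

end

lemma mult_qcnj_norm: "x * qcnj x = (norm x)\<^sup>2 *\<^sub>R 1" "qcnj x * x = (norm x)\<^sup>2 *\<^sub>R 1"
  by (simp_all add: quat_eq_iff power2_norm_eq_inner inner_quat_def)

lemma norm_quat_mult: "norm (x * y) = norm x * norm y" for x y :: quat
proof -
  have "(norm (x * y))\<^sup>2 *\<^sub>R 1 = x * (y * qcnj y) * qcnj x"
    by (simp add: mult_qcnj_norm(1) [symmetric] qcnj_mult mult.assoc)
  also have "\<dots> = ((norm x)\<^sup>2 * (norm y)\<^sup>2) *\<^sub>R 1"
    by (simp add: mult_qcnj_norm(1))
  finally have "(norm (x * y))\<^sup>2 = (norm x * norm y)\<^sup>2"
    by (simp add: quat_eq_iff power_mult_distrib)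
  then show ?thesis
    by (simp add: power2_eq_iff_nonneg)
qed

instance quat :: real_normed_algebra_1
proof
  fix x y :: quat
  show "norm (x * y) \<le> norm x * norm y"
    by (simp add: norm_quat_mult)
  show "norm (1 :: quat) = 1"
    by (simp add: norm_eq_sqrt_inner inner_quat_def)
qed

text \<open>Supplies Heine-Borel, for the compactness behind the existence of eigenvectors, and
  completeness, for the convergence of form values along Cauchy sequences.\<close>

instantiation quat :: euclidean_space
begin

definition Basis_quat :: "quat set" where
  "Basis_quat = {Quat 1 0 0 0, Quat 0 1 0 0, Quat 0 0 1 0, Quat 0 0 0 1}"

instance
proof
  fix x u v :: quat
  show "(Basis :: quat set) \<noteq> {}" "finite (Basis :: quat set)"
    by (simp_all add: Basis_quat_def)
  show "inner u v = (if u = v then 1 else 0)" if "u \<in> Basis" "v \<in> Basis"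
    using that unfolding Basis_quat_def inner_quat_def
    by (elim insertE emptyE; simp)
  show "(\<forall>u\<in>Basis. inner x u = 0) \<longleftrightarrow> x = 0"
    by (simp add: Basis_quat_def inner_quat_def quat_eq_iff [of x 0])
qed

end

lemma quat_parts_of_real [simp]:
  "qRe (of_real a) = a" "qI (of_real a) = 0" "qJ (of_real a) = 0" "qK (of_real a) = 0"
  by (simp_all add: of_real_def)

lemma qcnj_simps [simp]:
  "qcnj 0 = 0" "qcnj 1 = 1" "qcnj (of_real a) = of_real a" "qcnj (qcnj x) = x"
  "qcnj (x + y) = qcnj x + qcnj y" "qcnj (x - y) = qcnj x - qcnj y" "qcnj (- x) = - qcnj x"
  by (simp_all add: quat_eq_iff)

lemma qcnj_eq_0_iff [simp]: "qcnj x = 0 \<longleftrightarrow> x = 0"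
  by (simp add: quat_eq_iff)

lemma qcnj_sum: "qcnj (sum f A) = (\<Sum>i\<in>A. qcnj (f i))"
  by (induction A rule: infinite_finite_induct) auto

lemma qRe_sum: "qRe (sum f A) = (\<Sum>i\<in>A. qRe (f i))"
  by (induction A rule: infinite_finite_induct) auto

lemma norm_qcnj [simp]: "norm (qcnj x) = norm x"
  by (simp add: norm_eq_sqrt_inner inner_quat_def)

lemma quat_inverse_ex:
  assumes "x \<noteq> (0 :: quat)"
  obtains y where "x * y = 1" "y * x = 1"
proof
  have "norm x \<noteq> 0"
    using assms by simp
  then show "x * (inverse ((norm x)\<^sup>2) *\<^sub>R qcnj x) = 1"
    "(inverse ((norm x)\<^sup>2) *\<^sub>R qcnj x) * x = 1"
    by (simp_all add: mult_qcnj_norm of_real_def)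
qed

lemma quat_mult_eq_0_iff [simp]: "x * y = 0 \<longleftrightarrow> x = 0 \<or> y = 0" for x y :: quat
  by (metis norm_eq_zero mult_eq_0_iff norm_quat_mult)

lemma qRe_le_norm: "qRe x \<le> norm x" "\<bar>qRe x\<bar> \<le> norm x"
proof -
  have "qRe x = inner x 1"
    by (simp add: inner_quat_def)
  then show "\<bar>qRe x\<bar> \<le> norm x"
    using Cauchy_Schwarz_ineq2 [of x 1] by simp
  then show "qRe x \<le> norm x"
    by simp
qed

lemma tendsto_qRe: "(f \<longlongrightarrow> l) F \<Longrightarrow> ((\<lambda>x. qRe (f x)) \<longlongrightarrow> qRe l) F"
proof -
  have "qRe x = inner x 1" for x
    by (simp add: inner_quat_def)
  then show "(f \<longlongrightarrow> l) F \<Longrightarrow> ((\<lambda>x. qRe (f x)) \<longlongrightarrow> qRe l) F"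
    by (simp add: tendsto_inner)
qed

lemma tendsto_qcnj: "(f \<longlongrightarrow> l) F \<Longrightarrow> ((\<lambda>x. qcnj (f x)) \<longlongrightarrow> qcnj l) F"
proof -
  assume "(f \<longlongrightarrow> l) F"
  then have "((\<lambda>x. norm (f x - l)) \<longlongrightarrow> 0) F"
    using LIM_zero tendsto_norm_zero by blast
  moreover have "norm (f x - l) = norm (qcnj (f x) - qcnj l)" for x
    by (metis norm_qcnj qcnj_simps(6))
  ultimately show ?thesis
    using LIM_zero_cancel tendsto_norm_zero_cancel by fastforce
qed

lemma continuous_on_qRe [continuous_intros]:
  "continuous_on S f \<Longrightarrow> continuous_on S (\<lambda>x. qRe (f x))"
  by (simp add: continuous_on_def tendsto_qRe)

lemma continuous_on_qcnj [continuous_intros]: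
  "continuous_on S f \<Longrightarrow> continuous_on S (\<lambda>x. qcnj (f x))"
  by (simp add: continuous_on_def tendsto_qcnj)

section \<open>Underdetermined linear systems\<close>

text \<open>Gaussian elimination over a skew field. Coefficients stand to the left of the unknowns,
  matching right vector spaces, so equations may be multiplied from the left only. The dimension
  counts below rest on this.\<close>

lemma quat_system_nontrivial:
  fixes a :: "'i \<Rightarrow> 'j \<Rightarrow> quat"
  assumes "finite I" "finite J" "card I < card J"
  shows "\<exists>c. (\<exists>j\<in>J. c j \<noteq> 0) \<and> (\<forall>i\<in>I. (\<Sum>j\<in>J. a i j * c j) = 0)"
  using assms
proof (induction I arbitrary: J a rule: finite_induct)
  case empty
  then obtain j where "j \<in> J"
    by fastforce
  then show ?case
    by (intro exI [of _ "\<lambda>_. 1"]) auto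
next
  case (insert i0 I)
  show ?case
  proof (cases "\<forall>j\<in>J. a i0 j = 0")
    case True
    then show ?thesis
      using insert.IH [of J a] insert.hyps insert.prems by auto
  next
    case False
    then obtain j0 where j0: "j0 \<in> J" "a i0 j0 \<noteq> 0"
      by blast
    then obtain y where y: "a i0 j0 * y = 1" "y * a i0 j0 = 1"
      using quat_inverse_ex by blast
    \<comment> \<open>Row \<open>i\<close> minus \<open>a i j0 * y\<close> times the pivot row: the
      unknown \<open>j0\<close> is eliminated.\<close>
    define b where "b i j = a i j - a i j0 * y * a i0 j" for i j
    have "card I < card (J - {j0})"
      using insert j0 by (simp add: card_Diff_singleton)
    then obtain c where c: "\<exists>j\<in>J - {j0}. c j \<noteq> 0"
      "\<forall>i\<in>I. (\<Sum>j\<in>J - {j0}. b i j * c j) = 0"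
      using insert.IH [of "J - {j0}" b] insert.prems by blast
    define s where "s = (\<Sum>j\<in>J - {j0}. a i0 j * c j)"
    \<comment> \<open>The value at \<open>j0\<close> is obtained by solving the pivot equation, with
      \<open>y\<close> the inverse of the pivot.\<close>
    define d where "d = c(j0 := - (y * s))"
    have split: "(\<Sum>j\<in>J. a i j * d j) = (\<Sum>j\<in>J - {j0}. a i j * c j) - a i j0 * y * s" for i
    proof -
      have "(\<Sum>j\<in>J. a i j * d j) = a i j0 * d j0 + (\<Sum>j\<in>J - {j0}. a i j * d j)"
        using insert.prems j0 by (meson sum.remove)
      also have "(\<Sum>j\<in>J - {j0}. a i j * d j) = (\<Sum>j\<in>J - {j0}. a i j * c j)"
        by (rule sum.cong) (auto simp: d_def)
      finally show ?thesis
        by (simp add: d_def mult.assoc)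
    qed
    have "(\<Sum>j\<in>J. a i j * d j) = 0" if "i \<in> I" for i
    proof -
      have "0 = (\<Sum>j\<in>J - {j0}. b i j * c j)"
        using c that by simp
      also have "\<dots> = (\<Sum>j\<in>J - {j0}. a i j * c j) - a i j0 * y * s"
        by (simp add: b_def s_def left_diff_distrib sum_subtractf sum_distrib_left mult.assoc)
      finally show ?thesis
        using split by simp
    qed
    moreover have "(\<Sum>j\<in>J. a i0 j * d j) = 0"
      unfolding split using y by (simp add: s_def)
    moreover have "\<exists>j\<in>J. d j \<noteq> 0"
      using c(1) by (auto simp: d_def)
    ultimately show ?thesis
      by blast
  qed
qed

section \<open>Hermitian spaces\<close>

locale qhermitian =
  fixes P :: "'a::ab_group_add qspace"
  assumes vs: "right_qvector_space P" and hf: "hermitian_form P"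
begin

abbreviation "V \<equiv> qcarrier P"
abbreviation "B \<equiv> qform P"
abbreviation "sm \<equiv> qsmult P"

lemma zero_mem [simp]: "0 \<in> V"
  and add_mem [simp]: "a \<in> V \<Longrightarrow> b \<in> V \<Longrightarrow> a + b \<in> V"
  and uminus_mem [simp]: "a \<in> V \<Longrightarrow> - a \<in> V"
  and sm_mem [simp]: "a \<in> V \<Longrightarrow> sm a p \<in> V"
  and sm_add_left: "a \<in> V \<Longrightarrow> b \<in> V \<Longrightarrow> sm (a + b) p = sm a p + sm b p"
  and sm_add_right: "a \<in> V \<Longrightarrow> sm a (p + q) = sm a p + sm a q"
  and sm_mult: "a \<in> V \<Longrightarrow> sm a (p * q) = sm (sm a p) q"
  and sm_one [simp]: "a \<in> V \<Longrightarrow> sm a 1 = a"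
  using vs unfolding right_qvector_space_def by blast+

lemma diff_mem [simp]: "a \<in> V \<Longrightarrow> b \<in> V \<Longrightarrow> a - b \<in> V"
  using add_mem [of a "- b"] uminus_mem [of b] by simp

lemma sum_mem [simp]: "(\<And>i. i \<in> J \<Longrightarrow> f i \<in> V) \<Longrightarrow> sum f J \<in> V"
  by (induction J rule: infinite_finite_induct) auto

lemma sm_zero_right [simp]: "a \<in> V \<Longrightarrow> sm a 0 = 0"
  using sm_add_right [of a 0 0] by simp

lemma sm_zero_left [simp]: "sm 0 p = 0"
  using sm_add_left [of 0 0 p] by simp

lemma sm_uminus_right: "a \<in> V \<Longrightarrow> sm a (- p) = - sm a p"
  using sm_add_right [of a p "- p"] by (simp add: eq_neg_iff_add_eq_0 add.commute)

lemma sm_uminus_left: "a \<in> V \<Longrightarrow> sm (- a) p = - sm a p"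
  using sm_add_left [of a "- a" p] by (simp add: eq_neg_iff_add_eq_0 add.commute)

lemma sm_diff_left: "a \<in> V \<Longrightarrow> b \<in> V \<Longrightarrow> sm (a - b) p = sm a p - sm b p"
  using sm_add_left [of a "- b" p] by (simp add: sm_uminus_left)

lemma sm_diff_right: "a \<in> V \<Longrightarrow> sm a (p - q) = sm a p - sm a q"
  using sm_add_right [of a p "- q"] by (simp add: sm_uminus_right)

lemma sm_sum_left: "(\<And>i. i \<in> J \<Longrightarrow> f i \<in> V) \<Longrightarrow> sm (sum f J) p = (\<Sum>i\<in>J. sm (f i) p)"
  by (induction J rule: infinite_finite_induct) (auto simp: sm_add_left)

lemma B_add_left: "a \<in> V \<Longrightarrow> b \<in> V \<Longrightarrow> c \<in> V \<Longrightarrow> B (a + b) c = B a c + B b c"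
  and B_add_right: "a \<in> V \<Longrightarrow> b \<in> V \<Longrightarrow> c \<in> V \<Longrightarrow> B a (b + c) = B a b + B a c"
  and B_cnj: "a \<in> V \<Longrightarrow> b \<in> V \<Longrightarrow> qcnj (B a b) = B b a"
  and B_sm: "a \<in> V \<Longrightarrow> b \<in> V \<Longrightarrow> B (sm a p) (sm b q) = qcnj q * B a b * p"
  using hf unfolding hermitian_form_def by (blast, blast, metis, blast)

lemma B_sm_left: "a \<in> V \<Longrightarrow> b \<in> V \<Longrightarrow> B (sm a p) b = B a b * p"
  using B_sm [of a b p 1] by simp

lemma B_sm_right: "a \<in> V \<Longrightarrow> b \<in> V \<Longrightarrow> B a (sm b q) = qcnj q * B a b"
  using B_sm [of a b 1 q] by simp

lemma B_zero_left [simp]: "c \<in> V \<Longrightarrow> B 0 c = 0"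
  using B_add_left [of 0 0 c] by simp

lemma B_zero_right [simp]: "c \<in> V \<Longrightarrow> B c 0 = 0"
  using B_add_right [of c 0 0] by simp

lemma B_uminus_left: "a \<in> V \<Longrightarrow> c \<in> V \<Longrightarrow> B (- a) c = - B a c"
  using B_add_left [of a "- a" c] by (simp add: eq_neg_iff_add_eq_0 add.commute)

lemma B_uminus_right: "a \<in> V \<Longrightarrow> c \<in> V \<Longrightarrow> B c (- a) = - B c a"
  using B_add_right [of c a "- a"] by (simp add: eq_neg_iff_add_eq_0 add.commute)

lemma B_diff_left: "a \<in> V \<Longrightarrow> b \<in> V \<Longrightarrow> c \<in> V \<Longrightarrow> B (a - b) c = B a c - B b c"
  using B_add_left [of a "- b" c] by (simp add: B_uminus_left)

lemma B_diff_right: "a \<in> V \<Longrightarrow> b \<in> V \<Longrightarrow> c \<in> V \<Longrightarrow> B c (a - b) = B c a - B c b"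
  using B_add_right [of c a "- b"] by (simp add: B_uminus_right)

lemma B_sum_left:
  "(\<And>i. i \<in> J \<Longrightarrow> f i \<in> V) \<Longrightarrow> c \<in> V \<Longrightarrow> B (sum f J) c = (\<Sum>i\<in>J. B (f i) c)"
  by (induction J rule: infinite_finite_induct) (auto simp: B_add_left)

lemma B_sum_right:
  "(\<And>i. i \<in> J \<Longrightarrow> f i \<in> V) \<Longrightarrow> c \<in> V \<Longrightarrow> B c (sum f J) = (\<Sum>i\<in>J. B c (f i))"
  by (induction J rule: infinite_finite_induct) (auto simp: B_add_right)

lemma B_self_real: "a \<in> V \<Longrightarrow> B a a = of_real (qRe (B a a))"
  using B_cnj [of a a] by (simp add: quat_eq_iff)

lemma qRe_B_commute: "a \<in> V \<Longrightarrow> b \<in> V \<Longrightarrow> qRe (B a b) = qRe (B b a)"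
  using B_cnj [of a b] by (metis qcnj.sel(1))

lemma B_eq_0_commute: "a \<in> V \<Longrightarrow> b \<in> V \<Longrightarrow> B a b = 0 \<longleftrightarrow> B b a = 0"
  using B_cnj [of a b] by (metis qcnj_eq_0_iff)

lemma qsubspace_mem: "qsubspace P W \<Longrightarrow> a \<in> W \<Longrightarrow> a \<in> V"
  unfolding qsubspace_def by blast

lemma qsubspace_uminus: "qsubspace P W \<Longrightarrow> a \<in> W \<Longrightarrow> - a \<in> W"
  unfolding qsubspace_def by (metis in_mono sm_one sm_uminus_right)

lemma qsubspace_diff: "qsubspace P W \<Longrightarrow> a \<in> W \<Longrightarrow> b \<in> W \<Longrightarrow> a - b \<in> W"
  using qsubspace_uminus [of W b] unfolding qsubspace_def by (metis add_uminus_conv_diff)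

lemma qsubspace_sum: "qsubspace P W \<Longrightarrow> (\<And>i. i \<in> J \<Longrightarrow> f i \<in> W) \<Longrightarrow> sum f J \<in> W"
  by (induction J rule: infinite_finite_induct) (auto simp: qsubspace_def)

lemma qspan_subset: "A \<subseteq> W \<Longrightarrow> qsubspace P W \<Longrightarrow> qspan P A \<subseteq> W"
  unfolding qspan_def by (rule hull_minimal)

lemma qspan_superset: "A \<subseteq> qspan P A"
  unfolding qspan_def by (rule hull_subset)

lemma qsubspace_V: "qsubspace P V"
  unfolding qsubspace_def by simp

text \<open>A hull is an intersection. For \<open>A\<close> inside the carrier, the carrier is one
  of the intersected subspaces; otherwise the family would be empty and the hull the whole
  type.\<close>

lemma qsubspace_qspan: "A \<subseteq> V \<Longrightarrow> qsubspace P (qspan P A)"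
proof -
  assume A: "A \<subseteq> V"
  have "qsubspace P (\<Inter>{W. qsubspace P W \<and> A \<subseteq> W})"
    unfolding qsubspace_def
  proof (intro conjI)
    show "\<Inter>{W. (W \<subseteq> V \<and> 0 \<in> W \<and> (\<forall>a\<in>W. \<forall>b\<in>W. a + b \<in> W) \<and>
        (\<forall>a\<in>W. \<forall>p. sm a p \<in> W)) \<and> A \<subseteq> W} \<subseteq> V"
      using A by (intro Inter_lower) simp
  qed simp_all
  then show ?thesis
    unfolding qspan_def hull_def .
qed

lemma hermitian_carrier:
  assumes "qsubspace P W"
  shows "qhermitian (P\<lparr>qcarrier := W\<rparr>)"
proof
  note W = qsubspace_mem [OF assms] qsubspace_uminus [OF assms]
  show "right_qvector_space (P\<lparr>qcarrier := W\<rparr>)"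
    using assms W sm_add_left sm_add_right sm_mult
    unfolding right_qvector_space_def qsubspace_def by simp
  show "hermitian_form (P\<lparr>qcarrier := W\<rparr>)"
    unfolding hermitian_form_def using W by (simp add: B_add_left B_add_right B_cnj B_sm)
qed

end

text \<open>The discriminant criterion without a sign condition on \<open>c\<close>. It gives
  Cauchy-Schwarz for a semidefinite product and, with \<open>a = 0\<close>, the first-order
  condition at a maximum of the Rayleigh quotient.\<close>

lemma quadratic_nonneg_imp:
  fixes a b c :: real
  assumes "\<And>t. 0 \<le> a + 2 * t * b + t\<^sup>2 * c"
  shows "b\<^sup>2 \<le> a * c"
proof (cases "c = 0")
  case True
  have "b = 0"
  proof (rule ccontr)
    assume "b \<noteq> 0"
    then show False
      \<comment> \<open>At this point the affine function \<open>a + 2 * t * b\<close> takes the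
        value -1.\<close>
      using assms [of "- (a + 1) / (2 * b)"] True by (simp add: field_simps)
  qed
  then show ?thesis
    using True by simp
next
  case False
  have "0 \<le> c"
  proof (rule ccontr)
    assume "\<not> 0 \<le> c"
    \<comment> \<open>Adding the inequalities at \<open>s\<close> and \<open>- s\<close> removes the
      linear term; since \<open>s \<ge> 1\<close> and \<open>c < 0\<close>, the square term is at
      most \<open>s * c\<close>, which is below \<open>- \<bar>a\<bar>\<close>.\<close>
    define s where "s = (\<bar>a\<bar> + 1) / (- c) + 1"
    have s: "s \<ge> 1" "s * c = c - \<bar>a\<bar> - 1"
      using \<open>\<not> 0 \<le> c\<close> by (auto simp: s_def field_simps)
    have "a + s\<^sup>2 * c \<ge> 0"
      using assms [of s] assms [of "- s"] by simp
    moreover have "s\<^sup>2 * c \<le> s * c"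
      using s \<open>\<not> 0 \<le> c\<close> by (intro mult_right_mono_neg) (auto simp: power2_eq_square)
    ultimately show False
      using s(2) \<open>\<not> 0 \<le> c\<close> abs_ge_self [of a] by linarith
  qed
  then have "c > 0"
    using False by simp
  have "0 \<le> c * (a + 2 * (- b / c) * b + (- b / c)\<^sup>2 * c)"
    using assms [of "- b / c"] \<open>0 \<le> c\<close> by (simp add: mult_nonneg_nonneg)
  also have "\<dots> = a * c - b\<^sup>2"
    using \<open>c > 0\<close> by (simp add: field_simps power2_eq_square)
  finally show ?thesis
    by simp
qed

text \<open>The vectors \<open>e k\<close> span a maximal negative subspace; \<open>P\<close> may be degenerate and incomplete.
  A Pontryagin space is the definite and complete case.\<close>

locale pre_pontryagin = qhermitian P for P :: "'a::ab_group_add qspace" +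
  fixes I :: "'i set" and e :: "'i \<Rightarrow> 'a"
  assumes finite_I [simp]: "finite I"
    and e_mem [simp]: "k \<in> I \<Longrightarrow> e k \<in> V"
    and e_orth: "k \<in> I \<Longrightarrow> l \<in> I \<Longrightarrow> B (e k) (e l) = (if k = l then - 1 else 0)"
    and orth_nonneg: "x \<in> V \<Longrightarrow> (\<And>k. k \<in> I \<Longrightarrow> B x (e k) = 0) \<Longrightarrow> 0 \<le> qRe (B x x)"
begin

text \<open>The orthogonal projection onto the span of the \<open>e k\<close>; the outer minus
  compensates for \<open>B (e k) (e k) = - 1\<close>.\<close>

definition neg_part :: "'a \<Rightarrow> 'a" where
  "neg_part x = - (\<Sum>k\<in>I. sm (e k) (B x (e k)))"

lemma neg_part_mem [simp]: "neg_part x \<in> V"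
  unfolding neg_part_def by simp

lemma B_neg_part_e: "x \<in> V \<Longrightarrow> l \<in> I \<Longrightarrow> B (neg_part x) (e l) = B x (e l)"
  by (simp add: neg_part_def B_uminus_left B_sum_left B_sm_left e_orth if_distrib
      [of "\<lambda>u. u * _"] cong: if_cong)

lemma B_neg_part: "x \<in> V \<Longrightarrow> y \<in> V \<Longrightarrow> B (neg_part x) y = - (\<Sum>k\<in>I. B (e k) y * B x (e k))"
  by (simp add: neg_part_def B_uminus_left B_sum_left B_sm_left)

lemma B_neg_part_neg_part: "x \<in> V \<Longrightarrow> y \<in> V \<Longrightarrow> B (neg_part x) (neg_part y) = B (neg_part x) y"
proof -
  assume x: "x \<in> V" "y \<in> V"
  have "B (e k) (neg_part y) = B (e k) y" if "k \<in> I" for k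
    using x that B_neg_part_e [of y k] B_cnj [of _ "e k"] by (metis e_mem neg_part_mem)
  then show ?thesis
    using x by (simp add: B_neg_part)
qed

text \<open>The real part of the positive semidefinite product associated with the decomposition.\<close>

definition rip :: "'a \<Rightarrow> 'a \<Rightarrow> real" where
  "rip x y = qRe (B x y) + 2 * (\<Sum>k\<in>I. inner (B x (e k)) (B y (e k)))"

definition hn :: "'a \<Rightarrow> real" where
  "hn x = sqrt (rip x x)"

lemma rip_commute: "x \<in> V \<Longrightarrow> y \<in> V \<Longrightarrow> rip x y = rip y x"
  unfolding rip_def by (simp add: qRe_B_commute inner_commute)

lemma rip_add_left: "x \<in> V \<Longrightarrow> y \<in> V \<Longrightarrow> z \<in> V \<Longrightarrow> rip (x + y) z = rip x z + rip y z"
  unfolding rip_def by (simp add: B_add_left inner_add_left sum.distrib)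

lemma rip_add_right: "x \<in> V \<Longrightarrow> y \<in> V \<Longrightarrow> z \<in> V \<Longrightarrow> rip z (x + y) = rip z x + rip z y"
  unfolding rip_def by (simp add: B_add_left B_add_right inner_add_right sum.distrib)

lemma rip_real_left: "x \<in> V \<Longrightarrow> y \<in> V \<Longrightarrow> rip (sm x (of_real t)) y = t * rip x y"
proof -
  assume x: "x \<in> V" "y \<in> V"
  have "inner (u * of_real t) v = t * inner u v" for u v :: quat
    by (simp add: inner_quat_def algebra_simps)
  then show ?thesis
    using x unfolding rip_def by (simp add: B_sm_left sum_distrib_left algebra_simps)
qed

lemma rip_real_right: "x \<in> V \<Longrightarrow> y \<in> V \<Longrightarrow> rip y (sm x (of_real t)) = t * rip y x"
  by (metis rip_commute rip_real_left sm_mem)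

lemma rip_self: "x \<in> V \<Longrightarrow> rip x x = qRe (B x x) + 2 * (\<Sum>k\<in>I. (norm (B x (e k)))\<^sup>2)"
  unfolding rip_def by (simp add: power2_norm_eq_inner)

text \<open>The residual \<open>x - neg_part x\<close> is orthogonal to every \<open>e k\<close>,
  hence has nonnegative square, and this square is [x,x] plus the sum of the squared coefficients.
  The second copy of the sum in \<open>rip\<close> is what remains on the left.\<close>

lemma sum_le_rip: "x \<in> V \<Longrightarrow> (\<Sum>k\<in>I. (norm (B x (e k)))\<^sup>2) \<le> rip x x"
proof -
  assume x: "x \<in> V"
  have "B (x - neg_part x) (x - neg_part x) = B x x - B (neg_part x) x"
    using x by (simp add: B_diff_left B_diff_right B_neg_part_neg_part)
       (metis B_cnj B_neg_part_neg_part neg_part_mem)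
  moreover have "0 \<le> qRe (B (x - neg_part x) (x - neg_part x))"
    using x by (intro orth_nonneg) (auto simp: B_diff_left B_neg_part_e)
  moreover have "B (neg_part x) x = - (\<Sum>k\<in>I. (norm (B x (e k)))\<^sup>2 *\<^sub>R 1)"
    using x by (simp add: B_neg_part B_cnj [symmetric, of "e _"] mult_qcnj_norm)
  then have "qRe (B (neg_part x) x) = - (\<Sum>k\<in>I. (norm (B x (e k)))\<^sup>2)"
    by (simp add: qRe_sum)
  ultimately have "0 \<le> qRe (B x x) + (\<Sum>k\<in>I. (norm (B x (e k)))\<^sup>2)"
    by simp
  then show ?thesis
    using x by (simp add: rip_self)
qed

lemma rip_nonneg: "x \<in> V \<Longrightarrow> 0 \<le> rip x x"
  using sum_le_rip [of x] by (meson dual_order.trans sum_nonneg zero_le_power2)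

lemma hn_nonneg: "x \<in> V \<Longrightarrow> 0 \<le> hn x"
  unfolding hn_def by (simp add: rip_nonneg)

lemma hn_power2: "x \<in> V \<Longrightarrow> (hn x)\<^sup>2 = qRe (B x x) + 2 * (\<Sum>k\<in>I. (norm (B x (e k)))\<^sup>2)"
  unfolding hn_def using rip_nonneg [of x] by (simp add: rip_self)

lemma norm_B_e_le: "x \<in> V \<Longrightarrow> k \<in> I \<Longrightarrow> norm (B x (e k)) \<le> hn x"
proof -
  assume x: "x \<in> V" "k \<in> I"
  have "(norm (B x (e k)))\<^sup>2 \<le> (\<Sum>k\<in>I. (norm (B x (e k)))\<^sup>2)"
    using x by (intro member_le_sum) auto
  then have "(norm (B x (e k)))\<^sup>2 \<le> rip x x"
    using sum_le_rip x by fastforce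
  then show ?thesis
    unfolding hn_def using real_le_rsqrt by blast
qed

lemma sqrt_B_le_hn: "x \<in> V \<Longrightarrow> sqrt (qRe (B x x)) \<le> hn x"
  unfolding hn_def by (simp add: rip_self sum_nonneg [of I])

lemma rip_le_hn: "x \<in> V \<Longrightarrow> y \<in> V \<Longrightarrow> \<bar>rip x y\<bar> \<le> hn x * hn y"
proof -
  assume x: "x \<in> V" "y \<in> V"
  have "0 \<le> rip x x + 2 * t * rip x y + t\<^sup>2 * rip y y" for t
  proof -
    let ?z = "x + sm y (of_real t)"
    have "rip ?z ?z = rip x x + 2 * t * rip x y + t\<^sup>2 * rip y y"
      using x by (simp add: rip_add_left rip_add_right rip_real_left
          rip_real_right rip_commute [of y x] power2_eq_square algebra_simps)
    then show ?thesis
      using x rip_nonneg [of ?z] by simp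
  qed
  then have "(rip x y)\<^sup>2 \<le> rip x x * rip y y"
    by (rule quadratic_nonneg_imp)
  then have "\<bar>rip x y\<bar> \<le> sqrt (rip x x * rip y y)"
    by (simp add: real_le_rsqrt)
  then show ?thesis
    by (simp add: hn_def real_sqrt_mult)
qed

lemma hn_triangle: "x \<in> V \<Longrightarrow> y \<in> V \<Longrightarrow> hn (x + y) \<le> hn x + hn y"
proof -
  assume x: "x \<in> V" "y \<in> V"
  have "rip (x + y) (x + y) = (hn x)\<^sup>2 + 2 * rip x y + (hn y)\<^sup>2"
    using x by (simp add: rip_add_left rip_add_right rip_commute [of y x] hn_def rip_nonneg)
  also have "\<dots> \<le> (hn x + hn y)\<^sup>2"
    using rip_le_hn [OF x] by (simp add: power2_sum)
  finally show ?thesis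
    using x by (simp add: hn_def real_le_lsqrt rip_nonneg)
qed

lemma hn_zero [simp]: "hn 0 = 0"
  by (simp add: hn_def rip_def)

lemma hn_uminus [simp]: "x \<in> V \<Longrightarrow> hn (- x) = hn x"
  by (simp add: hn_def rip_def B_uminus_left B_uminus_right)

lemma hn_diff_commute: "x \<in> V \<Longrightarrow> y \<in> V \<Longrightarrow> hn (x - y) = hn (y - x)"
  using hn_uminus [of "x - y"] by simp

lemma hn_diff_triangle: "x \<in> V \<Longrightarrow> y \<in> V \<Longrightarrow> z \<in> V \<Longrightarrow> hn (x - z) \<le> hn (x - y) + hn (y - z)"
  using hn_triangle [of "x - y" "y - z"] by simp

lemma hn_sum_le: "(\<And>j. j \<in> J \<Longrightarrow> f j \<in> V) \<Longrightarrow> hn (sum f J) \<le> (\<Sum>j\<in>J. hn (f j))"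
proof (induction J rule: infinite_finite_induct)
  case (insert j J)
  then show ?case
    using hn_triangle [of "f j" "sum f J"] by fastforce
qed auto

lemma hn_sm: "x \<in> V \<Longrightarrow> hn (sm x q) = hn x * norm q"
proof -
  assume x: "x \<in> V"
  have "qcnj q * B x x * q = qRe (B x x) *\<^sub>R (qcnj q * q)"
    by (subst B_self_real [OF x]) (simp add: of_real_def)
  then have "qRe (B (sm x q) (sm x q)) = (norm q)\<^sup>2 * qRe (B x x)"
    using x by (simp add: mult_qcnj_norm B_sm)
  moreover have "(\<Sum>k\<in>I. (norm (B (sm x q) (e k)))\<^sup>2) = (norm q)\<^sup>2 * (\<Sum>k\<in>I. (norm (B x (e k)))\<^sup>2)"
    using x by (simp add: B_sm_left norm_quat_mult power_mult_distrib sum_distrib_left mult.commute)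
  ultimately have "(hn (sm x q))\<^sup>2 = (hn x * norm q)\<^sup>2"
    using x by (simp add: hn_power2 power_mult_distrib algebra_simps)
  then show ?thesis
    using x by (simp add: power2_eq_iff_nonneg hn_nonneg)
qed

text \<open>The real part of \<open>B x y\<close> is \<open>rip x y\<close> minus twice a sum of
  \<open>card I\<close> inner products, and each of these quantities is at most
  \<open>hn x * hn y\<close>.\<close>

definition cB :: real where
  "cB = 1 + 2 * real (card I)"

lemma cB_pos: "0 < cB"
  unfolding cB_def by simp

lemma norm_B_le: "x \<in> V \<Longrightarrow> y \<in> V \<Longrightarrow> norm (B x y) \<le> cB * hn x * hn y"
proof -
  assume x: "x \<in> V" "y \<in> V"
  have re: "\<bar>qRe (B x y)\<bar> \<le> cB * hn x * hn y" if "y \<in> V" for y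
  proof -
    have "\<bar>\<Sum>k\<in>I. inner (B x (e k)) (B y (e k))\<bar> \<le> (\<Sum>k\<in>I. hn x * hn y)"
    proof (rule order_trans [OF sum_abs sum_mono])
      fix k assume "k \<in> I"
      then have "norm (B x (e k)) * norm (B y (e k)) \<le> hn x * hn y"
        using x that norm_B_e_le hn_nonneg by (intro mult_mono) auto
      then show "\<bar>inner (B x (e k)) (B y (e k))\<bar> \<le> hn x * hn y"
        using Cauchy_Schwarz_ineq2 order_trans by blast
    qed
    then have "\<bar>\<Sum>k\<in>I. inner (B x (e k)) (B y (e k))\<bar> \<le> real (card I) * (hn x * hn y)"
      by simp
    moreover have "\<bar>rip x y\<bar> \<le> hn x * hn y"
      using x that by (intro rip_le_hn)
    ultimately show ?thesis
      unfolding rip_def cB_def by (simp add: algebra_simps)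
  qed
  \<comment> \<open>Multiplying \<open>y\<close> by \<open>?q\<close> turns the form value into the
    real number \<open>(norm ?q)\<^sup>2\<close>, so the bound on real parts suffices; one factor
    \<open>norm ?q\<close> is then cancelled.\<close>
  let ?q = "B x y"
  have "(norm ?q)\<^sup>2 = qRe (B x (sm y ?q))"
    using x by (simp add: B_sm_right mult_qcnj_norm)
  also have "\<dots> \<le> cB * hn x * (hn y * norm ?q)"
    using re [of "sm y ?q"] x by (simp add: hn_sm)
  finally have "norm ?q * norm ?q \<le> (cB * hn x * hn y) * norm ?q"
    by (simp add: power2_eq_square)
  then show ?thesis
    using x cB_pos by (cases "norm ?q = 0") (auto simp: hn_nonneg mult_le_cancel_right)
qed

text \<open>The inertia argument: were there more \<open>x j\<close> than \<open>e k\<close>, some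
  nontrivial combination would be orthogonal to all \<open>e k\<close> and so have nonnegative
  square. Its square is the sum of the \<open>d j * (norm (c j))\<^sup>2\<close>, which is
  negative.\<close>

lemma neg_count:
  assumes "finite J" "\<And>j. j \<in> J \<Longrightarrow> x j \<in> V"
    and "\<And>j l. j \<in> J \<Longrightarrow> l \<in> J \<Longrightarrow> B (x j) (x l) = (if j = l then of_real (d j) else 0)"
    and "\<And>j. j \<in> J \<Longrightarrow> d j < 0"
  shows "card J \<le> card I"
proof (rule ccontr)
  assume "\<not> card J \<le> card I"
  then obtain c where c: "\<exists>j\<in>J. c j \<noteq> 0" "\<forall>i\<in>I. (\<Sum>j\<in>J. B (x j) (e i) * c j) = 0"
    using quat_system_nontrivial [of I J "\<lambda>i j. B (x j) (e i)"] assms by auto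
  define z where "z = (\<Sum>j\<in>J. sm (x j) (c j))"
  have z: "z \<in> V"
    using assms by (simp add: z_def)
  have "B z (e i) = 0" if "i \<in> I" for i
    using c(2) that assms by (simp add: z_def B_sum_left B_sm_left)
  then have "0 \<le> qRe (B z z)"
    using z by (intro orth_nonneg)
  have zl: "B z (x l) = of_real (d l) * c l" if "l \<in> J" for l
    using that assms by (simp add: z_def B_sum_left B_sm_left if_distrib [of "\<lambda>u. u * _"] cong: if_cong)
  have "B z z = (\<Sum>l\<in>J. qcnj (c l) * B z (x l))"
    using assms z by (subst (2) z_def) (simp add: B_sum_right B_sm_right)
  also have "\<dots> = (\<Sum>l\<in>J. of_real (d l * (norm (c l))\<^sup>2))"
  proof (rule sum.cong)
    fix l assume "l \<in> J"
    have "qcnj (c l) * (of_real (d l) * c l) = d l *\<^sub>R (qcnj (c l) * c l)"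
      by (simp add: of_real_def)
    also have "\<dots> = of_real (d l * (norm (c l))\<^sup>2)"
      by (simp only: mult_qcnj_norm) (simp add: of_real_def)
    finally show "qcnj (c l) * B z (x l) = of_real (d l * (norm (c l))\<^sup>2)"
      using zl \<open>l \<in> J\<close> by simp
  qed simp
  finally have "qRe (B z z) = (\<Sum>l\<in>J. d l * (norm (c l))\<^sup>2)"
    by (simp add: qRe_sum del: of_real_mult of_real_power)
  also have "\<dots> < (\<Sum>l\<in>J. 0)"
  proof (rule sum_strict_mono_ex1)
    show "\<forall>l\<in>J. d l * (norm (c l))\<^sup>2 \<le> 0"
      using assms(4) by (simp add: mult_nonpos_nonneg less_imp_le)
    show "\<exists>l\<in>J. d l * (norm (c l))\<^sup>2 < 0"
      using assms(4) c(1) by (meson mult_neg_pos zero_less_norm_iff zero_less_power)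
  qed (use assms in auto)
  finally show False
    using \<open>0 \<le> qRe (B z z)\<close> by simp
qed

end

section \<open>Diagonalization of Hermitian quaternionic matrices\<close>

text \<open>Serves for two forms on the same vectors: the standard inner product when the matrix is
  the identity, and the form of \<open>T\<close> itself. Extension by zero off \<open>I\<close>
  makes a vector determined by its entries in \<open>I\<close>.\<close>

definition mspace :: "'i set \<Rightarrow> ('i \<Rightarrow> 'i \<Rightarrow> quat) \<Rightarrow> ('i \<Rightarrow> quat) qspace" where
  "mspace I T = \<lparr>qcarrier = {x. \<forall>i. i \<notin> I \<longrightarrow> x i = 0}, qsmult = \<lambda>x p i. x i * p,
     qform = \<lambda>x y. \<Sum>i\<in>I. \<Sum>j\<in>I. qcnj (y i) * T i j * x j\<rparr>"

lemma qhermitian_mspace: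
  assumes "\<And>i j. i \<in> I \<Longrightarrow> j \<in> I \<Longrightarrow> T i j = qcnj (T j i)"
  shows "qhermitian (mspace I T)"
proof
  show "right_qvector_space (mspace I T)"
    unfolding right_qvector_space_def mspace_def
    by (auto simp: fun_eq_iff distrib_left distrib_right mult.assoc)
  have T: "qcnj (T i j) = T j i" if "i \<in> I" "j \<in> I" for i j
    using assms [OF that] by (metis qcnj_simps(4))
  have "(\<Sum>i\<in>I. \<Sum>j\<in>I. qcnj (b i) * T i j * a j)
      = qcnj (\<Sum>i\<in>I. \<Sum>j\<in>I. qcnj (a i) * T i j * b j)" for a b
  proof -
    have "qcnj (\<Sum>i\<in>I. \<Sum>j\<in>I. qcnj (a i) * T i j * b j)
        = (\<Sum>i\<in>I. \<Sum>j\<in>I. qcnj (b j) * T j i * a i)"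
      using T by (auto simp: qcnj_sum qcnj_mult mult.assoc intro!: sum.cong)
    also have "\<dots> = (\<Sum>i\<in>I. \<Sum>j\<in>I. qcnj (b i) * T i j * a j)"
      by (rule sum.swap)
    finally show ?thesis by simp
  qed
  note cnj = this
  show "hermitian_form (mspace I T)"
    unfolding hermitian_form_def
  proof (intro conjI ballI allI)
    fix a b
    show "qform (mspace I T) a b = qcnj (qform (mspace I T) b a)"
      using cnj [of b a] by (simp add: mspace_def)
  qed (simp_all add: mspace_def distrib_left distrib_right sum.distrib qcnj_mult mult.assoc
        sum_distrib_left sum_distrib_right)
qed

lemma mspace_form_id:
  "finite I \<Longrightarrow> qform (mspace I (\<lambda>i j. if i = j then 1 else 0)) x y = (\<Sum>i\<in>I. qcnj (y i) * x i)"
  unfolding mspace_def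
  by (simp add: if_distrib [of "\<lambda>u. _ * u"] if_distrib [of "\<lambda>u. u * _"] cong: if_cong)

text \<open>Tychonoff, with the coordinates outside \<open>I\<close> confined to a point. In the
  product topology coordinates are continuous, hence so are the finite sums that define the
  forms.\<close>

lemma compact_unit_functions:
  "compact {x :: 'i \<Rightarrow> quat. \<forall>i. x i \<in> (if i \<in> I then cball 0 1 else {0})}"
proof -
  have "compactin (product_topology (\<lambda>i. euclidean) UNIV)
      (PiE UNIV (\<lambda>i :: 'i. if i \<in> I then cball (0 :: quat) 1 else {0}))"
    by (subst compactin_PiE) (auto simp: compactin_euclidean_iff)
  then have "compact (PiE UNIV (\<lambda>i :: 'i. if i \<in> I then cball (0 :: quat) 1 else {0}))"
    by (simp add: euclidean_product_topology compactin_euclidean_iff)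
  moreover have "PiE UNIV (\<lambda>i :: 'i. if i \<in> I then cball (0 :: quat) 1 else {0})
      = {x. \<forall>i. x i \<in> (if i \<in> I then cball 0 1 else {0})}"
    unfolding PiE_UNIV_domain Pi_def by blast
  ultimately show ?thesis
    by (simp only:)
qed

locale hmatrix =
  fixes I :: "'i set" and T :: "'i \<Rightarrow> 'i \<Rightarrow> quat"
  assumes finI [simp]: "finite I"
    and herm: "i \<in> I \<Longrightarrow> j \<in> I \<Longrightarrow> T i j = qcnj (T j i)"
begin

definition ip :: "('i \<Rightarrow> quat) \<Rightarrow> ('i \<Rightarrow> quat) \<Rightarrow> quat" where
  "ip = qform (mspace I (\<lambda>i j. if i = j then 1 else 0))"

definition tf :: "('i \<Rightarrow> quat) \<Rightarrow> ('i \<Rightarrow> quat) \<Rightarrow> quat" where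
  "tf = qform (mspace I T)"

definition app :: "('i \<Rightarrow> quat) \<Rightarrow> 'i \<Rightarrow> quat" where
  "app x i = (if i \<in> I then \<Sum>j\<in>I. T i j * x j else 0)"

definition C :: "('i \<Rightarrow> quat) set" where
  "C = {x. \<forall>i. i \<notin> I \<longrightarrow> x i = 0}"

definition smul :: "('i \<Rightarrow> quat) \<Rightarrow> quat \<Rightarrow> 'i \<Rightarrow> quat" where
  "smul x p = (\<lambda>i. x i * p)"

sublocale ips: qhermitian "mspace I (\<lambda>i j. if i = j then 1 else 0)"
  rewrites "qform (mspace I (\<lambda>i j. if i = j then 1 else 0)) = ip"
    and "qcarrier (mspace I (\<lambda>i j. if i = j then 1 else 0)) = C"
    and "qsmult (mspace I (\<lambda>i j. if i = j then 1 else 0)) = smul"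
proof -
  show "qhermitian (mspace I (\<lambda>i j. if i = j then 1 else 0))"
    by (rule qhermitian_mspace) auto
qed (simp_all add: ip_def C_def smul_def mspace_def fun_eq_iff)

sublocale tfs: qhermitian "mspace I T"
  rewrites "qform (mspace I T) = tf"
    and "qcarrier (mspace I T) = C"
    and "qsmult (mspace I T) = smul"
proof -
  show "qhermitian (mspace I T)"
    by (rule qhermitian_mspace) (fact herm)
qed (simp_all add: tf_def C_def smul_def mspace_def fun_eq_iff)

lemma ip_eq: "ip x y = (\<Sum>i\<in>I. qcnj (y i) * x i)"
  unfolding ip_def by (simp add: mspace_form_id)

lemma tf_eq: "tf x y = (\<Sum>i\<in>I. \<Sum>j\<in>I. qcnj (y i) * T i j * x j)"
  unfolding tf_def by (simp add: mspace_def)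

lemma tf_app: "tf x y = ip (app x) y"
  unfolding tf_eq ip_eq by (simp add: app_def sum_distrib_left mult.assoc)

lemma app_mem [simp]: "app x \<in> C"
  by (simp add: app_def C_def)

lemma ip_self: "ip x x = (\<Sum>i\<in>I. (norm (x i))\<^sup>2) *\<^sub>R 1"
  by (simp add: ip_eq mult_qcnj_norm scaleR_left.sum)

lemma ip_self_eq_0: "x \<in> C \<Longrightarrow> ip x x = 0 \<Longrightarrow> x = 0"
proof -
  assume x: "x \<in> C" "ip x x = 0"
  then have "(\<Sum>i\<in>I. (norm (x i))\<^sup>2) = 0"
    by (simp add: ip_self)
  then have "\<forall>i\<in>I. x i = 0"
    by (simp add: sum_nonneg_eq_0_iff)
  then show "x = 0"
    using x unfolding C_def fun_eq_iff by auto
qed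

lemma unit_multiple:
  assumes "x \<in> C" "x \<noteq> 0"
  obtains t where "t \<noteq> 0" "ip (smul x (of_real t)) (smul x (of_real t)) = 1"
    "t\<^sup>2 * qRe (ip x x) = 1"
proof
  define s where "s = (\<Sum>i\<in>I. (norm (x i))\<^sup>2)"
  have s: "s > 0"
  proof -
    have "s \<noteq> 0"
      using assms ip_self_eq_0 ip_self by (metis s_def scaleR_zero_left)
    then show ?thesis
      unfolding s_def by (simp add: less_le sum_nonneg)
  qed
  then show "inverse (sqrt s) \<noteq> 0"
    by simp
  have ips: "ip x x = s *\<^sub>R 1"
    by (simp add: ip_self s_def)
  show "(inverse (sqrt s))\<^sup>2 * qRe (ip x x) = 1"
    using s by (simp add: ips power_inverse)
  show "ip (smul x (of_real (inverse (sqrt s)))) (smul x (of_real (inverse (sqrt s)))) = 1"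
    using assms s
    by (simp add: ips.B_sm ips quat_eq_iff del: of_real_inverse)
       (simp add: power2_eq_square [symmetric] field_simps)
qed

text \<open>The next eigenvector maximizes the quadratic form of \<open>T\<close> over the unit
  vectors orthogonal to those already found. Moving from the maximizer \<open>x\<close> in the
  direction of the residual \<open>app x - smul x (of_real l)\<close> cannot increase the Rayleigh
  quotient, which forces the residual to vanish.\<close>

lemma eigenvector_step:
  assumes J: "J \<subset> I" and v: "\<And>j. j \<in> J \<Longrightarrow> v j \<in> C"
    and eig: "\<And>j. j \<in> J \<Longrightarrow> app (v j) = smul (v j) (of_real (d j))"
  shows "\<exists>x l. x \<in> C \<and> ip x x = 1 \<and> (\<forall>j\<in>J. ip x (v j) = 0) \<and> app x = smul x (of_real l)"
proof -
  define K where "K = {x. \<forall>i. x i \<in> (if i \<in> I then cball 0 1 else {0})} \<inter>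
    ({x. ip x x = 1} \<inter> (\<Inter>j\<in>J. {x. ip x (v j) = 0}))"
  have coord: "continuous_on UNIV (\<lambda>x :: 'i \<Rightarrow> quat. x i)" for i
    by (rule continuous_on_product_coordinates)
  have "closed ({x. ip x x = 1} \<inter> (\<Inter>j\<in>J. {x. ip x (v j) = 0}))"
    unfolding ip_eq
    by (intro closed_Int closed_INT ballI closed_Collect_eq continuous_intros coord)
  then have "compact K"
    unfolding K_def by (intro compact_Int_closed compact_unit_functions)
  have K: "x \<in> K \<longleftrightarrow> x \<in> C \<and> ip x x = 1 \<and> (\<forall>j\<in>J. ip x (v j) = 0)" for x
  proof -
    have "norm (x i) \<le> 1" if "ip x x = 1" "i \<in> I" for i
    proof -
      have "(\<Sum>i\<in>I. (norm (x i))\<^sup>2) = 1"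
        using that(1) ip_self [of x] by (simp add: quat_eq_iff)
      moreover have "(norm (x i))\<^sup>2 \<le> (\<Sum>i\<in>I. (norm (x i))\<^sup>2)"
        using that(2) by (intro member_le_sum) auto
      ultimately show ?thesis
        by (simp add: abs_square_le_1)
    qed
    then show ?thesis
      unfolding K_def C_def by auto
  qed
  \<comment> \<open>Orthogonality to the \<open>v j\<close> is a homogeneous system of
    \<open>card J < card I\<close> equations.\<close>
  have "K \<noteq> {}"
  proof -
    have "finite J" "card J < card I"
      using J by (auto simp: psubset_card_mono finite_subset)
    then obtain c where c: "\<exists>i\<in>I. c i \<noteq> 0" "\<forall>j\<in>J. (\<Sum>i\<in>I. qcnj (v j i) * c i) = 0"
      using quat_system_nontrivial [of J I "\<lambda>j i. qcnj (v j i)"] by auto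
    define x where "x i = (if i \<in> I then c i else 0)" for i
    have x: "x \<in> C" "x \<noteq> 0"
      using c(1) by (auto simp: x_def C_def fun_eq_iff)
    have "ip x (v j) = 0" if "j \<in> J" for j
    proof -
      have "ip x (v j) = (\<Sum>i\<in>I. qcnj (v j i) * c i)"
        unfolding ip_eq by (simp add: x_def)
      then show ?thesis
        using c(2) that by simp
    qed
    then obtain t where "ip (smul x (of_real t)) (smul x (of_real t)) = 1"
      using unit_multiple x by blast
    then have "smul x (of_real t) \<in> K"
      unfolding K using x v \<open>\<And>j. j \<in> J \<Longrightarrow> ip x (v j) = 0\<close> by (simp add: ips.B_sm_left)
    then show ?thesis by blast
  qed
  moreover have "continuous_on K (\<lambda>x. qRe (tf x x))"
    unfolding tf_eq
    by (intro continuous_intros continuous_on_subset [OF coord]) auto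
  ultimately obtain x where x: "x \<in> K" "\<And>y. y \<in> K \<Longrightarrow> qRe (tf y y) \<le> qRe (tf x x)"
    using continuous_attains_sup [OF \<open>compact K\<close>] by blast
  define l where "l = qRe (tf x x)"
  have xC: "x \<in> C" "ip x x = 1" and xv: "\<And>j. j \<in> J \<Longrightarrow> ip x (v j) = 0"
    using x K by auto
  \<comment> \<open>By scaling, the maximum over unit vectors bounds the form on the whole
    orthogonal complement of the \<open>v j\<close>.\<close>
  have rayleigh: "qRe (tf z z) \<le> l * qRe (ip z z)"
    if z: "z \<in> C" "\<forall>j\<in>J. ip z (v j) = 0" for z
  proof (cases "z = 0")
    case True
    then show ?thesis
      by (simp add: tf_eq ip_eq)
  next
    case False
    then obtain t where t: "t \<noteq> 0" "ip (smul z (of_real t)) (smul z (of_real t)) = 1"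
      "t\<^sup>2 * qRe (ip z z) = 1"
      using unit_multiple z by blast
    then have "smul z (of_real t) \<in> K"
      unfolding K using z v by (simp add: ips.B_sm_left)
    then have "qRe (tf (smul z (of_real t)) (smul z (of_real t))) \<le> l"
      using x l_def by blast
    then have "t\<^sup>2 * qRe (tf z z) \<le> t\<^sup>2 * (l * qRe (ip z z))"
      using z t(3) by (simp add: tfs.B_sm power2_eq_square algebra_simps)
    then show ?thesis
      using t(1) by simp
  qed
  define y where "y = app x - smul x (of_real l)"
  have y: "y \<in> C"
    using xC by (simp add: y_def)
  \<comment> \<open>A Hermitian \<open>T\<close> maps the orthogonal complement of eigenvectors into
    itself, so \<open>x\<close> may be perturbed along \<open>y\<close> without leaving it.\<close>
  have yv: "ip y (v j) = 0" if "j \<in> J" for j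
  proof -
    have "tf x (v j) = qcnj (tf (v j) x)"
      using that v xC by (simp add: tfs.B_cnj)
    also have "\<dots> = qcnj (ip (v j) x * of_real (d j))"
      using that v xC eig by (simp add: tf_app ips.B_sm_left)
    also have "ip (v j) x = 0"
      using xv that v xC by (subst ips.B_eq_0_commute) auto
    finally show ?thesis
      using that v xC xv by (simp add: y_def ips.B_diff_left ips.B_sm_left tf_app)
  qed
  \<comment> \<open>Half the linear coefficient in \<open>t\<close> of \<open>l\<close> times the
    squared length minus the form, at \<open>x + smul y (of_real t)\<close>. The constant
    coefficient is zero because \<open>x\<close> attains the maximum.\<close>
  define b where "b = l * qRe (ip x y) - qRe (tf x y)"
  have "b\<^sup>2 \<le> 0 * (l * qRe (ip y y) - qRe (tf y y))"
  proof (rule quadratic_nonneg_imp)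
    fix t
    let ?z = "x + smul y (of_real t)"
    have "qRe (tf ?z ?z) \<le> l * qRe (ip ?z ?z)"
      using xC xv y yv v by (intro rayleigh) (auto simp: ips.B_add_left ips.B_sm_left)
    moreover have "qRe (tf ?z ?z) = l + 2 * t * qRe (tf x y) + t\<^sup>2 * qRe (tf y y)"
      using xC y tfs.qRe_B_commute [of y x]
      by (simp add: tfs.B_add_left tfs.B_add_right tfs.B_sm tfs.B_sm_left tfs.B_sm_right
          l_def power2_eq_square algebra_simps)
    moreover have "qRe (ip ?z ?z) = 1 + 2 * t * qRe (ip x y) + t\<^sup>2 * qRe (ip y y)"
      using xC y ips.qRe_B_commute [of y x]
      by (simp add: ips.B_add_left ips.B_add_right ips.B_sm ips.B_sm_left ips.B_sm_right
          power2_eq_square algebra_simps)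
    ultimately show "0 \<le> 0 + 2 * t * b + t\<^sup>2 * (l * qRe (ip y y) - qRe (tf y y))"
      by (simp add: b_def algebra_simps)
  qed
  then have "b = 0"
    by simp
  \<comment> \<open>Expanding only the left argument by the definition of \<open>y\<close>
    reproduces \<open>b\<close> with opposite sign.\<close>
  moreover have "qRe (ip y y) = - b"
    using xC y by (subst y_def) (simp add: b_def tf_app ips.B_diff_left ips.B_sm_left)
  ultimately have "ip y y = 0"
    by (simp add: ip_self)
  then have "y = 0"
    using ip_self_eq_0 y by blast
  then have "app x = smul x (of_real l)"
    by (simp add: y_def)
  then show ?thesis
    using xC xv by blast
qed

lemma eigenbasis:
  "\<exists>v d. \<forall>j\<in>I. v j \<in> C \<and> app (v j) = smul (v j) (of_real (d j)) \<and>
      (\<forall>k\<in>I. ip (v j) (v k) = (if j = k then 1 else 0))"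
proof -
  have "\<exists>v d. \<forall>j\<in>J. v j \<in> C \<and> app (v j) = smul (v j) (of_real (d j)) \<and>
      (\<forall>k\<in>J. ip (v j) (v k) = (if j = k then 1 else 0))" if "finite J" "J \<subseteq> I" for J
    using that
  proof (induction J rule: finite_induct)
    case (insert j J)
    then obtain v d where v: "\<forall>j\<in>J. v j \<in> C \<and> app (v j) = smul (v j) (of_real (d j)) \<and>
      (\<forall>k\<in>J. ip (v j) (v k) = (if j = k then 1 else 0))"
      by blast
    have "J \<subset> I"
      using insert by blast
    then obtain x l where x: "x \<in> C" "ip x x = 1" "\<forall>j\<in>J. ip x (v j) = 0"
      "app x = smul x (of_real l)"
      using eigenvector_step [of J v d] v by auto
    have "\<forall>j\<in>J. ip (v j) x = 0"
      using x v by (auto simp: ips.B_eq_0_commute [of _ x])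
    then show ?case
      using insert.hyps v x
      by (intro exI [of _ "v(j := x)"] exI [of _ "d(j := l)"]) auto
  qed simp
  then show ?thesis
    by simp
qed

lemma diagonalization: "\<exists>W d. diagonalizes I T W d"
proof -
  obtain v d where v: "\<And>j. j \<in> I \<Longrightarrow> v j \<in> C"
    and eig: "\<And>j. j \<in> I \<Longrightarrow> app (v j) = smul (v j) (of_real (d j))"
    and orth: "\<And>j k. j \<in> I \<Longrightarrow> k \<in> I \<Longrightarrow> ip (v j) (v k) = (if j = k then 1 else 0)"
    using eigenbasis by blast
  \<comment> \<open>Orthonormality of the columns is one half of unitarity; this is the other half.
    A unit vector not spanned by the eigenvectors would leave a nonzero residual \<open>y\<close>
    orthogonal to all of them.\<close>
  have complete: "(\<Sum>k\<in>I. v k i * qcnj (v k j)) = (if i = j then 1 else 0)"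
    if ij: "i \<in> I" "j \<in> I" for i j
  proof -
    define u where "u = (\<lambda>i. if i = j then 1 else 0 :: quat)"
    have u: "u \<in> C"
      using ij by (auto simp: u_def C_def)
    have uv: "ip u (v k) = qcnj (v k j)" if "k \<in> I" for k
      using ij by (simp add: ip_eq u_def if_distrib [of "\<lambda>u. _ * u"] cong: if_cong)
    define y where "y = u - (\<Sum>k\<in>I. smul (v k) (ip u (v k)))"
    have y: "y \<in> C"
      using u v by (simp add: y_def)
    have yv: "ip y (v l) = 0" if "l \<in> I" for l
      using that u v
      by (simp add: y_def ips.B_diff_left ips.B_sum_left ips.B_sm_left orth
          if_distrib [of "\<lambda>u. u * _"] cong: if_cong)
    have "y = 0"
    proof (rule ccontr)
      assume "y \<noteq> 0"
      \<comment> \<open>The residual is adjoined under the index \<open>None\<close>: one more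
        orthogonal nonzero vector than there are coordinates, so a nontrivial relation exists, yet
        pairing it with each vector kills every coefficient.\<close>
      define w where "w k = (case k of None \<Rightarrow> y | Some k \<Rightarrow> v k)" for k
      define J where "J = insert None (Some ` I)"
      have "card I < card J"
        by (simp add: J_def card_insert_if card_image)
      moreover have finJ: "finite J"
        by (simp add: J_def)
      ultimately obtain c where c: "\<exists>k\<in>J. c k \<noteq> 0" "\<forall>i\<in>I. (\<Sum>k\<in>J. w k i * c k) = 0"
        using quat_system_nontrivial [of I J "\<lambda>i k. w k i"] by (auto simp: J_def)
      have w: "w k \<in> C" if "k \<in> J" for k
        using that v y by (auto simp: J_def w_def)
      have worth: "ip (w k) (w l) = 0" if "k \<in> J" "l \<in> J" "k \<noteq> l" for k l
        using that v y yv orth ips.B_eq_0_commute [of y] by (auto simp: J_def w_def split: if_splits)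
      have wself: "ip (w k) (w k) \<noteq> 0" if "k \<in> J" for k
        using that \<open>y \<noteq> 0\<close> ip_self_eq_0 y orth by (auto simp: J_def w_def)
      define s where "s = (\<Sum>k\<in>J. smul (w k) (c k))"
      have s_apply: "s i = (\<Sum>k\<in>J. w k i * c k)" for i
      proof -
        have "(\<Sum>k\<in>A. smul (w k) (c k)) i = (\<Sum>k\<in>A. w k i * c k)" if "finite A" for A
          using that by (induction A rule: finite_induct) (auto simp: smul_def)
        from this [of J] show ?thesis
          unfolding s_def by (simp add: J_def)
      qed
      have "c l = 0" if l: "l \<in> J" for l
      proof -
        have "0 = ip s (w l)"
          unfolding ip_eq s_apply using c(2) by simp
        also have "\<dots> = (\<Sum>k\<in>J. ip (w k) (w l) * c k)"
          unfolding s_def using w l by (simp add: ips.B_sum_left ips.B_sm_left)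
        also have "\<dots> = (\<Sum>k\<in>J. if k = l then ip (w l) (w l) * c l else 0)"
          using worth l by (intro sum.cong) auto
        also have "\<dots> = ip (w l) (w l) * c l"
          using l finJ by simp
        finally show ?thesis
          using wself l by auto
      qed
      then show False
        using c(1) by blast
    qed
    then have "u = (\<Sum>k\<in>I. smul (v k) (qcnj (v k j)))"
      using uv by (simp add: y_def)
    moreover have "(\<Sum>k\<in>A. smul (v k) (qcnj (v k j))) i = (\<Sum>k\<in>A. v k i * qcnj (v k j))"
      if "finite A" for A
      using that by (induction A rule: finite_induct) (auto simp: smul_def)
    ultimately have "u i = (\<Sum>k\<in>I. v k i * qcnj (v k j))"
      by simp
    then show ?thesis
      by (simp add: u_def)
  qed
  \<comment> \<open>With V the matrix of eigenvectors, T = T (V V^* ) = (T V) V^*, and T V has the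
    columns of V scaled by the eigenvalues.\<close>
  have "T i j = (\<Sum>k\<in>I. v k i * of_real (d k) * qcnj (v k j))" if "i \<in> I" "j \<in> I" for i j
  proof -
    have "T i j = (\<Sum>m\<in>I. T i m * (\<Sum>k\<in>I. v k m * qcnj (v k j)))"
      using that complete by (simp add: if_distrib [of "\<lambda>u. _ * u"] cong: if_cong)
    also have "\<dots> = (\<Sum>k\<in>I. \<Sum>m\<in>I. T i m * v k m * qcnj (v k j))"
      by (subst sum.swap) (simp add: sum_distrib_left mult.assoc)
    also have "\<dots> = (\<Sum>k\<in>I. app (v k) i * qcnj (v k j))"
      using that by (simp add: app_def sum_distrib_right)
    also have "\<dots> = (\<Sum>k\<in>I. v k i * of_real (d k) * qcnj (v k j))"
      using eig by (simp add: smul_def)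
    finally show ?thesis .
  qed
  moreover have "unitary_qmatrix I (\<lambda>i k. v k i)"
    unfolding unitary_qmatrix_def using complete orth by (simp add: ip_eq)
  ultimately have "diagonalizes I T (\<lambda>i k. v k i) d"
    unfolding diagonalizes_def by blast
  then show ?thesis
    by blast
qed

text \<open>Opens the choice in \<open>hermitian_eigenvalues\<close>: the \<open>W\<close> and
  \<open>d\<close> obtained are ones that produce the chosen multiset.\<close>

lemma negative_count:
  "\<exists>W d. diagonalizes I T W d \<and>
     size (filter_mset (\<lambda>x. x < 0) (hermitian_eigenvalues I T)) = card {k \<in> I. d k < 0}"
proof -
  have "\<exists>E. \<exists>W d. diagonalizes I T W d \<and> E = image_mset d (mset_set I)"
    using diagonalization by blast
  then have "\<exists>W d. diagonalizes I T W d \<and> hermitian_eigenvalues I T = image_mset d (mset_set I)"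
    unfolding hermitian_eigenvalues_def by (rule someI_ex)
  then obtain W d where "diagonalizes I T W d"
    "hermitian_eigenvalues I T = image_mset d (mset_set I)"
    by blast
  then show ?thesis
    by (intro exI [of _ W] exI [of _ d]) (simp add: filter_mset_image_mset filter_mset_mset_set)
qed

end

section \<open>Pontryagin spaces and fundamental decompositions\<close>

context pre_pontryagin
begin

text \<open>Phrased with \<open>hn\<close> directly, since in a degenerate space \<open>hn\<close>
  is only a seminorm and there is no metric to refer to.\<close>

definition hCauchy :: "(nat \<Rightarrow> 'a) \<Rightarrow> bool" where
  "hCauchy x \<longleftrightarrow> (\<forall>\<epsilon>>0. \<exists>N. \<forall>i\<ge>N. \<forall>j\<ge>N. hn (x i - x j) < \<epsilon>)"

definition hconv :: "(nat \<Rightarrow> 'a) \<Rightarrow> 'a \<Rightarrow> bool" where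
  "hconv x y \<longleftrightarrow> (\<lambda>i. hn (x i - y)) \<longlonglongrightarrow> 0"

lemma hconv_iff:
  assumes "\<And>i. x i \<in> V" "y \<in> V"
  shows "hconv x y \<longleftrightarrow> (\<forall>\<epsilon>>0. \<exists>N. \<forall>i\<ge>N. hn (x i - y) < \<epsilon>)"
  unfolding hconv_def LIMSEQ_iff using assms by (simp add: hn_nonneg)

lemma hconv_hCauchy:
  assumes "\<And>i. x i \<in> V" "y \<in> V" "hconv x y"
  shows "hCauchy x"
  unfolding hCauchy_def
proof (intro allI impI)
  fix \<epsilon> :: real assume "\<epsilon> > 0"
  then obtain N where N: "\<And>i. i \<ge> N \<Longrightarrow> hn (x i - y) < \<epsilon> / 2"
    using assms hconv_iff [of x y] by (meson half_gt_zero)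
  have "hn (x i - x j) < \<epsilon>" if "i \<ge> N" "j \<ge> N" for i j
    using N [of i] N [of j] that hn_diff_triangle [of "x i" y "x j"] hn_diff_commute [of y "x j"] assms
    by simp
  then show "\<exists>N. \<forall>i\<ge>N. \<forall>j\<ge>N. hn (x i - x j) < \<epsilon>"
    by blast
qed

lemma hconv_dominated:
  assumes "\<And>i. hn (x i - y) \<le> f i" "\<And>i. x i \<in> V" "y \<in> V" "f \<longlonglongrightarrow> 0"
  shows "hconv x y"
  unfolding hconv_def
  using assms by (intro tendsto_sandwich [OF _ _ tendsto_const assms(4)]) (auto simp: hn_nonneg)

lemma hconv_add:
  assumes "\<And>i. x i \<in> V" "\<And>i. y i \<in> V" "a \<in> V" "b \<in> V" "hconv x a" "hconv y b"
  shows "hconv (\<lambda>i. x i + y i) (a + b)"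
proof (rule hconv_dominated)
  show "hn (x i + y i - (a + b)) \<le> hn (x i - a) + hn (y i - b)" for i
    using hn_triangle [of "x i - a" "y i - b"] assms by (simp add: algebra_simps)
  show "(\<lambda>i. hn (x i - a) + hn (y i - b)) \<longlonglongrightarrow> 0"
    using assms(5,6) tendsto_add_zero unfolding hconv_def by blast
qed (use assms in auto)

lemma hconv_sm:
  assumes "\<And>i. x i \<in> V" "a \<in> V" "hconv x a"
  shows "hconv (\<lambda>i. sm (x i) p) (sm a p)"
  using tendsto_mult_left_zero [OF assms(3) [unfolded hconv_def], of "norm p"] assms(1,2)
  unfolding hconv_def by (simp add: sm_diff_left [symmetric] hn_sm)

lemma hconv_const: "hconv (\<lambda>_. a) a"
  unfolding hconv_def by simp

lemma hconv_B:
  assumes "\<And>i. x i \<in> V" "\<And>i. y i \<in> V" "a \<in> V" "b \<in> V" "hconv x a" "hconv y b"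
  shows "(\<lambda>i. B (x i) (y i)) \<longlonglongrightarrow> B a b"
proof -
  let ?f = "\<lambda>i. cB * hn (x i - a) * (hn (y i - b) + hn b) + cB * hn a * hn (y i - b)"
  have "norm (B (x i) (y i) - B a b) \<le> ?f i" for i
  proof -
    have "B (x i) (y i) - B a b = B (x i - a) (y i) + B a (y i - b)"
      using assms by (simp add: B_diff_left B_diff_right)
    also have "norm \<dots> \<le> cB * hn (x i - a) * hn (y i) + cB * hn a * hn (y i - b)"
      using assms by (intro order_trans [OF norm_triangle_ineq] add_mono norm_B_le) auto
    also have "\<dots> \<le> ?f i"
    proof -
      have "hn (y i) \<le> hn (y i - b) + hn b"
        using hn_triangle [of "y i - b" b] assms by simp
      then show ?thesis
        using assms cB_pos by (intro add_right_mono mult_left_mono) (auto simp: hn_nonneg)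
    qed
    finally show ?thesis .
  qed
  moreover have "?f \<longlonglongrightarrow> cB * 0 * (0 + hn b) + cB * hn a * 0"
    using assms(5,6) unfolding hconv_def by (intro tendsto_intros)
  then have "?f \<longlonglongrightarrow> 0"
    by simp
  ultimately have "(\<lambda>i. B (x i) (y i) - B a b) \<longlonglongrightarrow> 0"
    by (rule Lim_null_comparison [OF always_eventually [OF allI]])
  then show ?thesis
    by (rule LIM_zero_cancel)
qed

lemma hCauchy_bounded:
  assumes "\<And>i. x i \<in> V" "hCauchy x"
  shows "\<exists>M. \<forall>i. hn (x i) \<le> M"
proof -
  obtain N where N: "\<And>i. i \<ge> N \<Longrightarrow> hn (x i - x N) < 1"
    using assms(2) unfolding hCauchy_def by (metis le_refl zero_less_one)
  have "hn (x i) \<le> 1 + (\<Sum>j\<le>N. hn (x j))" for i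
  proof (cases "i \<ge> N")
    case True
    have "hn (x i) \<le> hn (x i - x N) + hn (x N)"
      using hn_triangle [of "x i - x N" "x N"] assms by simp
    also have "hn (x N) \<le> (\<Sum>j\<le>N. hn (x j))"
      using assms by (intro member_le_sum) (auto simp: hn_nonneg)
    finally show ?thesis
      using N [OF True] by simp
  next
    case False
    then have "hn (x i) \<le> (\<Sum>j\<le>N. hn (x j))"
      using assms by (intro member_le_sum) (auto simp: hn_nonneg)
    then show ?thesis
      by simp
  qed
  then show ?thesis
    by blast
qed

text \<open>Holds without completeness of the space, since the values lie in the quaternions. It
  gives limits of coefficients and, later, the form on the completion.\<close>

lemma hCauchy_B:
  assumes "\<And>i. x i \<in> V" "\<And>i. y i \<in> V" "hCauchy x" "hCauchy y"
  shows "convergent (\<lambda>i. B (x i) (y i))"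
proof -
  obtain M where M: "\<And>i. hn (x i) \<le> M"
    using hCauchy_bounded assms by blast
  obtain M' where M': "\<And>i. hn (y i) \<le> M'"
    using hCauchy_bounded assms by blast
  \<comment> \<open>A common bound for \<open>cB * hn (x i)\<close> and
    \<open>cB * hn (y i)\<close>; the summand 1 makes it positive, so that division by it is
    possible.\<close>
  define L where "L = cB * (\<bar>M\<bar> + \<bar>M'\<bar> + 1)"
  have L: "L > 0"
    unfolding L_def using cB_pos by (intro mult_pos_pos) auto
  have "Cauchy (\<lambda>i. B (x i) (y i))"
  proof (rule CauchyI)
    fix \<epsilon> :: real assume "\<epsilon> > 0"
    then have "\<epsilon> / (2 * L) > 0"
      using L by simp
    then obtain N1 N2 where N: "\<And>i j. i \<ge> N1 \<Longrightarrow> j \<ge> N1 \<Longrightarrow> hn (x i - x j) < \<epsilon> / (2 * L)"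
      "\<And>i j. i \<ge> N2 \<Longrightarrow> j \<ge> N2 \<Longrightarrow> hn (y i - y j) < \<epsilon> / (2 * L)"
      using assms(3,4) unfolding hCauchy_def by meson
    have "norm (B (x i) (y i) - B (x j) (y j)) < \<epsilon>"
      if "i \<ge> max N1 N2" "j \<ge> max N1 N2" for i j
    proof -
      have "B (x i) (y i) - B (x j) (y j) = B (x i - x j) (y i) + B (x j) (y i - y j)"
        using assms by (simp add: B_diff_left B_diff_right)
      also have "norm \<dots> \<le> cB * hn (x i - x j) * hn (y i) + cB * hn (x j) * hn (y i - y j)"
        using assms by (intro order_trans [OF norm_triangle_ineq] add_mono norm_B_le) auto
      also have "\<dots> \<le> hn (x i - x j) * L + L * hn (y i - y j)"
      proof (rule add_mono)
        have "cB * hn (y i) \<le> L" "cB * hn (x j) \<le> L"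
          unfolding L_def using M [of j] M' [of i] cB_pos by (auto intro!: mult_left_mono)
        then show "cB * hn (x i - x j) * hn (y i) \<le> hn (x i - x j) * L"
          "cB * hn (x j) * hn (y i - y j) \<le> L * hn (y i - y j)"
          using assms mult_left_mono [of "cB * hn (y i)" L "hn (x i - x j)"]
            mult_right_mono [of "cB * hn (x j)" L "hn (y i - y j)"]
          by (auto simp: hn_nonneg mult.assoc mult.left_commute)
      qed
      also have "\<dots> < \<epsilon> / (2 * L) * L + L * (\<epsilon> / (2 * L))"
        using N that L by (intro add_strict_mono mult_strict_right_mono mult_strict_left_mono) auto
      also have "\<dots> = \<epsilon>"
        using L by (simp add: field_simps)
      finally show ?thesis .
    qed
    then show "\<exists>N. \<forall>m\<ge>N. \<forall>n\<ge>N. norm (B (x m) (y m) - B (x n) (y n)) < \<epsilon>"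
      by blast
  qed
  then show ?thesis
    by (simp add: Cauchy_convergent_iff)
qed

lemma hCauchy_add:
  assumes "\<And>i. x i \<in> V" "\<And>i. y i \<in> V" "hCauchy x" "hCauchy y"
  shows "hCauchy (\<lambda>i. x i + y i)"
  unfolding hCauchy_def
proof (intro allI impI)
  fix \<epsilon> :: real assume "\<epsilon> > 0"
  then obtain N1 N2 where N: "\<And>i j. i \<ge> N1 \<Longrightarrow> j \<ge> N1 \<Longrightarrow> hn (x i - x j) < \<epsilon> / 2"
    "\<And>i j. i \<ge> N2 \<Longrightarrow> j \<ge> N2 \<Longrightarrow> hn (y i - y j) < \<epsilon> / 2"
    using assms(3,4) unfolding hCauchy_def by (meson half_gt_zero)
  have "hn (x i + y i - (x j + y j)) < \<epsilon>" if "i \<ge> max N1 N2" "j \<ge> max N1 N2" for i j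
    using N(1) [of i j] N(2) [of i j] that hn_triangle [of "x i - x j" "y i - y j"] assms(1,2)
    by (simp add: algebra_simps)
  then show "\<exists>N. \<forall>i\<ge>N. \<forall>j\<ge>N. hn (x i + y i - (x j + y j)) < \<epsilon>"
    by blast
qed

lemma hCauchy_bounded_map:
  assumes "\<And>i. x i \<in> V" "hCauchy x" and M: "\<And>i j. hn (y i - y j) \<le> M * hn (x i - x j)"
  shows "hCauchy y"
  unfolding hCauchy_def
proof (intro allI impI)
  fix \<epsilon> :: real assume "\<epsilon> > 0"
  then have "\<epsilon> / (\<bar>M\<bar> + 1) > 0"
    by simp
  then obtain N where N: "\<And>i j. i \<ge> N \<Longrightarrow> j \<ge> N \<Longrightarrow> hn (x i - x j) < \<epsilon> / (\<bar>M\<bar> + 1)"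
    using assms(2) unfolding hCauchy_def by blast
  have "hn (y i - y j) < \<epsilon>" if "i \<ge> N" "j \<ge> N" for i j
  proof -
    have "hn (y i - y j) \<le> (\<bar>M\<bar> + 1) * hn (x i - x j)"
    proof (rule order_trans [OF M mult_right_mono])
      show "M \<le> \<bar>M\<bar> + 1"
        by simp
    qed (use assms(1) in \<open>simp add: hn_nonneg\<close>)
    also have "\<dots> < (\<bar>M\<bar> + 1) * (\<epsilon> / (\<bar>M\<bar> + 1))"
      using N [OF that] by (intro mult_strict_left_mono) auto
    finally show ?thesis
      by simp
  qed
  then show "\<exists>N. \<forall>i\<ge>N. \<forall>j\<ge>N. hn (y i - y j) < \<epsilon>"
    by blast
qed

lemma neg_part_add: "x \<in> V \<Longrightarrow> y \<in> V \<Longrightarrow> neg_part (x + y) = neg_part x + neg_part y"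
  unfolding neg_part_def by (simp add: B_add_left sm_add_right sum.distrib)

lemma neg_part_sm: "x \<in> V \<Longrightarrow> neg_part (sm x p) = sm (neg_part x) p"
  unfolding neg_part_def by (simp add: B_sm_left sm_mult sm_sum_left sm_uminus_left)

lemma neg_part_zero [simp]: "neg_part 0 = 0"
  unfolding neg_part_def by simp

lemma neg_part_diff: "x \<in> V \<Longrightarrow> y \<in> V \<Longrightarrow> neg_part (x - y) = neg_part x - neg_part y"
  using neg_part_add [of "x - y" y] by simp

lemma neg_part_idem: "x \<in> V \<Longrightarrow> neg_part (neg_part x) = neg_part x"
  by (subst neg_part_def) (simp add: B_neg_part_e neg_part_def [symmetric])

lemma neg_part_e: "k \<in> I \<Longrightarrow> neg_part (e k) = e k"
  unfolding neg_part_def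
  by (simp add: e_orth if_distrib [of "sm _"] sm_uminus_right sum_negf [symmetric]
      if_distrib [of uminus] cong: if_cong)

lemma qRe_B_neg_part: "x \<in> V \<Longrightarrow> qRe (B (neg_part x) (neg_part x)) = - (\<Sum>k\<in>I. (norm (B x (e k)))\<^sup>2)"
proof -
  assume x: "x \<in> V"
  have "B (neg_part x) (neg_part x) = B (neg_part x) x"
    using x by (intro B_neg_part_neg_part)
  also have "\<dots> = - (\<Sum>k\<in>I. (norm (B x (e k)))\<^sup>2 *\<^sub>R 1)"
    using x by (simp add: B_neg_part B_cnj [symmetric, of "e _"] mult_qcnj_norm)
  finally show ?thesis
    by (simp add: qRe_sum)
qed

text \<open>The squared norm of the residual is [x,x] plus one copy of the sum of squared
  coefficients, while that of \<open>x\<close> contains two copies.\<close>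

lemma hn_neg_part_diff_le: "x \<in> V \<Longrightarrow> hn (x - neg_part x) \<le> hn x"
proof -
  assume x: "x \<in> V"
  have "(hn (x - neg_part x))\<^sup>2 = qRe (B (x - neg_part x) (x - neg_part x))"
    using x by (simp add: hn_power2 B_neg_part_e B_diff_left [of x "neg_part x" "e _"])
  also have "\<dots> = qRe (B x x) - qRe (B (neg_part x) (neg_part x))"
    using x qRe_B_commute [of x "neg_part x"]
    by (simp add: B_diff_left B_diff_right B_neg_part_neg_part)
  also have "\<dots> = qRe (B x x) + (\<Sum>k\<in>I. (norm (B x (e k)))\<^sup>2)"
    using x by (simp only: qRe_B_neg_part)
  also have "\<dots> \<le> (hn x)\<^sup>2"
    using x by (simp add: hn_power2 sum_nonneg)
  finally show ?thesis
    using x power2_le_imp_le hn_nonneg by blast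
qed

lemma hn_neg_part_le: "x \<in> V \<Longrightarrow> hn (neg_part x) \<le> (\<Sum>k\<in>I. hn (e k)) * hn x"
proof -
  assume x: "x \<in> V"
  have "hn (neg_part x) \<le> (\<Sum>k\<in>I. hn (sm (e k) (B x (e k))))"
    unfolding neg_part_def using x by (simp add: hn_sum_le)
  also have "\<dots> \<le> (\<Sum>k\<in>I. hn (e k) * hn x)"
    using x by (intro sum_mono) (simp add: hn_sm mult_left_mono norm_B_e_le hn_nonneg)
  finally show ?thesis
    by (simp add: sum_distrib_right)
qed

lemma metric_subspace:
  assumes W: "qsubspace P W" and nrm: "\<And>a. a \<in> W \<Longrightarrow> nrm a = hn a"
    and definite: "\<And>a. a \<in> W \<Longrightarrow> hn a = 0 \<Longrightarrow> a = 0"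
  shows "Metric_space W (norm_dist W nrm)"
proof
  fix x y z
  have diff: "a - b \<in> W" if "a \<in> W" "b \<in> W" for a b
    using qsubspace_diff [OF W] that by blast
  note V = qsubspace_mem [OF W]
  show "0 \<le> norm_dist W nrm x y"
    using diff V by (simp add: norm_dist_def nrm hn_nonneg)
  show "norm_dist W nrm x y = norm_dist W nrm y x"
    using diff V by (simp add: norm_dist_def nrm hn_diff_commute)
  show "(norm_dist W nrm x y = 0) = (x = y)" if "x \<in> W" "y \<in> W"
    using that diff definite [of "x - y"] nrm [of "x - y"] by (auto simp: norm_dist_def)
  show "norm_dist W nrm x z \<le> norm_dist W nrm x y + norm_dist W nrm y z"
    if "x \<in> W" "y \<in> W" "z \<in> W"
    using that diff V by (simp add: norm_dist_def nrm hn_diff_triangle)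
qed

text \<open>Leaves \<open>nrm\<close> free on \<open>W\<close> because the Hilbert norm in question
  changes: it comes from the form on the positive part and from its negative on the negative part,
  and both agree there with \<open>hn\<close>.\<close>

lemma mcomplete_subspace:
  assumes W: "qsubspace P W" and nrm: "\<And>a. a \<in> W \<Longrightarrow> nrm a = hn a"
    and definite: "\<And>a. a \<in> W \<Longrightarrow> hn a = 0 \<Longrightarrow> a = 0"
  shows "Metric_space.mcomplete W (norm_dist W nrm) \<longleftrightarrow>
    (\<forall>x. (\<forall>i. x i \<in> W) \<longrightarrow> hCauchy x \<longrightarrow> (\<exists>y\<in>W. hconv x y))"
proof -
  interpret M: Metric_space W "norm_dist W nrm"
    using metric_subspace [OF assms] .
  have d: "norm_dist W nrm a b = hn (a - b)" if "a \<in> W" "b \<in> W" for a b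
    using that qsubspace_diff [OF W] by (simp add: norm_dist_def nrm)
  note V = qsubspace_mem [OF W]
  have "M.MCauchy x \<longleftrightarrow> (\<forall>i. x i \<in> W) \<and> hCauchy x" for x
    unfolding M.MCauchy_def hCauchy_def using d by (simp add: image_subset_iff) metis
  moreover have "limitin M.mtopology x y sequentially \<longleftrightarrow> y \<in> W \<and> hconv x y"
    if "\<forall>i. x i \<in> W" for x y
    unfolding M.limit_metric_sequentially using that V d by (auto simp: hconv_iff)
  ultimately show ?thesis
    unfolding M.mcomplete_def by metis
qed

end

section \<open>From a negative orthonormal basis to a fundamental decomposition\<close>

locale pontryagin_basis = pre_pontryagin +
  assumes orth_pos: "x \<in> V \<Longrightarrow> (\<And>k. k \<in> I \<Longrightarrow> B x (e k) = 0) \<Longrightarrow> x \<noteq> 0 \<Longrightarrow> 0 < qRe (B x x)"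
    and complete: "(\<And>i. s i \<in> V) \<Longrightarrow> hCauchy s \<Longrightarrow> \<exists>y\<in>V. hconv s y"
begin

lemma hn_eq_0: "x \<in> V \<Longrightarrow> hn x = 0 \<Longrightarrow> x = 0"
proof (rule ccontr)
  assume x: "x \<in> V" "hn x = 0" "x \<noteq> 0"
  have "B x (e k) = 0" if "k \<in> I" for k
    using norm_B_e_le [OF x(1) that] x(2) by simp
  then show False
    using orth_pos [of x] x hn_power2 [of x] by simp
qed

lemma hconv_unique:
  assumes "\<And>i. x i \<in> V" "a \<in> V" "b \<in> V" "hconv x a" "hconv x b"
  shows "a = b"
proof -
  have "hn (a - b) \<le> hn (x i - a) + hn (x i - b)" for i
    using hn_diff_triangle [of a "x i" b] assms by (simp add: hn_diff_commute)
  moreover have "(\<lambda>i. hn (x i - a) + hn (x i - b)) \<longlonglongrightarrow> 0"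
    using assms(4,5) tendsto_add_zero unfolding hconv_def by blast
  ultimately have "hn (a - b) \<le> 0"
    using LIMSEQ_le_const by blast
  then have "hn (a - b) = 0"
    using assms hn_nonneg [of "a - b"] by simp
  then show ?thesis
    using assms hn_eq_0 [of "a - b"] by simp
qed

lemma nondegenerate: "x \<in> V \<Longrightarrow> (\<And>y. y \<in> V \<Longrightarrow> B x y = 0) \<Longrightarrow> x = 0"
  using orth_pos [of x] by force

definition pos_space :: "'a set" where
  "pos_space = {x \<in> V. \<forall>k\<in>I. B x (e k) = 0}"

text \<open>Encoded by the fixed points of the projection rather than as a span, so that closedness
  under limits becomes continuity of \<open>neg_part\<close>.\<close>

definition neg_space :: "'a set" where
  "neg_space = {x \<in> V. neg_part x = x}"

lemma qsubspace_pos: "qsubspace P pos_space"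
  unfolding qsubspace_def pos_space_def by (auto simp: B_add_left B_sm_left)

lemma qsubspace_neg: "qsubspace P neg_space"
  unfolding qsubspace_def neg_space_def by (auto simp: neg_part_add neg_part_sm)

lemma hilbert_pos: "right_qhilbert_space (P\<lparr>qcarrier := pos_space\<rparr>)"
proof -
  interpret p: qhermitian "P\<lparr>qcarrier := pos_space\<rparr>"
    by (rule hermitian_carrier [OF qsubspace_pos])
  have "Metric_space.mcomplete pos_space (norm_dist pos_space (\<lambda>a. sqrt (qRe (B a a))))"
  proof (subst mcomplete_subspace [OF qsubspace_pos])
    show "sqrt (qRe (B a a)) = hn a" if "a \<in> pos_space" for a
      using that by (simp add: pos_space_def hn_def rip_def)
    show "a = 0" if "a \<in> pos_space" "hn a = 0" for a
      using that hn_eq_0 by (simp add: pos_space_def)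
    show "\<forall>x. (\<forall>i. x i \<in> pos_space) \<longrightarrow> hCauchy x \<longrightarrow> (\<exists>y\<in>pos_space. hconv x y)"
    proof (intro allI impI)
      fix x assume x: "\<forall>i. x i \<in> pos_space" "hCauchy x"
      then have xV: "\<And>i. x i \<in> V"
        by (simp add: pos_space_def)
      then obtain y where y: "y \<in> V" "hconv x y"
        using complete x by blast
      have "B y (e k) = 0" if "k \<in> I" for k
      proof -
        have "(\<lambda>i. B (x i) (e k)) \<longlonglongrightarrow> B y (e k)"
          using that y xV by (intro hconv_B hconv_const) auto
        moreover have "(\<lambda>i. B (x i) (e k)) = (\<lambda>_. 0)"
          using x(1) that by (simp add: pos_space_def)
        ultimately show ?thesis
          by (simp add: LIMSEQ_const_iff)
      qed
      then show "\<exists>y\<in>pos_space. hconv x y"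
        using y by (auto simp: pos_space_def)
    qed
  qed
  moreover have "0 < qRe (B a a)" if "a \<in> pos_space" "a \<noteq> 0" for a
    using that orth_pos [of a] by (simp add: pos_space_def)
  ultimately show ?thesis
    unfolding right_qhilbert_space_def using p.vs p.hf by simp
qed

lemma hilbert_neg: "right_qhilbert_space (P\<lparr>qcarrier := neg_space, qform := \<lambda>a b. - B a b\<rparr>)"
proof -
  interpret n: qhermitian "P\<lparr>qcarrier := neg_space\<rparr>"
    by (rule hermitian_carrier [OF qsubspace_neg])
  have Bneg: "qRe (B a a) = - (\<Sum>k\<in>I. (norm (B a (e k)))\<^sup>2)" if "a \<in> neg_space" for a
    using that qRe_B_neg_part [of a] by (simp add: neg_space_def)
  have "Metric_space.mcomplete neg_space (norm_dist neg_space (\<lambda>a. sqrt (qRe (- B a a))))"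
  proof (subst mcomplete_subspace [OF qsubspace_neg])
    show "sqrt (qRe (- B a a)) = hn a" if "a \<in> neg_space" for a
    proof -
      have "a \<in> V"
        using that by (simp add: neg_space_def)
      then show ?thesis
        using Bneg [OF that] by (simp add: hn_def rip_self)
    qed
    show "a = 0" if "a \<in> neg_space" "hn a = 0" for a
      using that hn_eq_0 by (simp add: neg_space_def)
    show "\<forall>x. (\<forall>i. x i \<in> neg_space) \<longrightarrow> hCauchy x \<longrightarrow> (\<exists>y\<in>neg_space. hconv x y)"
    proof (intro allI impI)
      fix x assume x: "\<forall>i. x i \<in> neg_space" "hCauchy x"
      then have xV: "\<And>i. x i \<in> V"
        by (simp add: neg_space_def)
      then obtain y where y: "y \<in> V" "hconv x y"
        using complete x by blast
      \<comment> \<open>The projection is bounded and fixes every \<open>x i\<close>, so the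
        sequence converges to \<open>neg_part y\<close> as well; uniqueness of limits then puts
        \<open>y\<close> in the subspace.\<close>
      have "hconv x (neg_part y)"
      proof (rule hconv_dominated)
        show "hn (x i - neg_part y) \<le> (\<Sum>k\<in>I. hn (e k)) * hn (x i - y)" for i
          using hn_neg_part_le [of "x i - y"] xV [of i] y x(1)
          by (simp add: neg_part_diff) (simp add: neg_space_def)
        show "(\<lambda>i. (\<Sum>k\<in>I. hn (e k)) * hn (x i - y)) \<longlonglongrightarrow> 0"
          using y(2) unfolding hconv_def by (rule tendsto_mult_right_zero)
      qed (use xV y in auto)
      then have "neg_part y = y"
        using hconv_unique [of x "neg_part y" y] xV y by simp
      then show "\<exists>y\<in>neg_space. hconv x y"
        using y by (auto simp: neg_space_def)
    qed
  qed
  moreover have "0 < qRe (- B a a)" if "a \<in> neg_space" "a \<noteq> 0" for a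
  proof -
    have "(\<Sum>k\<in>I. (norm (B a (e k)))\<^sup>2) \<noteq> 0"
    proof
      assume "(\<Sum>k\<in>I. (norm (B a (e k)))\<^sup>2) = 0"
      then have "\<forall>k\<in>I. B a (e k) = 0"
        by (simp add: sum_nonneg_eq_0_iff)
      then have "neg_part a = 0"
        by (simp add: neg_part_def that neg_space_def)
      then show False
        using that by (simp add: neg_space_def)
    qed
    moreover have "(\<Sum>k\<in>I. (norm (B a (e k)))\<^sup>2) \<ge> 0"
      by (simp add: sum_nonneg)
    ultimately show ?thesis
      using Bneg [OF that(1)] by simp
  qed
  moreover have "right_qvector_space (P\<lparr>qcarrier := neg_space, qform := \<lambda>a b. - B a b\<rparr>)"
    using n.vs unfolding right_qvector_space_def by simp
  moreover have "hermitian_form (P\<lparr>qcarrier := neg_space, qform := \<lambda>a b. - B a b\<rparr>)"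
    using qsubspace_mem [OF qsubspace_neg] unfolding hermitian_form_def
    by (simp add: B_add_left B_add_right B_cnj B_sm)
  ultimately show ?thesis
    unfolding right_qhilbert_space_def by simp
qed

lemma finite_qdim_neg: "finite_qdim (P\<lparr>qcarrier := neg_space\<rparr>)"
proof -
  interpret n: qhermitian "P\<lparr>qcarrier := neg_space\<rparr>"
    by (rule hermitian_carrier [OF qsubspace_neg])
  have sub: "e ` I \<subseteq> neg_space"
    by (auto simp: neg_space_def neg_part_e)
  have "neg_space \<subseteq> qspan (P\<lparr>qcarrier := neg_space\<rparr>) (e ` I)"
  proof
    fix x assume x: "x \<in> neg_space"
    have span: "qsubspace (P\<lparr>qcarrier := neg_space\<rparr>) (qspan (P\<lparr>qcarrier := neg_space\<rparr>) (e ` I))"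
      using sub by (intro n.qsubspace_qspan) simp
    have "sm (e k) (B x (e k)) \<in> qspan (P\<lparr>qcarrier := neg_space\<rparr>) (e ` I)" if "k \<in> I" for k
      using span n.qspan_superset [of "e ` I"] that unfolding qsubspace_def by auto
    then have "neg_part x \<in> qspan (P\<lparr>qcarrier := neg_space\<rparr>) (e ` I)"
      unfolding neg_part_def by (intro n.qsubspace_uminus [OF span] n.qsubspace_sum [OF span])
    then show "x \<in> qspan (P\<lparr>qcarrier := neg_space\<rparr>) (e ` I)"
      using x by (simp add: neg_space_def)
  qed
  moreover have "qspan (P\<lparr>qcarrier := neg_space\<rparr>) (e ` I) \<subseteq> neg_space"
    using n.qspan_subset [OF _ n.qsubspace_V] sub by simp
  ultimately show ?thesis
    unfolding finite_qdim_def using sub by (intro exI [of _ "e ` I"]) auto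
qed

theorem fundamental_decomposition: "fundamental_decomposition P pos_space neg_space"
proof -
  have split: "V = {a + b | a b. a \<in> pos_space \<and> b \<in> neg_space}"
  proof (intro set_eqI iffI)
    fix x assume "x \<in> V"
    then have "x - neg_part x \<in> pos_space" "neg_part x \<in> neg_space"
      by (simp_all add: pos_space_def neg_space_def B_diff_left B_neg_part_e neg_part_idem)
    then show "x \<in> {a + b | a b. a \<in> pos_space \<and> b \<in> neg_space}"
      by (metis (mono_tags, lifting) diff_add_cancel mem_Collect_eq)
  qed (auto simp: pos_space_def neg_space_def)
  have orth: "B a b = 0" if "a \<in> pos_space" "b \<in> neg_space" for a b
  proof -
    have "B (neg_part b) a = 0"
      using that B_eq_0_commute [of a] by (subst B_neg_part) (auto simp: pos_space_def neg_space_def)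
    then show ?thesis
      using that B_eq_0_commute [of a b] by (simp add: pos_space_def neg_space_def)
  qed
  have int: "pos_space \<inter> neg_space = {0}"
    by (auto simp: pos_space_def neg_space_def neg_part_def)
  show ?thesis
    unfolding fundamental_decomposition_def
    by (intro conjI ballI qsubspace_pos qsubspace_neg hilbert_pos hilbert_neg finite_qdim_neg
        split int orth)
qed

lemma pontryagin: "pontryagin_space P"
  unfolding pontryagin_space_def using vs hf fundamental_decomposition by blast

end

section \<open>From a fundamental decomposition to a negative orthonormal basis\<close>

lemma (in qhermitian) negative_gram_schmidt:
  assumes W: "qsubspace P W" and neg: "\<And>a. a \<in> W \<Longrightarrow> a \<noteq> 0 \<Longrightarrow> qRe (B a a) < 0"
    and "finite A" "A \<subseteq> W"
  shows "\<exists>n e. (\<forall>k<n. e k \<in> W) \<and>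
      (\<forall>k<n. \<forall>l<n. B (e k) (e l) = (if k = l then - 1 else 0)) \<and>
      (\<forall>x\<in>A. x = - (\<Sum>k<(n::nat). sm (e k) (B x (e k))))"
  using assms(3,4)
proof (induction A rule: finite_induct)
  case empty
  then show ?case
    by (intro exI [of _ 0]) auto
next
  case (insert b A)
  then obtain n e where e: "\<forall>k<n. e k \<in> W"
    "\<forall>k<n. \<forall>l<n. B (e k) (e l) = (if k = l then - 1 else 0)"
    "\<forall>x\<in>A. x = - (\<Sum>k<(n::nat). sm (e k) (B x (e k)))"
    by auto
  note V = qsubspace_mem [OF W]
  have eV: "\<And>k. k < n \<Longrightarrow> e k \<in> V" and bV: "b \<in> V" and bW: "b \<in> W"
    using e V insert.prems by auto
  have sV [simp]: "(\<Sum>k<n. sm (e k) (g k)) \<in> V" for g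
    using eV by (intro sum_mem sm_mem) auto
  have sB: "B (\<Sum>k<n. sm (e k) (g k)) x = (\<Sum>k<n. B (e k) x * g k)" if "x \<in> V" for g x
    using eV that by (subst B_sum_left) (auto simp: B_sm_left)
  \<comment> \<open>Gram-Schmidt with a plus sign, since the \<open>e k\<close> have square -1. If
    \<open>y\<close> is zero the family is kept, otherwise \<open>y\<close> is normalized and
    appended.\<close>
  define y where "y = b + (\<Sum>k<n. sm (e k) (B b (e k)))"
  have "(\<Sum>k<n. sm (e k) (B b (e k))) \<in> W"
    using e W by (intro qsubspace_sum [OF W]) (auto simp: qsubspace_def)
  then have yW: "y \<in> W"
    using W bW unfolding y_def qsubspace_def by blast
  then have yV: "y \<in> V"
    using V by blast
  have y_orth: "B y (e l) = 0" if "l < n" for l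
  proof -
    have "B (\<Sum>k<n. sm (e k) (B b (e k))) (e l) = (\<Sum>k<n. B (e k) (e l) * B b (e k))"
      using that eV by (simp add: sB)
    also have "\<dots> = (\<Sum>k<n. if k = l then - B b (e l) else 0)"
      using that e(2) by (intro sum.cong) auto
    finally show ?thesis
      using that eV bV by (simp add: y_def B_add_left)
  qed
  show ?case
  proof (cases "y = 0")
    case True
    then have "b = - (\<Sum>k<n. sm (e k) (B b (e k)))"
      by (simp add: y_def eq_neg_iff_add_eq_0)
    then show ?thesis
      using e by (intro exI [of _ n] exI [of _ e]) auto
  next
    case False
    define c where "c = - qRe (B y y)"
    have c: "c > 0"
      using neg [OF yW False] by (simp add: c_def)
    have Byy: "B y y = of_real (- c)"
      using B_self_real [OF yV] by (simp add: c_def)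
    \<comment> \<open>Scales the square of \<open>y\<close> from \<open>- c\<close> to -1.\<close>
    define t where "t = inverse (sqrt c)"
    have t: "t * t * c = 1"
      using c by (simp add: t_def field_simps)
    define f where "f = e(n := sm y (of_real t))"
    have fn: "f n = sm y (of_real t)" and fk: "\<And>k. k < n \<Longrightarrow> f k = e k"
      by (auto simp: f_def)
    have "sm y (of_real t) \<in> W"
      using yW W by (auto simp: qsubspace_def)
    then have fW: "\<forall>k<Suc n. f k \<in> W"
      using e(1) by (auto simp: f_def)
    have self: "B (f n) (f n) = - 1"
    proof -
      have "B (f n) (f n) = of_real (- (t * t * c))"
        using yV by (simp add: fn B_sm Byy) (simp add: quat_eq_iff)
      then show ?thesis
        using t by simp
    qed
    have orth: "B (f n) (e k) = 0" "B (e k) (f n) = 0" if "k < n" for k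
      using that y_orth [OF that] yV eV B_eq_0_commute [of y "e k"]
      by (simp_all add: fn B_sm_left B_sm_right)
    have ff: "\<forall>k<Suc n. \<forall>l<Suc n. B (f k) (f l) = (if k = l then - 1 else 0)"
      using e(2) orth self by (simp add: less_Suc_eq fk all_conj_distrib)
    have fnV: "f n \<in> V"
      using yV by (simp add: fn)
    have sum_f: "(\<Sum>k<Suc n. sm (f k) (B x (f k)))
        = (\<Sum>k<n. sm (e k) (B x (e k))) + sm (f n) (B x (f n))" for x
      by (simp add: fk)
    \<comment> \<open>Vectors treated earlier are combinations of the old \<open>e k\<close>, hence
      orthogonal to the new vector, and their expansions gain only a zero term.\<close>
    have "x = - (\<Sum>k<Suc n. sm (f k) (B x (f k)))" if "x \<in> A" for x
    proof -
      have x: "x = - (\<Sum>k<n. sm (e k) (B x (e k)))"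
        using e(3) that by blast
      have "B (- (\<Sum>k<n. sm (e k) (B x (e k)))) (f n) = 0"
        using eV fnV orth by (simp add: B_uminus_left sB)
      then have "B x (f n) = 0"
        using x by simp
      then show ?thesis
        using x sum_f [of x] fnV by simp
    qed
    moreover have "b = - (\<Sum>k<Suc n. sm (f k) (B b (f k)))"
    proof -
      have b: "b = y - (\<Sum>k<n. sm (e k) (B b (e k)))"
        by (simp add: y_def)
      have "B b (f n) = B y (f n) - B (\<Sum>k<n. sm (e k) (B b (e k))) (f n)"
        by (subst (1) b) (use yV eV fnV in \<open>simp add: B_diff_left\<close>)
      also have "B (\<Sum>k<n. sm (e k) (B b (e k))) (f n) = 0"
        using eV fnV orth by (simp add: sB)
      finally have "B b (f n) = of_real (- (t * c))"
        using yV by (simp add: fn B_sm_right Byy)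
      then have "sm (f n) (B b (f n)) = sm y (of_real (- (t * t * c)))"
        using yV by (simp add: fn sm_mult [symmetric] mult.assoc)
      also have "\<dots> = - y"
        using t yV by (simp add: sm_uminus_right)
      finally show ?thesis
        unfolding sum_f by (simp add: y_def)
    qed
    ultimately have "\<forall>x\<in>insert b A. x = - (\<Sum>k<Suc n. sm (f k) (B x (f k)))"
      by blast
    then show ?thesis
      using fW ff by (intro exI [of _ "Suc n"] exI [of _ f]) blast
  qed
qed

text \<open>Stated for an arbitrary decomposition because \<open>pontryagin_norm\<close> uses an
  unspecified one. Gram-Schmidt on a finite spanning set of \<open>Pm\<close> makes
  \<open>neg_part\<close> the projection to \<open>Pm\<close>, and the norms then agree
  exactly.\<close>

lemma fundamental_decomposition_basis:
  assumes P: "right_qvector_space P" "hermitian_form P" and D: "fundamental_decomposition P Pp Pm"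
  shows "\<exists>(n :: nat) e. pontryagin_basis P {..<n} e \<and>
    (\<forall>x\<in>qcarrier P. sqrt (qRe (decomposition_inner P Pp Pm x x)) = pre_pontryagin.hn P {..<n} e x)"
proof -
  interpret qhermitian P
    using P by unfold_locales
  have Wp: "qsubspace P Pp" and Wm: "qsubspace P Pm"
    and split: "V = {a + b | a b. a \<in> Pp \<and> b \<in> Pm}" and int: "Pp \<inter> Pm = {0}"
    and orth: "\<And>a b. a \<in> Pp \<Longrightarrow> b \<in> Pm \<Longrightarrow> B a b = 0"
    and hp: "right_qhilbert_space (P\<lparr>qcarrier := Pp\<rparr>)"
    and hm: "right_qhilbert_space (P\<lparr>qcarrier := Pm, qform := \<lambda>a b. - B a b\<rparr>)"
    and fin: "finite_qdim (P\<lparr>qcarrier := Pm\<rparr>)"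
    using D unfolding fundamental_decomposition_def by auto
  note Vp = qsubspace_mem [OF Wp] and Vm = qsubspace_mem [OF Wm]
  have pos: "0 < qRe (B a a)" if "a \<in> Pp" "a \<noteq> 0" for a
    using hp that unfolding right_qhilbert_space_def by simp
  have neg: "qRe (B a a) < 0" if "a \<in> Pm" "a \<noteq> 0" for a
    using hm that unfolding right_qhilbert_space_def by simp
  interpret m: qhermitian "P\<lparr>qcarrier := Pm\<rparr>"
    by (rule hermitian_carrier [OF Wm])
  obtain A where A: "finite A" "A \<subseteq> Pm" "qspan (P\<lparr>qcarrier := Pm\<rparr>) A = Pm"
    using fin unfolding finite_qdim_def by auto
  obtain n and e :: "nat \<Rightarrow> _" where e: "\<forall>k<n. e k \<in> Pm"
    "\<forall>k<n. \<forall>l<n. B (e k) (e l) = (if k = l then - 1 else 0)"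
    "\<forall>x\<in>A. x = - (\<Sum>k<(n::nat). sm (e k) (B x (e k)))"
    using negative_gram_schmidt [OF Wm neg A(1,2)] by blast
  let ?np = "\<lambda>x. - (\<Sum>k<n. sm (e k) (B x (e k)))"
  have eV: "\<And>k. k < n \<Longrightarrow> e k \<in> V"
    using e(1) Vm by blast
  have sV [simp]: "(\<Sum>k<n. sm (e k) (g k)) \<in> V" for g
    using eV by (intro sum_mem sm_mem) auto
  \<comment> \<open>The vectors of \<open>Pm\<close> that equal their expansion form a subspace
    containing the spanning set \<open>A\<close>, hence all of \<open>Pm\<close>.\<close>
  have "qsubspace (P\<lparr>qcarrier := Pm\<rparr>) {x \<in> Pm. x = ?np x}"
    unfolding qsubspace_def
  proof (intro conjI ballI allI)
    fix a b p assume a: "a \<in> {x \<in> Pm. x = ?np x}"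
    then have aV: "a \<in> V" "a \<in> Pm" "a = ?np a"
      using Vm by auto
    have "?np (sm a p) = sm (?np a) p"
      using aV(1) eV by (subst sm_uminus_left [OF sV], subst sm_sum_left) (auto simp: B_sm_left sm_mult)
    then show "qsmult (P\<lparr>qcarrier := Pm\<rparr>) a p \<in> {x \<in> Pm. x = ?np x}"
      using aV Wm unfolding qsubspace_def by simp
    assume "b \<in> {x \<in> Pm. x = ?np x}"
    then have bV: "b \<in> V" "b \<in> Pm" "b = ?np b"
      using Vm by auto
    have "?np (a + b) = ?np a + ?np b"
      using aV bV eV by (simp add: B_add_left sm_add_right sum.distrib)
    then show "a + b \<in> {x \<in> Pm. x = ?np x}"
      using aV bV Wm unfolding qsubspace_def by simp
  qed (use Wm eV in \<open>auto simp: qsubspace_def\<close>)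
  then have "qspan (P\<lparr>qcarrier := Pm\<rparr>) A \<subseteq> {x \<in> Pm. x = ?np x}"
    using A(2) e(3) by (intro m.qspan_subset) auto
  then have np: "x = ?np x" if "x \<in> Pm" for x
    using A(3) that by auto
  \<comment> \<open>The component in \<open>Pp\<close> is orthogonal to every \<open>e k\<close>, so
    the coefficients of \<open>x\<close> are those of its component in \<open>Pm\<close>.\<close>
  have parts: "\<exists>a\<in>Pp. \<exists>b\<in>Pm. x = a + b \<and> b = ?np x" if xV: "x \<in> V" for x
  proof -
    obtain a b where ab: "a \<in> Pp" "b \<in> Pm" "x = a + b"
      using xV split by auto
    have "B x (e k) = B b (e k)" if "k < n" for k
    proof -
      have "B a (e k) = 0" "a \<in> V" "b \<in> V" "e k \<in> V"
        using ab(1,2) that e(1) orth [of a "e k"] Vp [of a] Vm [of b] eV [of k] by auto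
      then show ?thesis
        unfolding ab(3) by (simp add: B_add_left)
    qed
    then have "?np x = ?np b"
      by simp
    then show ?thesis
      using ab np by metis
  qed
  interpret pre_pontryagin P "{..<n}" e
  proof
    show "0 \<le> qRe (B x x)" if x: "x \<in> V" "\<And>k. k \<in> {..<n} \<Longrightarrow> B x (e k) = 0" for x
    proof -
      obtain a b where ab: "a \<in> Pp" "b \<in> Pm" "x = a + b" "b = ?np x"
        using parts x by blast
      moreover have "?np x = 0"
        using x eV by (simp add: sum.neutral)
      ultimately have "x \<in> Pp"
        by (metis add.right_neutral)
      then show ?thesis
        using pos [of x] by (cases "x = 0") auto
    qed
  qed (use eV e(2) in auto)
  have npm: "neg_part x = ?np x" for x
    by (simp add: neg_part_def)
  have p_part: "x - neg_part x \<in> Pp" if "x \<in> V" for x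
    using parts [OF that] npm by (metis add_diff_cancel_right')
  have m_part: "neg_part x \<in> Pm" if "x \<in> V" for x
    using parts [OF that] npm by metis
  have orth_Pp: "x \<in> Pp" if "x \<in> V" "\<And>k. k \<in> {..<n} \<Longrightarrow> B x (e k) = 0" for x
    using p_part [OF that(1)] that eV by (simp add: neg_part_def sum.neutral)
  have hnp: "sqrt (qRe (B a a)) = hn a" if "a \<in> Pp" for a
    using that e(1) orth by (simp add: hn_def rip_def)
  have "pontryagin_basis P {..<n} e"
  proof
    show "0 < qRe (B x x)" if "x \<in> V" "\<And>k. k \<in> {..<n} \<Longrightarrow> B x (e k) = 0" "x \<noteq> 0" for x
      using orth_Pp pos that by blast
    show "\<exists>y\<in>V. hconv x y" if x: "\<And>i. x i \<in> V" "hCauchy x" for x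
    proof -
      \<comment> \<open>A Cauchy sequence is split: the finitely many coefficients converge and give
        a limit of the negative parts, while the residuals form a Cauchy sequence in the complete
        space \<open>Pp\<close>.\<close>
      have "\<exists>c. (\<lambda>i. B (x i) (e k)) \<longlonglongrightarrow> c" if "k < n" for k
        using hCauchy_B [of x "\<lambda>_. e k"] that x hconv_hCauchy [OF _ _ hconv_const]
        by (auto simp: convergent_def)
      then obtain c where c: "\<And>k. k < n \<Longrightarrow> (\<lambda>i. B (x i) (e k)) \<longlonglongrightarrow> c k"
        by metis
      define b where "b = - (\<Sum>k<n. sm (e k) (c k))"
      have bV: "b \<in> V"
        using eV by (simp add: b_def)
      have b: "hconv (\<lambda>i. neg_part (x i)) b"
      proof (rule hconv_dominated)
        fix i
        have "neg_part (x i) - b = - (\<Sum>k<n. sm (e k) (B (x i) (e k) - c k))"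
          using eV by (simp add: neg_part_def b_def sm_diff_right sum_subtractf)
        also have "hn \<dots> \<le> (\<Sum>k<n. hn (sm (e k) (B (x i) (e k) - c k)))"
          using eV by (subst hn_uminus) (auto intro!: hn_sum_le)
        also have "\<dots> = (\<Sum>k<n. hn (e k) * norm (B (x i) (e k) - c k))"
          using eV by (simp add: hn_sm)
        finally show "hn (neg_part (x i) - b) \<le> (\<Sum>k<n. hn (e k) * norm (B (x i) (e k) - c k))" .
      next
        have "(\<lambda>i. \<Sum>k<n. hn (e k) * norm (B (x i) (e k) - c k)) \<longlonglongrightarrow> (\<Sum>k<n. hn (e k) * 0)"
          using c by (intro tendsto_sum tendsto_mult tendsto_const tendsto_norm_zero LIM_zero) auto
        then show "(\<lambda>i. \<Sum>k<n. hn (e k) * norm (B (x i) (e k) - c k)) \<longlonglongrightarrow> 0"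
          by simp
      qed (use bV in auto)
      have Cauchy: "hCauchy (\<lambda>i. x i - neg_part (x i))"
        unfolding hCauchy_def
      proof (intro allI impI)
        fix \<epsilon> :: real assume "\<epsilon> > 0"
        then obtain N where N: "\<forall>i\<ge>N. \<forall>j\<ge>N. hn (x i - x j) < \<epsilon>"
          using x(2) unfolding hCauchy_def by blast
        have "hn (x i - neg_part (x i) - (x j - neg_part (x j))) \<le> hn (x i - x j)" for i j
          using hn_neg_part_diff_le [of "x i - x j"] x(1) by (simp add: neg_part_diff algebra_simps)
        then show "\<exists>N. \<forall>i\<ge>N. \<forall>j\<ge>N. hn (x i - neg_part (x i) - (x j - neg_part (x j))) < \<epsilon>"
          using N by (meson le_less_trans)
      qed
      have "Metric_space.mcomplete Pp (norm_dist Pp (\<lambda>a. sqrt (qRe (B a a))))"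
        using hp unfolding right_qhilbert_space_def by simp
      then have Pp_complete: "\<forall>x. (\<forall>i. x i \<in> Pp) \<longrightarrow> hCauchy x \<longrightarrow> (\<exists>y\<in>Pp. hconv x y)"
      proof (subst (asm) mcomplete_subspace [OF Wp])
        show "sqrt (qRe (B a a)) = hn a" if "a \<in> Pp" for a
          using hnp that .
        show "a = 0" if "a \<in> Pp" "hn a = 0" for a
          using hnp [OF that(1)] that pos [of a] by fastforce
      qed
      obtain a where a: "a \<in> Pp" "hconv (\<lambda>i. x i - neg_part (x i)) a"
        using spec [OF Pp_complete, of "\<lambda>i. x i - neg_part (x i)"] Cauchy p_part [OF x(1)]
        by auto
      have "hconv (\<lambda>i. (x i - neg_part (x i)) + neg_part (x i)) (a + b)"
        using a b bV Vp x(1) by (intro hconv_add) auto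
      then show ?thesis
        using a bV Vp by auto
    qed
  qed
  moreover have "sqrt (qRe (decomposition_inner P Pp Pm x x)) = hn x" if x: "x \<in> V" for x
  proof -
    \<comment> \<open>Two candidates for the positive component differ by a vector lying in both
      \<open>Pp\<close> and \<open>Pm\<close>.\<close>
    have "plus_part Pp Pm x = x - neg_part x"
      unfolding plus_part_def
    proof (rule the_equality)
      show "x - neg_part x \<in> Pp \<and> x - (x - neg_part x) \<in> Pm"
        using p_part m_part x by simp
      fix y assume y: "y \<in> Pp \<and> x - y \<in> Pm"
      have "neg_part x - (x - y) \<in> Pm"
        using y m_part [OF x] qsubspace_diff [OF Wm] by blast
      moreover have "y - (x - neg_part x) \<in> Pp"
        using y p_part [OF x] qsubspace_diff [OF Wp] by blast
      ultimately have "y - (x - neg_part x) \<in> Pp \<inter> Pm"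
        by (simp add: algebra_simps)
      then show "y = x - neg_part x"
        using int by simp
    qed
    then have "qRe (decomposition_inner P Pp Pm x x)
        = qRe (B (x - neg_part x) (x - neg_part x)) - qRe (B (neg_part x) (neg_part x))"
      by (simp add: decomposition_inner_def)
    also have "qRe (B (x - neg_part x) (x - neg_part x)) = qRe (B x x) - qRe (B (neg_part x) (neg_part x))"
      using x qRe_B_commute [of x "neg_part x"]
      by (simp add: B_diff_left B_diff_right B_neg_part_neg_part)
    finally have "qRe (decomposition_inner P Pp Pm x x) = rip x x"
      using x by (simp only: qRe_B_neg_part rip_self)
    then show ?thesis
      by (simp add: hn_def)
  qed
  ultimately show ?thesis
    by blast
qed

text \<open>The basis is built from the very decomposition that the choice in
  \<open>pontryagin_norm\<close> selects; hence an equality of norms and not just an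
  equivalence.\<close>

lemma pontryagin_basis_exists:
  assumes "pontryagin_space P"
  obtains n :: nat and e where "pontryagin_basis P {..<n} e"
    "\<And>x. x \<in> qcarrier P \<Longrightarrow> pontryagin_norm P x = pre_pontryagin.hn P {..<n} e x"
proof -
  define D where "D = (SOME D. fundamental_decomposition P (fst D) (snd D))"
  have "\<exists>D. fundamental_decomposition P (fst D) (snd D)"
    using assms unfolding pontryagin_space_def by auto
  then have "fundamental_decomposition P (fst D) (snd D)"
    unfolding D_def by (rule someI_ex)
  moreover have "pontryagin_norm P x = sqrt (qRe (decomposition_inner P (fst D) (snd D) x x))" for x
    unfolding pontryagin_norm_def D_def by (simp add: case_prod_beta)
  ultimately show ?thesis
    using fundamental_decomposition_basis [of P "fst D" "snd D"] assms that
    unfolding pontryagin_space_def by metis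
qed

section \<open>Bounded operators\<close>

lemma isometry_bound:
  assumes "pre_pontryagin P I e" "pre_pontryagin Q J f"
    and S: "\<And>x. x \<in> qcarrier P \<Longrightarrow> S x \<in> qcarrier Q"
    and form: "\<And>x y. x \<in> qcarrier P \<Longrightarrow> y \<in> qcarrier P \<Longrightarrow> qform Q (S x) (S y) = qform P x y"
    and onto: "\<And>k. k \<in> J \<Longrightarrow> \<exists>g\<in>qcarrier P. S g = f k"
  shows "\<exists>M\<ge>0. \<forall>x\<in>qcarrier P. pre_pontryagin.hn Q J f (S x) \<le> M * pre_pontryagin.hn P I e x"
proof -
  interpret p: pre_pontryagin P I e by fact
  interpret q: pre_pontryagin Q J f by fact
  obtain g where g: "\<And>k. k \<in> J \<Longrightarrow> g k \<in> p.V" "\<And>k. k \<in> J \<Longrightarrow> S (g k) = f k"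
    using onto by metis
  \<comment> \<open>The summands bound [x,x] and twice the sum of squared coefficients of
    \<open>S x\<close>, each relative to \<open>(p.hn x)\<^sup>2\<close>; the operator bound is
    \<open>sqrt M\<close>.\<close>
  define M where "M = p.cB + 2 * (\<Sum>k\<in>J. (p.cB * p.hn (g k))\<^sup>2)"
  have "M \<ge> 0"
    unfolding M_def using p.cB_pos by (simp add: sum_nonneg)
  have "q.hn (S x) \<le> sqrt M * p.hn x" if x: "x \<in> p.V" for x
  proof -
    have "(q.hn (S x))\<^sup>2 = qRe (p.B x x) + 2 * (\<Sum>k\<in>J. (norm (q.B (S x) (f k)))\<^sup>2)"
      using x S form by (simp add: q.hn_power2)
    also have "(\<Sum>k\<in>J. (norm (q.B (S x) (f k)))\<^sup>2) = (\<Sum>k\<in>J. (norm (p.B x (g k)))\<^sup>2)"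
      using x g form by (intro sum.cong) (simp_all flip: g(2))
    also have "\<dots> \<le> (\<Sum>k\<in>J. (p.cB * p.hn x * p.hn (g k))\<^sup>2)"
      using x g by (intro sum_mono power_mono p.norm_B_le) auto
    also have "\<dots> = (\<Sum>k\<in>J. (p.cB * p.hn (g k))\<^sup>2) * (p.hn x)\<^sup>2"
      unfolding sum_distrib_right by (intro sum.cong) (simp_all add: power_mult_distrib)
    also have "qRe (p.B x x) \<le> p.cB * (p.hn x)\<^sup>2"
      using qRe_le_norm(1) [of "p.B x x"] p.norm_B_le [OF x x]
      by (simp add: power2_eq_square mult.assoc)
    finally have "(q.hn (S x))\<^sup>2 \<le> M * (p.hn x)\<^sup>2"
      by (simp add: M_def algebra_simps)
    then have "q.hn (S x) \<le> sqrt (M * (p.hn x)\<^sup>2)"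
      by (rule real_le_rsqrt)
    then show ?thesis
      using x by (simp add: real_sqrt_mult p.hn_nonneg)
  qed
  then show ?thesis
    using \<open>M \<ge> 0\<close> by (intro exI [of _ "sqrt M"]) auto
qed

text \<open>Boundedness comes from \<open>isometry_bound\<close>: surjectivity places the negative
  basis of the target in the range.\<close>

lemma unitary_operatorI:
  assumes P: "pontryagin_space P" and Q: "pontryagin_space Q"
    and S: "right_linear P Q S" "bij_betw S (qcarrier P) (qcarrier Q)"
    and form: "\<And>x y. x \<in> qcarrier P \<Longrightarrow> y \<in> qcarrier P \<Longrightarrow> qform Q (S x) (S y) = qform P x y"
  shows "unitary_operator P Q S"
proof -
  obtain n :: nat and e where p: "pontryagin_basis P {..<n} e"
    "\<And>x. x \<in> qcarrier P \<Longrightarrow> pontryagin_norm P x = pre_pontryagin.hn P {..<n} e x"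
    using pontryagin_basis_exists [OF P] by blast
  obtain m :: nat and f where q: "pontryagin_basis Q {..<m} f"
    "\<And>x. x \<in> qcarrier Q \<Longrightarrow> pontryagin_norm Q x = pre_pontryagin.hn Q {..<m} f x"
    using pontryagin_basis_exists [OF Q] by blast
  interpret p: pontryagin_basis P "{..<n}" e by fact
  interpret q: pontryagin_basis Q "{..<m}" f by fact
  have SV: "\<And>x. x \<in> p.V \<Longrightarrow> S x \<in> q.V"
    using S(1) unfolding right_linear_def by blast
  have "\<exists>M\<ge>0. \<forall>x\<in>p.V. q.hn (S x) \<le> M * p.hn x"
  proof (rule isometry_bound [OF p.pre_pontryagin_axioms q.pre_pontryagin_axioms SV form])
    show "\<exists>g\<in>p.V. S g = f k" if "k \<in> {..<m}" for k
      using q.e_mem [OF that] S(2) unfolding bij_betw_def by (metis imageE)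
  qed
  then have "bounded_operator P Q S"
    unfolding bounded_operator_def using S(1) p(2) q(2) SV by auto
  then show ?thesis
    unfolding unitary_operator_def using S(2) form by blast
qed

section \<open>The coefficient space and adjoints of operators defined on it\<close>

lemma Hspace_simps [simp]:
  "qcarrier (Hspace :: (quat ^ 's) qspace) = UNIV"
  "qform Hspace c d = (\<Sum>i\<in>UNIV. qcnj (d $ i) * c $ i)"
  "qsmult Hspace c p $ i = c $ i * p"
  by (simp_all add: Hspace_def)

text \<open>The form is positive definite, so the negative basis is empty and \<open>hn\<close> is
  the usual vector norm.\<close>

lemma Hspace_pontryagin_basis: "pontryagin_basis (Hspace :: (quat ^ 's) qspace) ({} :: nat set) e"
proof -
  interpret qhermitian "Hspace :: (quat ^ 's) qspace"
  proof
    show "right_qvector_space (Hspace :: (quat ^ 's) qspace)"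
      unfolding right_qvector_space_def by (simp add: vec_eq_iff algebra_simps)
    show "hermitian_form (Hspace :: (quat ^ 's) qspace)"
      unfolding hermitian_form_def
      by (simp add: algebra_simps sum.distrib qcnj_sum qcnj_mult sum_distrib_left sum_distrib_right)
  qed
  have self: "qRe (B c c) = (norm c)\<^sup>2" for c :: "quat ^ 's"
    by (simp add: qRe_sum mult_qcnj_norm norm_vec_def L2_set_def sum_nonneg del: times_quat.simps)
  interpret pre_pontryagin "Hspace :: (quat ^ 's) qspace" "{} :: nat set" e
    by unfold_locales (simp_all only: self, auto)
  have hn: "hn c = norm c" for c
    unfolding hn_def rip_def self by simp
  show ?thesis
  proof
    show "0 < qRe (B x x)" if "x \<noteq> 0" for x :: "quat ^ 's"
      using that self by simp
    show "\<exists>y\<in>V. hconv s y" if "hCauchy s" for s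
    proof -
      have "Cauchy s"
        using that unfolding hCauchy_def hn by (intro CauchyI) blast
      then obtain y where "s \<longlonglongrightarrow> y"
        using Cauchy_convergent_iff convergent_def by blast
      then have "(\<lambda>i. norm (s i - y)) \<longlonglongrightarrow> 0"
        by (intro tendsto_norm_zero LIM_zero)
      then show ?thesis
        unfolding hconv_def hn by auto
    qed
  qed
qed

text \<open>The decomposition chosen for \<open>Hspace\<close> is unknown, but the norm of any basis
  dominates the square root of [c,c], which here is the vector norm. This direction bounds operators
  that start in \<open>Hspace\<close>.\<close>

lemma norm_le_pontryagin_norm: "norm c \<le> pontryagin_norm Hspace c" for c :: "quat ^ 's"
proof -
  have "pontryagin_space (Hspace :: (quat ^ 's) qspace)"
    using pontryagin_basis.pontryagin Hspace_pontryagin_basis by blast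
  then obtain n :: nat and e :: "nat \<Rightarrow> quat ^ 's" where p: "pontryagin_basis Hspace {..<n} e"
    "\<And>x. x \<in> qcarrier Hspace \<Longrightarrow> pontryagin_norm Hspace x = pre_pontryagin.hn Hspace {..<n} e x"
    using pontryagin_basis_exists by blast
  interpret pontryagin_basis "Hspace :: (quat ^ 's) qspace" "{..<n}" e
    by fact
  have "norm c = sqrt (qRe (B c c))"
    by (simp add: qRe_sum mult_qcnj_norm norm_vec_def L2_set_def del: times_quat.simps)
  then show ?thesis
    using sqrt_B_le_hn [of c] p(2) [of c] by simp
qed

context qhermitian
begin

lemma right_linear_Hspace_expand:
  fixes c :: "quat ^ 's"
  assumes "right_linear Hspace P C"
  shows "C c = (\<Sum>i\<in>UNIV. sm (C (axis i 1)) (c $ i))"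
proof -
  have C: "C a \<in> V" "C (a + b) = C a + C b" "C (qsmult Hspace a p) = sm (C a) p" for a b p
    using assms unfolding right_linear_def by auto
  have "C 0 = 0"
    using C(2) [of 0 0] by simp
  then have sum: "C (sum f A) = (\<Sum>i\<in>A. C (f i))" for f and A :: "'s set"
    by (induction A rule: infinite_finite_induct) (auto simp: C)
  have "c = (\<Sum>i\<in>UNIV. qsmult Hspace (axis i 1) (c $ i))"
    by (simp add: vec_eq_iff sum_component axis_def if_distrib [of "\<lambda>u. u * _"] cong: if_cong)
  then have "C c = C (\<Sum>i\<in>UNIV. qsmult Hspace (axis i 1) (c $ i))"
    by simp
  also have "\<dots> = (\<Sum>i\<in>UNIV. sm (C (axis i 1)) (c $ i))"
    by (simp add: sum C(3))
  finally show ?thesis .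
qed

text \<open>Validates the definite description: expanding in unit vectors shows that the displayed
  vector satisfies the adjoint identity, and testing on unit vectors shows that no other
  does.\<close>

lemma qadjoint_component:
  fixes i :: "'s::finite"
  assumes C: "right_linear Hspace P C" and b: "b \<in> V"
  shows "qadjoint Hspace P C b $ i = B b (C (axis i 1))"
proof -
  have CV: "C a \<in> V" for a
    using C unfolding right_linear_def by auto
  have "qadjoint Hspace P C b = (\<chi> i. B b (C (axis i 1)))"
    unfolding qadjoint_def
  proof (rule the_equality)
    show "(\<chi> i. B b (C (axis i 1))) \<in> qcarrier Hspace \<and>
        (\<forall>a\<in>qcarrier Hspace. B (C a) b = qform Hspace a (\<chi> i. B b (C (axis i 1))))"
    proof (intro conjI ballI)
      fix a
      show "B (C a) b = qform Hspace a (\<chi> i. B b (C (axis i 1)))"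
        by (subst right_linear_Hspace_expand [OF C, of a])
           (use CV b in \<open>simp add: B_sum_left B_sm_left B_cnj\<close>)
    qed simp
  next
    fix x assume x: "x \<in> qcarrier Hspace \<and> (\<forall>a\<in>qcarrier Hspace. B (C a) b = qform Hspace a x)"
    have "B (C (axis i 1)) b = qcnj (x $ i)" for i
      using x by (simp add: axis_def if_distrib [of "\<lambda>u. _ * u"] cong: if_cong)
    then have "x $ i = B b (C (axis i 1))" for i
      using B_cnj [OF CV b] by (metis qcnj_simps(4))
    then show "x = (\<chi> i. B b (C (axis i 1)))"
      by (simp add: vec_eq_iff)
  qed
  then show ?thesis
    by simp
qed

end

lemma bounded_operator_Hspace:
  fixes C :: "quat ^ 's \<Rightarrow> 'a::ab_group_add"
  assumes P: "pontryagin_space P" and C: "right_linear Hspace P C"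
  shows "bounded_operator Hspace P C"
proof -
  obtain n :: nat and e where p: "pontryagin_basis P {..<n} e"
    "\<And>x. x \<in> qcarrier P \<Longrightarrow> pontryagin_norm P x = pre_pontryagin.hn P {..<n} e x"
    using pontryagin_basis_exists [OF P] by blast
  interpret p: pontryagin_basis P "{..<n}" e by fact
  have CV: "C a \<in> p.V" for a
    using C unfolding right_linear_def by auto
  let ?M = "\<Sum>i\<in>UNIV. p.hn (C (axis i 1))"
  have "p.hn (C c) \<le> ?M * pontryagin_norm Hspace c" for c
  proof -
    have "p.hn (C c) \<le> (\<Sum>i\<in>UNIV. p.hn (p.sm (C (axis i 1)) (c $ i)))"
      unfolding p.right_linear_Hspace_expand [OF C, of c] using CV by (simp add: p.hn_sum_le)
    also have "\<dots> \<le> (\<Sum>i\<in>UNIV. p.hn (C (axis i 1)) * norm c)"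
      using CV by (intro sum_mono) (auto simp: p.hn_sm p.hn_nonneg Finite_Cartesian_Product.norm_nth_le
          intro!: mult_left_mono)
    also have "\<dots> = ?M * norm c"
      by (simp add: sum_distrib_right)
    also have "\<dots> \<le> ?M * pontryagin_norm Hspace c"
      using CV by (intro mult_left_mono norm_le_pontryagin_norm sum_nonneg) (simp add: p.hn_nonneg)
    finally show ?thesis .
  qed
  then show ?thesis
    unfolding bounded_operator_def using C p(2) CV by auto
qed

section \<open>Realizations\<close>

text \<open>The algebraic content of a unitary operator. It applies to the shift on a degenerate
  space too; boundedness is recovered in \<open>qisometry_bounded\<close> from a negative
  basis.\<close>

locale qisometry = qhermitian P for P :: "'a::ab_group_add qspace" +
  fixes U :: "'a \<Rightarrow> 'a"
  assumes U_linear: "right_linear P P U"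
    and U_bij: "bij_betw U V V"
    and U_form: "x \<in> V \<Longrightarrow> y \<in> V \<Longrightarrow> B (U x) (U y) = B x y"
begin

abbreviation "pw \<equiv> int_power P U"

lemma U_mem [simp]: "x \<in> V \<Longrightarrow> U x \<in> V"
  and U_add: "x \<in> V \<Longrightarrow> y \<in> V \<Longrightarrow> U (x + y) = U x + U y"
  and U_sm: "x \<in> V \<Longrightarrow> U (sm x p) = sm (U x) p"
  using U_linear unfolding right_linear_def by auto

lemma U_inj: "x \<in> V \<Longrightarrow> y \<in> V \<Longrightarrow> U x = U y \<Longrightarrow> x = y"
  using U_bij unfolding bij_betw_def by (meson inj_onD)

lemma inv_mem [simp]: "x \<in> V \<Longrightarrow> inv_into V U x \<in> V"
  and U_inv: "x \<in> V \<Longrightarrow> U (inv_into V U x) = x"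
  using U_bij unfolding bij_betw_def by (auto intro: inv_into_into f_inv_into_f)

lemma pw_mem [simp]: "x \<in> V \<Longrightarrow> pw n x \<in> V"
proof -
  assume x: "x \<in> V"
  have "(U ^^ k) x \<in> V" "(inv_into V U ^^ k) x \<in> V" for k
    using x by (induction k) auto
  then show ?thesis
    unfolding int_power_def by simp
qed

lemma pw_zero [simp]: "pw 0 x = x"
  unfolding int_power_def by simp

lemma pw_succ: "x \<in> V \<Longrightarrow> pw (n + 1) x = U (pw n x)"
proof (cases "n \<ge> 0")
  case True
  then show ?thesis
    unfolding int_power_def by (simp add: nat_add_distrib)
next
  case False
  assume x: "x \<in> V"
  \<comment> \<open>The number of inverses left after \<open>U\<close> cancels one of them; for
    \<open>k = 0\<close> the exponent \<open>n + 1\<close> is zero.\<close>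
  define k where "k = nat (- n - 1)"
  have n: "n = - 1 - int k"
    using False by (simp add: k_def)
  have "(inv_into V U ^^ k) x \<in> V"
    using x by (induction k) auto
  then have "U ((inv_into V U ^^ Suc k) x) = (inv_into V U ^^ k) x"
    by (simp add: U_inv)
  moreover have "pw n x = (inv_into V U ^^ Suc k) x"
    unfolding int_power_def n by (simp add: nat_add_distrib Suc_nat_eq_nat_zadd1)
  moreover have "pw (n + 1) x = (inv_into V U ^^ k) x"
    unfolding int_power_def n by (cases "k = 0") auto
  ultimately show ?thesis
    by simp
qed

lemma pw_pred: "x \<in> V \<Longrightarrow> U (pw (n - 1) x) = pw n x"
  using pw_succ [of x "n - 1"] by simp

text \<open>Induction runs in both directions. The downward step applies \<open>U\<close> to both
  sides and cancels it by injectivity, in place of additivity of the inverse.\<close>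

lemma pw_add: "x \<in> V \<Longrightarrow> y \<in> V \<Longrightarrow> pw n (x + y) = pw n x + pw n y"
proof (induction n rule: int_induct [where k = 0])
  case (step2 n)
  have "U (pw (n - 1) (x + y)) = U (pw (n - 1) x + pw (n - 1) y)"
    using step2 by (simp add: pw_pred U_add)
  then show ?case
    using step2 by - (rule U_inj, auto)
next
  case (step1 n)
  then have "U (pw n (x + y)) = U (pw n x + pw n y)"
    by simp
  then show ?case
    using step1 by (simp only: pw_succ add_mem sm_mem U_add pw_mem)
qed simp

lemma pw_sm: "x \<in> V \<Longrightarrow> pw n (sm x p) = sm (pw n x) p"
proof (induction n rule: int_induct [where k = 0])
  case (step2 n)
  have "U (pw (n - 1) (sm x p)) = U (sm (pw (n - 1) x) p)"
    using step2 by (simp add: pw_pred U_sm)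
  then show ?case
    using step2 by - (rule U_inj, auto)
next
  case (step1 n)
  then have "U (pw n (sm x p)) = U (sm (pw n x) p)"
    by simp
  then show ?case
    using step1 by (simp only: pw_succ add_mem sm_mem U_sm pw_mem)
qed simp

lemma pw_zero_right [simp]: "pw n 0 = 0"
  using pw_add [of 0 0 n] by simp

lemma pw_sum: "(\<And>i. i \<in> A \<Longrightarrow> f i \<in> V) \<Longrightarrow> pw n (sum f A) = (\<Sum>i\<in>A. pw n (f i))"
  by (induction A rule: infinite_finite_induct) (auto simp: pw_add)

lemma B_pw_pw: "x \<in> V \<Longrightarrow> y \<in> V \<Longrightarrow> B (pw (m + n) x) (pw n y) = B (pw m x) y"
proof (induction n rule: int_induct [where k = 0])
  case (step1 n)
  then show ?case
    using pw_succ [of x "m + n"] by (simp add: pw_succ U_form add.assoc)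
next
  case (step2 n)
  have "B (pw (m + (n - 1)) x) (pw (n - 1) y) = B (U (pw (m + n - 1) x)) (U (pw (n - 1) y))"
    using step2 by (simp add: U_form algebra_simps)
  then show ?case
    using step2 by (simp add: pw_pred)
qed auto

lemma B_pw: "x \<in> V \<Longrightarrow> y \<in> V \<Longrightarrow> B (pw m x) (pw n y) = B (pw (m - n) x) y"
  using B_pw_pw [of x y "m - n" n] by simp

end

lemma qisometry_bounded:
  assumes "pre_pontryagin P I e" "qisometry P U"
  shows "\<exists>M. \<forall>x\<in>qcarrier P. pre_pontryagin.hn P I e (U x) \<le> M * pre_pontryagin.hn P I e x"
proof -
  interpret pre_pontryagin P I e by fact
  interpret qisometry P U by fact
  have "\<exists>g\<in>V. U g = e k" if "k \<in> I" for k
    using U_inv [OF e_mem [OF that]] inv_mem [OF e_mem [OF that]] by blast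
  then show ?thesis
    using isometry_bound [OF pre_pontryagin_axioms pre_pontryagin_axioms U_mem U_form] by blast
qed

lemma axis_mult: "(A *v axis j 1) $ i = A $ i $ j" for A :: "quat ^ 's ^ 's"
  by (simp add: matrix_vector_mult_def axis_def if_distrib [of "\<lambda>u. _ * u"] cong: if_cong)

lemma right_linear_mem: "right_linear Hspace P C \<Longrightarrow> C c \<in> qcarrier P"
  unfolding right_linear_def by auto

text \<open>Testing the operator identity on unit vectors turns it into scalar identities between
  entries of \<open>r n\<close> and form values; \<open>realizationI\<close> goes back.\<close>

lemma realizationD:
  fixes r :: "int \<Rightarrow> quat ^ 's ^ 's"
  assumes "realization P U C r"
  shows "qisometry P U" "right_linear Hspace P C"
    "r n $ i $ j = qform P (int_power P U n (C (axis j 1))) (C (axis i 1))"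
proof -
  have P: "pontryagin_space P" and U: "unitary_operator P P U" and C: "right_linear Hspace P C"
    and r: "\<And>n c. r n *v c = qadjoint Hspace P C (int_power P U n (C c))"
    using assms unfolding realization_def bounded_operator_def by auto
  interpret qhermitian P
    using P unfolding pontryagin_space_def by unfold_locales auto
  show q: "qisometry P U"
    using U unfolding unitary_operator_def bounded_operator_def by unfold_locales auto
  interpret qisometry P U by fact
  show "right_linear Hspace P C" by fact
  have CV: "C c \<in> V" for c
    using C by (rule right_linear_mem)
  show "r n $ i $ j = B (pw n (C (axis j 1))) (C (axis i 1))"
    using r [of n "axis j 1"] axis_mult [of "r n" j i] CV by (simp add: qadjoint_component [OF C])
qed

lemma realizationI:
  fixes r :: "int \<Rightarrow> quat ^ 's ^ 's"
  assumes P: "pontryagin_space P" and U: "qisometry P U" and C: "right_linear Hspace P C"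
    and r: "\<And>n i j. r n $ i $ j = qform P (int_power P U n (C (axis j 1))) (C (axis i 1))"
  shows "realization P U C r"
proof -
  interpret qisometry P U by fact
  have CV: "C c \<in> V" for c
    using C by (rule right_linear_mem)
  have "r n *v c = qadjoint Hspace P C (int_power P U n (C c))" for n c
  proof (rule vec_eq_iff [THEN iffD2, rule_format])
    fix i
    have "qadjoint Hspace P C (pw n (C c)) $ i = B (pw n (C c)) (C (axis i 1))"
      using CV by (simp add: qadjoint_component [OF C])
    also have "\<dots> = (\<Sum>j\<in>UNIV. B (pw n (C (axis j 1))) (C (axis i 1)) * c $ j)"
      by (subst right_linear_Hspace_expand [OF C, of c])
         (use CV in \<open>simp add: pw_sum pw_sm B_sum_left B_sm_left\<close>)
    also have "\<dots> = (r n *v c) $ i"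
      by (simp add: matrix_vector_mult_def r)
    finally show "(r n *v c) $ i = qadjoint Hspace P C (pw n (C c)) $ i" ..
  qed
  then show ?thesis
    unfolding realization_def
    using P bounded_operator_Hspace [OF P C] unitary_operatorI [OF P P U_linear U_bij U_form] by blast
qed

section \<open>A realization has finitely many negative squares\<close>

lemma conj_transpose_component:
  "(\<forall>n. r (- n) = conj_transpose (r n)) \<longleftrightarrow> (\<forall>n i j. r (- n) $ i $ j = qcnj (r n $ j $ i))"
  by (simp add: conj_transpose_def vec_eq_iff)

lemma hmatrix_block_toeplitz:
  fixes r :: "int \<Rightarrow> quat ^ 's ^ 's"
  assumes "\<forall>n. r (- n) = conj_transpose (r n)"
  shows "hmatrix (toeplitz_index N) (block_toeplitz r)"
proof
  show "finite (toeplitz_index N :: (nat \<times> 's) set)"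
    unfolding toeplitz_index_def by simp
  show "block_toeplitz r p q = qcnj (block_toeplitz r q p)" for p q
    using assms [unfolded conj_transpose_component, rule_format, of "int (fst p) - int (fst q)"]
    unfolding block_toeplitz_def by (simp add: case_prod_beta)
qed

text \<open>The identity W^* T W = D, from T = W D W^* and W^* W = 1: columns of \<open>W\<close>
  are orthogonal for the form of \<open>T\<close>, with squares \<open>d k\<close>.\<close>

lemma diagonalizes_form:
  assumes "finite I" "diagonalizes I T W d" "k \<in> I" "l \<in> I"
  shows "(\<Sum>q\<in>I. \<Sum>p\<in>I. qcnj (W q l) * T q p * W p k) = (if l = k then of_real (d k) else 0)"
proof -
  have WW: "\<And>i j. i \<in> I \<Longrightarrow> j \<in> I \<Longrightarrow> (\<Sum>k\<in>I. qcnj (W k i) * W k j) = (if i = j then 1 else 0)"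
    and T: "\<And>i j. i \<in> I \<Longrightarrow> j \<in> I \<Longrightarrow> T i j = (\<Sum>k\<in>I. W i k * of_real (d k) * qcnj (W j k))"
    using assms(2) unfolding diagonalizes_def unitary_qmatrix_def by auto
  have "(\<Sum>q\<in>I. \<Sum>p\<in>I. qcnj (W q l) * T q p * W p k)
      = (\<Sum>q\<in>I. \<Sum>p\<in>I. \<Sum>m\<in>I. (qcnj (W q l) * W q m) * of_real (d m) * (qcnj (W p m) * W p k))"
    by (simp add: T sum_distrib_left sum_distrib_right mult.assoc)
  also have "\<dots> = (\<Sum>q\<in>I. \<Sum>m\<in>I. \<Sum>p\<in>I. (qcnj (W q l) * W q m) * of_real (d m) * (qcnj (W p m) * W p k))"
    by (intro sum.cong refl sum.swap)
  also have "\<dots> = (\<Sum>m\<in>I. \<Sum>q\<in>I. \<Sum>p\<in>I. (qcnj (W q l) * W q m) * of_real (d m) * (qcnj (W p m) * W p k))"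
    by (rule sum.swap)
  also have "\<dots> = (\<Sum>m\<in>I. (\<Sum>q\<in>I. qcnj (W q l) * W q m) * of_real (d m) * (\<Sum>p\<in>I. qcnj (W p m) * W p k))"
    by (simp add: sum_distrib_left sum_distrib_right, rule sum.cong [OF refl], rule sum.swap)
  also have "\<dots> = (\<Sum>m\<in>I. if m = l then (if l = k then of_real (d k) else 0) else 0)"
    using assms(3,4) WW by (intro sum.cong) auto
  also have "\<dots> = (if l = k then of_real (d k) else 0)"
    using assms by simp
  finally show ?thesis .
qed

lemma bounded_attained:
  fixes f :: "nat \<Rightarrow> nat"
  assumes "\<And>N. f N \<le> b"
  shows "\<exists>\<kappa>. (\<forall>N. f N \<le> \<kappa>) \<and> (\<exists>N. f N = \<kappa>)"
proof (intro exI conjI allI)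
  have fin: "finite (range f)"
    using assms by (meson finite_atMost finite_subset atMost_iff image_subset_iff)
  show "f N \<le> Max (range f)" for N
    using fin by simp
  show "f (SOME N. f N = Max (range f)) = Max (range f)"
    using Max_in [OF fin] by (intro someI_ex [of "\<lambda>N. f N = Max (range f)"]) auto
qed

lemma realization_negative_squares:
  fixes r :: "int \<Rightarrow> quat ^ 's ^ 's"
  assumes "realization P U C r"
  shows "\<exists>\<kappa>. negative_squares r \<kappa>"
proof -
  have "pontryagin_space P"
    using assms unfolding realization_def by blast
  then obtain n :: nat and e where "pontryagin_basis P {..<n} e"
    using pontryagin_basis_exists by blast
  then interpret pontryagin_basis P "{..<n}" e .
  interpret qisometry P U
    using realizationD(1) [OF assms] .
  note C = realizationD(2) [OF assms]
  have CV: "C c \<in> V" for c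
    using C by (rule right_linear_mem)
  note r = realizationD(3) [OF assms]
  have herm: "\<forall>n. r (- n) = conj_transpose (r n)"
    unfolding conj_transpose_component
  proof (intro allI)
    fix n i j
    have "B (pw (- n) (C (axis j 1))) (C (axis i 1)) = B (C (axis j 1)) (pw n (C (axis i 1)))"
      using B_pw [OF CV CV, of 0 _ n] by simp
    then show "r (- n) $ i $ j = qcnj (r n $ j $ i)"
      unfolding r using CV by (simp add: B_cnj)
  qed
  have "negative_eigenvalues r N \<le> card {..<n}" for N
  proof -
    define I where "I = (toeplitz_index N :: (nat \<times> 's) set)"
    define T where "T = block_toeplitz r"
    interpret h: hmatrix I T
      unfolding I_def T_def by (rule hmatrix_block_toeplitz [OF herm])
    obtain W d where W: "diagonalizes I T W d"
      and neg: "negative_eigenvalues r N = card {k \<in> I. d k < 0}"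
      unfolding negative_eigenvalues_def using h.negative_count unfolding I_def T_def by blast
    \<comment> \<open>The block Toeplitz matrix is the Gram matrix of the vectors obtained by
      applying the powers 0 to \<open>N\<close> of \<open>U\<close> to the images of the unit
      vectors.\<close>
    define v where "v = (\<lambda>(j, b). pw (int j) (C (axis b 1)))"
    have vV: "v p \<in> V" for p
      unfolding v_def using CV by (simp add: case_prod_beta)
    have vv: "B (v p) (v q) = T q p" for p q
      unfolding v_def T_def block_toeplitz_def using CV by (simp add: case_prod_beta B_pw r)
    \<comment> \<open>Combining the \<open>v p\<close> by the columns of \<open>W\<close> gives
      orthogonal vectors with squares \<open>d k\<close>, to which \<open>neg_count\<close>
      applies.\<close>
    define x where "x k = (\<Sum>p\<in>I. sm (v p) (W p k))" for k
    have "B (x k) (x l) = (if l = k then of_real (d k) else 0)" if "k \<in> I" "l \<in> I" for k l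
    proof -
      have "B (x k) (x l) = (\<Sum>q\<in>I. \<Sum>p\<in>I. qcnj (W q l) * T q p * W p k)"
        unfolding x_def using vV by (simp add: B_sum_left B_sum_right B_sm vv)
      then show ?thesis
        using diagonalizes_form [OF h.finI W that] by simp
    qed
    then have "card {k \<in> I. d k < 0} \<le> card {..<n}"
      using vV by (intro neg_count [of _ x d]) (auto simp: x_def)
    then show ?thesis
      by (simp add: neg)
  qed
  then show ?thesis
    unfolding negative_squares_def using bounded_attained herm by meson
qed

section \<open>Uniqueness of minimal realizations\<close>

text \<open>Pairs of sums over the same list of generators: a relation needs no proof that equal
  sums on one side have equal partners. Coefficients are absent because the generators absorb
  scalars.\<close>

inductive lincomb :: "('x \<Rightarrow> 'a::ab_group_add) \<Rightarrow> ('x \<Rightarrow> 'b::ab_group_add) \<Rightarrow> 'a \<Rightarrow> 'b \<Rightarrow> bool"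
  for g h where
  zero: "lincomb g h 0 0"
| step: "lincomb g h x y \<Longrightarrow> lincomb g h (x + g k) (y + h k)"

lemma lincomb_swap: "lincomb g h x y \<Longrightarrow> lincomb h g y x"
  by (induction rule: lincomb.induct) (auto intro: lincomb.intros)

lemma lincomb_gen: "lincomb g h (g k) (h k)"
  using lincomb.step [OF lincomb.zero, of g h k] by simp

lemma lincomb_add:
  assumes "lincomb g h x y" "lincomb g h x' y'"
  shows "lincomb g h (x + x') (y + y')"
  using assms(2,1)
  by (induction rule: lincomb.induct)
    (auto simp: add.assoc [symmetric] intro: lincomb.intros)

lemma pontryagin_dense:
  assumes P: "pontryagin_basis P I e" and norm: "\<And>x. x \<in> qcarrier P \<Longrightarrow> pontryagin_norm P x = pre_pontryagin.hn P I e x"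
    and dense: "pontryagin_topology P closure_of D = qcarrier P"
    and x: "x \<in> qcarrier P" "\<epsilon> > 0"
  shows "\<exists>y\<in>D. y \<in> qcarrier P \<and> pre_pontryagin.hn P I e (x - y) < \<epsilon>"
proof -
  interpret pontryagin_basis P I e by fact
  interpret M: Metric_space V "norm_dist V (pontryagin_norm P)"
    using qsubspace_V norm hn_eq_0 by (rule metric_subspace)
  have "x \<in> M.mtopology closure_of D"
    using dense x unfolding pontryagin_topology_def by simp
  then obtain y where "y \<in> D" "y \<in> M.mball x \<epsilon>"
    using x(2) unfolding M.metric_closure_of by blast
  then show ?thesis
    using norm [of "x - y"] by (auto simp: norm_dist_def split: if_splits)
qed

locale min_real = pontryagin_basis P I e + qisometry P U
  for P :: "'a::ab_group_add qspace" and I :: "'i set" and e :: "'i \<Rightarrow> 'a" and U :: "'a \<Rightarrow> 'a" +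
  fixes C :: "quat ^ 's \<Rightarrow> 'a"
  assumes C_linear: "right_linear Hspace P C"
    and dense: "x \<in> V \<Longrightarrow> \<epsilon> > 0 \<Longrightarrow>
      \<exists>y\<in>qspan P (\<Union>n. range (\<lambda>c. int_power P U n (C c))). hn (x - y) < \<epsilon>"
begin

definition gen :: "int \<times> (quat ^ 's) \<Rightarrow> 'a" where
  "gen = (\<lambda>(n, c). pw n (C c))"

lemma C_mem [simp]: "C c \<in> V"
  using C_linear by (rule right_linear_mem)

lemma gen_mem [simp]: "gen k \<in> V"
  unfolding gen_def by (simp add: case_prod_beta)

lemma gen_sm: "sm (gen (n, c)) p = gen (n, qsmult Hspace c p)"
  using C_linear unfolding gen_def right_linear_def by (simp add: pw_sm)

lemma U_gen: "U (gen (n, c)) = gen (n + 1, c)"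
  unfolding gen_def by (simp add: pw_succ)

lemma lincomb_mem: "lincomb gen h x y \<Longrightarrow> x \<in> V"
  by (induction rule: lincomb.induct) auto

lemma U_hconv:
  assumes "\<And>i. x i \<in> V" "a \<in> V" "hconv x a"
  shows "hconv (\<lambda>i. U (x i)) (U a)"
proof -
  obtain M where M: "\<And>x. x \<in> V \<Longrightarrow> hn (U x) \<le> M * hn x"
    using qisometry_bounded [OF pre_pontryagin_axioms qisometry_axioms] by blast
  have diff: "U x - U y = U (x - y)" if "x \<in> V" "y \<in> V" for x y
    using U_add [of "x - y" y] that by (simp add: algebra_simps)
  show ?thesis
  proof (rule hconv_dominated)
    show "hn (U (x i) - U a) \<le> M * hn (x i - a)" for i
      using M [of "x i - a"] assms(1,2) by (simp add: diff)
    show "(\<lambda>i. M * hn (x i - a)) \<longlonglongrightarrow> 0"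
      using assms(3) unfolding hconv_def by (rule tendsto_mult_right_zero)
  qed (use assms in auto)
qed

end

locale real_pair = r1: min_real P I e U C + r2: min_real Q J f W D
  for P :: "'a::ab_group_add qspace" and I :: "'i set" and e :: "'i \<Rightarrow> 'a" and U :: "'a \<Rightarrow> 'a"
    and C :: "quat ^ 's \<Rightarrow> 'a"
    and Q :: "'b::ab_group_add qspace" and J :: "'j set" and f :: "'j \<Rightarrow> 'b" and W :: "'b \<Rightarrow> 'b"
    and D :: "quat ^ 's \<Rightarrow> 'b" +
  assumes same: "r1.B (r1.pw n (C c)) (C d) = r2.B (r2.pw n (D c)) (D d)"
begin

abbreviation "R \<equiv> lincomb r1.gen r2.gen"

lemma R_mem: "R x y \<Longrightarrow> x \<in> r1.V" "R x y \<Longrightarrow> y \<in> r2.V"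
  using r1.lincomb_mem r2.lincomb_mem lincomb_swap by blast+

lemma R_sm: "R x y \<Longrightarrow> R (r1.sm x p) (r2.sm y p)"
proof (induction rule: lincomb.induct)
  case (step x y k)
  obtain n c where k: "k = (n, c)"
    by (cases k)
  show ?case
    using lincomb.step [OF step.IH, of "(n, qsmult Hspace c p)"] R_mem [OF step.hyps]
    by (simp add: k r1.sm_add_left r2.sm_add_left r1.gen_sm r2.gen_sm)
qed (simp add: lincomb.zero)

lemma R_diff: "R x y \<Longrightarrow> R x' y' \<Longrightarrow> R (x - x') (y - y')"
  using lincomb_add [of _ _ x y "- x'" "- y'"] R_sm [of x' y' "- 1"] R_mem [of x' y']
  by (simp add: r1.sm_uminus_right r2.sm_uminus_right)

lemma R_isometry: "R x y \<Longrightarrow> R (U x) (W y)"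
proof (induction rule: lincomb.induct)
  case zero
  show ?case
    using r1.U_add [of 0 0] r2.U_add [of 0 0] lincomb.zero by simp
next
  case (step x y k)
  obtain n c where k: "k = (n, c)"
    by (cases k)
  show ?case
    using lincomb.step [OF step.IH, of "(n + 1, c)"] R_mem [OF step.hyps]
    by (simp add: k r1.U_add r2.U_add r1.U_gen r2.U_gen)
qed

lemma R_form: "R x y \<Longrightarrow> R x' y' \<Longrightarrow> r1.B x x' = r2.B y y'"
proof (induction rule: lincomb.induct)
  case zero
  then show ?case
    using R_mem by simp
next
  case (step x y k)
  have "r1.B (r1.gen k) x' = r2.B (r2.gen k) y'"
    using step.prems
  proof (induction rule: lincomb.induct)
    case (step x' y' l)
    have "r1.B (r1.gen k) (r1.gen l) = r2.B (r2.gen k) (r2.gen l)"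
      unfolding r1.gen_def r2.gen_def by (simp add: case_prod_beta r1.B_pw r2.B_pw same)
    then show ?case
      using step R_mem [OF step.hyps] by (simp add: r1.B_add_right r2.B_add_right)
  qed simp
  then show ?case
    using step R_mem [OF step.hyps] R_mem [OF step.prems]
    by (simp add: r1.B_add_left r2.B_add_left)
qed

lemma span_R: "x \<in> qspan P (\<Union>n. range (\<lambda>c. r1.pw n (C c))) \<Longrightarrow> \<exists>y. R x y"
proof -
  have "qspan P (\<Union>n. range (\<lambda>c. r1.pw n (C c))) \<subseteq> {x. \<exists>y. R x y}"
  proof (rule r1.qspan_subset)
    show "(\<Union>n. range (\<lambda>c. r1.pw n (C c))) \<subseteq> {x. \<exists>y. R x y}"
    proof clarify
      fix n c
      show "\<exists>y. R (r1.pw n (C c)) y"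
        using lincomb_gen [of r1.gen r2.gen "(n, c)"] unfolding r1.gen_def by auto
    qed
    show "qsubspace P {x. \<exists>y. R x y}"
      unfolding qsubspace_def using R_mem lincomb_add R_sm lincomb.zero by blast
  qed
  then show "x \<in> qspan P (\<Union>n. range (\<lambda>c. r1.pw n (C c))) \<Longrightarrow> \<exists>y. R x y"
    by blast
qed

end

text \<open>The vectors \<open>f k\<close> need not lie in the span of the generators of \<open>Q\<close>; they are replaced by
  approximations from the span, and the error is absorbed into the left-hand side.\<close>

lemma (in real_pair) R_bounded:
  assumes onto: "\<And>y. y \<in> qspan Q (\<Union>n. range (\<lambda>c. r2.pw n (D c))) \<Longrightarrow> \<exists>x. R x y"
  shows "\<exists>M\<ge>0. \<forall>x y. R x y \<longrightarrow> r2.hn y \<le> M * r1.hn x"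
proof -
  define m where "m = real (card J)"
  \<comment> \<open>Makes the coefficient \<open>4 * m * (r2.cB * \<epsilon>)\<^sup>2\<close> of the
    error term at most 1/2; \<open>m + 1\<close> avoids division by zero for an empty basis.\<close>
  define \<epsilon> where "\<epsilon> = 1 / (r2.cB * 4 * (m + 1))"
  have m: "m \<ge> 0"
    by (simp add: m_def)
  then have \<epsilon>: "\<epsilon> > 0" "r2.cB * \<epsilon> = 1 / (4 * (m + 1))"
    using r2.cB_pos by (simp_all add: \<epsilon>_def)
  have "\<exists>u v. R u v \<and> r2.hn (f k - v) < \<epsilon>" if "k \<in> J" for k
    using r2.dense [OF r2.e_mem [OF that] \<epsilon>(1)] onto by blast
  then obtain u v where uv: "\<And>k. k \<in> J \<Longrightarrow> R (u k) (v k)" "\<And>k. k \<in> J \<Longrightarrow> r2.hn (f k - v k) < \<epsilon>"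
    by metis
  define G where "G = (\<Sum>k\<in>J. r1.cB * r1.hn (u k))"
  \<comment> \<open>The factor 2 pays for absorbing half of the squared norm of \<open>y\<close>
    into the left-hand side.\<close>
  define M where "M = 2 * (r1.cB + 4 * m * G\<^sup>2)"
  have "M \<ge> 0"
    using r1.cB_pos m by (simp add: M_def)
  have "r2.hn y \<le> sqrt M * r1.hn x" if xy: "R x y" for x y
  proof -
    define a b where "a = r1.hn x" and "b = r2.hn y"
    have xV: "x \<in> r1.V" and yV: "y \<in> r2.V"
      using R_mem xy by auto
    then have ab: "a \<ge> 0" "b \<ge> 0"
      by (simp_all add: a_def b_def r1.hn_nonneg r2.hn_nonneg)
    have coef: "(norm (r2.B y (f k)))\<^sup>2 \<le> 2 * G\<^sup>2 * a\<^sup>2 + 2 * (r2.cB * \<epsilon>)\<^sup>2 * b\<^sup>2" if k: "k \<in> J" for k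
    proof -
      have uV: "u k \<in> r1.V" and vV: "v k \<in> r2.V" and fV: "f k \<in> r2.V"
        using R_mem [OF uv(1) [OF k]] k by auto
      have "r1.cB * r1.hn (u k) \<le> G"
        unfolding G_def using k R_mem(1) [OF uv(1)] r1.cB_pos
        by (intro member_le_sum [of _ _ "\<lambda>k. r1.cB * r1.hn (u k)"]) (auto simp: r1.hn_nonneg)
      have "r2.B y (f k) = r1.B x (u k) + r2.B y (f k - v k)"
        using R_form [OF xy uv(1) [OF k]] yV vV fV by (simp add: r2.B_diff_right)
      also have "norm \<dots> \<le> r1.cB * a * r1.hn (u k) + r2.cB * b * r2.hn (f k - v k)"
        unfolding a_def b_def using xV uV yV vV fV
        by (intro order_trans [OF norm_triangle_ineq] add_mono r1.norm_B_le r2.norm_B_le) auto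
      also have "\<dots> \<le> G * a + r2.cB * \<epsilon> * b"
      proof (rule add_mono)
        show "r1.cB * a * r1.hn (u k) \<le> G * a"
          using mult_right_mono [OF \<open>r1.cB * r1.hn (u k) \<le> G\<close> ab(1)] by (simp add: mult_ac)
        have "r2.cB * b * r2.hn (f k - v k) \<le> r2.cB * b * \<epsilon>"
          using uv(2) [OF k] ab r2.cB_pos by (intro mult_left_mono) auto
        then show "r2.cB * b * r2.hn (f k - v k) \<le> r2.cB * \<epsilon> * b"
          by (simp add: mult_ac)
      qed
      finally have "(norm (r2.B y (f k)))\<^sup>2 \<le> (G * a + r2.cB * \<epsilon> * b)\<^sup>2"
        by (intro power_mono) auto
      also have "\<dots> \<le> 2 * (G * a)\<^sup>2 + 2 * (r2.cB * \<epsilon> * b)\<^sup>2"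
        using zero_le_power2 [of "G * a - r2.cB * \<epsilon> * b"] by (simp add: power2_sum power2_diff)
      finally show ?thesis
        by (simp add: power_mult_distrib)
    qed
    have "b\<^sup>2 = qRe (r1.B x x) + 2 * (\<Sum>k\<in>J. (norm (r2.B y (f k)))\<^sup>2)"
      unfolding b_def using yV R_form [OF xy xy] by (simp add: r2.hn_power2)
    also have "\<dots> \<le> r1.cB * a\<^sup>2 + 2 * (\<Sum>k\<in>J. 2 * G\<^sup>2 * a\<^sup>2 + 2 * (r2.cB * \<epsilon>)\<^sup>2 * b\<^sup>2)"
    proof -
      have "qRe (r1.B x x) \<le> r1.cB * a\<^sup>2"
        using qRe_le_norm(1) [of "r1.B x x"] r1.norm_B_le [OF xV xV]
        by (simp add: a_def power2_eq_square mult.assoc)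
      then show ?thesis
        using coef by (intro add_mono mult_left_mono sum_mono) auto
    qed
    also have "\<dots> = (r1.cB + 4 * m * G\<^sup>2) * a\<^sup>2 + 4 * m * (r2.cB * \<epsilon>)\<^sup>2 * b\<^sup>2"
      by (simp add: m_def algebra_simps)
    also have "\<dots> \<le> (r1.cB + 4 * m * G\<^sup>2) * a\<^sup>2 + 1 / 2 * b\<^sup>2"
    proof -
      have "4 * m * (r2.cB * \<epsilon>)\<^sup>2 \<le> 1 / 2"
      proof -
        have "8 * m \<le> (4 * (m + 1))\<^sup>2"
          using m by (simp add: power2_eq_square algebra_simps)
        then show ?thesis
          unfolding \<epsilon>(2) using m by (simp add: power_divide divide_simps)
      qed
      then show ?thesis
        by (intro add_left_mono mult_right_mono) auto
    qed
    finally have "b\<^sup>2 \<le> M * a\<^sup>2"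
      unfolding M_def mult.assoc by linarith
    then have "b \<le> sqrt (M * a\<^sup>2)"
      by (rule real_le_rsqrt)
    then show ?thesis
      using ab by (simp add: real_sqrt_mult a_def b_def)
  qed
  then show ?thesis
    using \<open>M \<ge> 0\<close> by (intro exI [of _ "sqrt M"]) auto
qed

context real_pair
begin

text \<open>Closure of the graph in both norms at once. Being symmetric in the two spaces, it makes
  surjectivity the same statement as totality with the roles exchanged.\<close>

definition rel :: "'a \<Rightarrow> 'b \<Rightarrow> bool" where
  "rel x y \<longleftrightarrow> x \<in> r1.V \<and> y \<in> r2.V \<and>
     (\<exists>xs ys. (\<forall>i. R (xs i) (ys i)) \<and> r1.hconv xs x \<and> r2.hconv ys y)"

lemma rel_mem: "rel x y \<Longrightarrow> x \<in> r1.V" "rel x y \<Longrightarrow> y \<in> r2.V"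
  unfolding rel_def by auto

lemma rel_form: "rel x y \<Longrightarrow> rel x' y' \<Longrightarrow> r1.B x x' = r2.B y y'"
proof -
  assume xy: "rel x y" "rel x' y'"
  obtain xs ys where s: "\<And>i. R (xs i) (ys i)" "r1.hconv xs x" "r2.hconv ys y"
    using xy(1) unfolding rel_def by blast
  obtain xs' ys' where s': "\<And>i. R (xs' i) (ys' i)" "r1.hconv xs' x'" "r2.hconv ys' y'"
    using xy(2) unfolding rel_def by blast
  have "(\<lambda>i. r1.B (xs i) (xs' i)) \<longlonglongrightarrow> r1.B x x'"
    using s s' R_mem rel_mem xy by (intro r1.hconv_B) blast+
  moreover have "(\<lambda>i. r2.B (ys i) (ys' i)) \<longlonglongrightarrow> r2.B y y'"
    using s s' R_mem rel_mem xy by (intro r2.hconv_B) blast+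
  moreover have "r1.B (xs i) (xs' i) = r2.B (ys i) (ys' i)" for i
    using R_form s(1) s'(1) by blast
  ultimately show ?thesis
    using LIMSEQ_unique by simp
qed

lemma rel_add: "rel x y \<Longrightarrow> rel x' y' \<Longrightarrow> rel (x + x') (y + y')"
proof -
  assume xy: "rel x y" "rel x' y'"
  obtain xs ys where s: "\<And>i. R (xs i) (ys i)" "r1.hconv xs x" "r2.hconv ys y"
    using xy(1) unfolding rel_def by blast
  obtain xs' ys' where s': "\<And>i. R (xs' i) (ys' i)" "r1.hconv xs' x'" "r2.hconv ys' y'"
    using xy(2) unfolding rel_def by blast
  have "r1.hconv (\<lambda>i. xs i + xs' i) (x + x')"
    using s s' R_mem rel_mem xy by (intro r1.hconv_add) blast+
  moreover have "r2.hconv (\<lambda>i. ys i + ys' i) (y + y')"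
    using s s' R_mem rel_mem xy by (intro r2.hconv_add) blast+
  moreover have "R (xs i + xs' i) (ys i + ys' i)" for i
    using lincomb_add s(1) s'(1) by blast
  ultimately show ?thesis
    unfolding rel_def using rel_mem xy by (auto intro!: exI)
qed

lemma rel_sm: "rel x y \<Longrightarrow> rel (r1.sm x p) (r2.sm y p)"
proof -
  assume xy: "rel x y"
  obtain xs ys where s: "\<And>i. R (xs i) (ys i)" "r1.hconv xs x" "r2.hconv ys y"
    using xy unfolding rel_def by blast
  have "r1.hconv (\<lambda>i. r1.sm (xs i) p) (r1.sm x p)"
    using s R_mem rel_mem xy by (intro r1.hconv_sm) blast+
  moreover have "r2.hconv (\<lambda>i. r2.sm (ys i) p) (r2.sm y p)"
    using s R_mem rel_mem xy by (intro r2.hconv_sm) blast+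
  moreover have "R (r1.sm (xs i) p) (r2.sm (ys i) p)" for i
    using R_sm s(1) by blast
  ultimately show ?thesis
    unfolding rel_def using rel_mem xy by (auto intro!: exI)
qed

lemma rel_isometry: "rel x y \<Longrightarrow> rel (U x) (W y)"
proof -
  assume xy: "rel x y"
  obtain xs ys where s: "\<And>i. R (xs i) (ys i)" "r1.hconv xs x" "r2.hconv ys y"
    using xy unfolding rel_def by blast
  have "r1.hconv (\<lambda>i. U (xs i)) (U x)"
    using s R_mem rel_mem xy by (intro r1.U_hconv) blast+
  moreover have "r2.hconv (\<lambda>i. W (ys i)) (W y)"
    using s R_mem rel_mem xy by (intro r2.U_hconv) blast+
  moreover have "R (U (xs i)) (W (ys i))" for i
    using R_isometry s(1) by blast
  ultimately show ?thesis
    unfolding rel_def using rel_mem xy by (auto intro!: exI)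
qed

lemma rel_R: "R x y \<Longrightarrow> rel x y"
  unfolding rel_def using R_mem [of x y] r1.hconv_const r2.hconv_const
  by (intro conjI exI [of _ "\<lambda>_. x"] exI [of _ "\<lambda>_. y"]) auto

text \<open>Approximants of \<open>x\<close> from the dense span have partners,
  \<open>R_bounded\<close> makes the partners a Cauchy sequence, and completeness supplies the
  limit. The assumption \<open>onto\<close> is what \<open>R_bounded\<close> asks for.\<close>

lemma rel_total:
  assumes onto: "\<And>y. y \<in> qspan Q (\<Union>n. range (\<lambda>c. r2.pw n (D c))) \<Longrightarrow> \<exists>x. R x y"
    and x: "x \<in> r1.V"
  shows "\<exists>y. rel x y"
proof -
  have "\<exists>x' y'. R x' y' \<and> r1.hn (x - x') < inverse (real (Suc i))" for i
  proof -
    have "inverse (real (Suc i)) > 0"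
      by simp
    from r1.dense [OF x this] show ?thesis
      using span_R by blast
  qed
  then obtain xs ys where s: "\<And>i. R (xs i) (ys i)"
    "\<And>i. r1.hn (x - xs i) < inverse (real (Suc i))"
    by metis
  have mem: "\<And>i. xs i \<in> r1.V" "\<And>i. ys i \<in> r2.V"
    using R_mem s(1) by blast+
  have conv: "r1.hconv xs x"
  proof (rule r1.hconv_dominated)
    show "r1.hn (xs i - x) \<le> inverse (real (Suc i))" for i
      using s(2) [of i] mem x by (simp add: r1.hn_diff_commute)
  qed (use mem x LIMSEQ_inverse_real_of_nat in auto)
  then have "r1.hCauchy xs"
    using mem x r1.hconv_hCauchy by blast
  obtain M where M: "M \<ge> 0" "\<And>x y. R x y \<Longrightarrow> r2.hn y \<le> M * r1.hn x"
    using R_bounded [OF onto] by blast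
  have "r2.hCauchy ys"
    unfolding r2.hCauchy_def
  proof (intro allI impI)
    fix \<epsilon> :: real assume "\<epsilon> > 0"
    then have "\<epsilon> / (M + 1) > 0"
      using M by simp
    then obtain N where N: "\<And>i j. i \<ge> N \<Longrightarrow> j \<ge> N \<Longrightarrow> r1.hn (xs i - xs j) < \<epsilon> / (M + 1)"
      using \<open>r1.hCauchy xs\<close> unfolding r1.hCauchy_def by blast
    have "r2.hn (ys i - ys j) < \<epsilon>" if "i \<ge> N" "j \<ge> N" for i j
    proof -
      have "r2.hn (ys i - ys j) \<le> M * r1.hn (xs i - xs j)"
        using M R_diff s(1) by blast
      also have "\<dots> \<le> (M + 1) * r1.hn (xs i - xs j)"
        using mem by (intro mult_right_mono) (auto simp: r1.hn_nonneg)
      also have "\<dots> < (M + 1) * (\<epsilon> / (M + 1))"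
        using N [OF that] M by (intro mult_strict_left_mono) auto
      finally show ?thesis
        using M by simp
    qed
    then show "\<exists>N. \<forall>i\<ge>N. \<forall>j\<ge>N. r2.hn (ys i - ys j) < \<epsilon>"
      by blast
  qed
  then obtain y where "y \<in> r2.V" "r2.hconv ys y"
    using r2.complete mem by blast
  then show ?thesis
    unfolding rel_def using s(1) conv x by blast
qed

end

lemma minimal_realization_min_real:
  fixes r :: "int \<Rightarrow> quat ^ 's ^ 's"
  assumes "minimal_realization P U C r"
  obtains n :: nat and e where "min_real P {..<n} e U C"
proof -
  have real: "realization P U C r" and P: "pontryagin_space P"
    and dense: "pontryagin_topology P closure_of
      (qspan P (\<Union>n. range (\<lambda>c. int_power P U n (C c)))) = qcarrier P"
    using assms unfolding minimal_realization_def realization_def by auto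
  obtain n :: nat and e where p: "pontryagin_basis P {..<n} e"
    "\<And>x. x \<in> qcarrier P \<Longrightarrow> pontryagin_norm P x = pre_pontryagin.hn P {..<n} e x"
    using pontryagin_basis_exists [OF P] by blast
  interpret pontryagin_basis P "{..<n}" e by fact
  interpret qisometry P U
    using realizationD(1) [OF real] .
  have "min_real P {..<n} e U C"
  proof
    show "right_linear Hspace P C"
      using realizationD(2) [OF real] .
    show "\<exists>y\<in>qspan P (\<Union>n. range (\<lambda>c. pw n (C c))). hn (x - y) < \<epsilon>"
      if "x \<in> V" "\<epsilon> > 0" for x \<epsilon>
      using pontryagin_dense [OF p dense that] by blast
  qed
  then show ?thesis
    using that by blast
qed

text \<open>The right-hand side involves \<open>r\<close>, \<open>c\<close> and \<open>d\<close>
  only, so any two realizations of \<open>r\<close> have the same form values on their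
  generators.\<close>

lemma qform_generators:
  fixes r :: "int \<Rightarrow> quat ^ 's ^ 's"
  assumes "realization P U C r"
  shows "qform P (int_power P U n (C c)) (C d) = (\<Sum>i\<in>UNIV. qcnj (d $ i) * (r n *v c) $ i)"
proof -
  interpret qisometry P U
    using realizationD(1) [OF assms] .
  note C = realizationD(2) [OF assms]
  have CV: "C c \<in> V" for c
    using C by (rule right_linear_mem)
  have "(r n *v c) $ i = B (pw n (C c)) (C (axis i 1))" for i
    using assms CV unfolding realization_def by (simp add: qadjoint_component [OF C])
  then show ?thesis
    by (subst right_linear_Hspace_expand [OF C, of d]) (use CV in \<open>simp add: B_sum_right B_sm_right\<close>)
qed

theorem minimal_realization_unique:
  fixes r :: "int \<Rightarrow> quat ^ 's ^ 's"
  assumes m1: "minimal_realization P U C r" and m2: "minimal_realization Q W D r"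
  shows "\<exists>S. unitary_operator P Q S \<and> (\<forall>c. S (C c) = D c) \<and> (\<forall>a\<in>qcarrier P. S (U a) = W (S a))"
proof -
  obtain n :: nat and e where "min_real P {..<n} e U C"
    using minimal_realization_min_real [OF m1] .
  then interpret r1: min_real P "{..<n}" e U C .
  obtain m :: nat and f where "min_real Q {..<m} f W D"
    using minimal_realization_min_real [OF m2] .
  then interpret r2: min_real Q "{..<m}" f W D .
  have real: "realization P U C r" "realization Q W D r"
    using m1 m2 unfolding minimal_realization_def by auto
  \<comment> \<open>The pair is instantiated in both orders, so each lemma yields its mirror image;
    in particular \<open>span_R\<close> of one order is the assumption \<open>onto\<close> of the
    other.\<close>
  interpret pq: real_pair P "{..<n}" e U C Q "{..<m}" f W D
    by unfold_locales (simp add: qform_generators [OF real(1)] qform_generators [OF real(2)])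
  interpret qp: real_pair Q "{..<m}" f W D P "{..<n}" e U C
    by unfold_locales (simp add: pq.same)
  have R: "qp.R y x \<longleftrightarrow> pq.R x y" for x y
    using lincomb_swap [of r2.gen r1.gen y x] lincomb_swap [of r1.gen r2.gen x y] by argo
  have total: "\<exists>y. pq.rel x y" if "x \<in> r1.V" for x
    using pq.rel_total [OF _ that] qp.span_R R by blast
  have rel: "qp.rel y x \<longleftrightarrow> pq.rel x y" for x y
    unfolding pq.rel_def qp.rel_def R by blast
  have onto: "\<exists>x. pq.rel x y" if "y \<in> r2.V" for y
    using qp.rel_total [OF _ that] pq.span_R R rel by blast
  have diff: "pq.rel (x - x') (y - y')" if "pq.rel x y" "pq.rel x' y'" for x x' y y'
    using pq.rel_add [OF that(1) pq.rel_sm [OF that(2), of "- 1"]] pq.rel_mem [OF that(2)]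
    by (simp add: r1.sm_uminus_right r2.sm_uminus_right)
  \<comment> \<open>The difference of two partners of \<open>x\<close> is related to 0, hence
    orthogonal to every vector of the target, since each occurs in the relation. Nondegeneracy makes
    it 0.\<close>
  have functional: "y = y'" if "pq.rel x y" "pq.rel x y'" for x y y'
  proof -
    have "r2.B (y - y') z = 0" if z: "z \<in> r2.V" for z
    proof -
      obtain w where w: "pq.rel w z"
        using onto z by blast
      then show ?thesis
        using pq.rel_form [OF diff [OF \<open>pq.rel x y\<close> \<open>pq.rel x y'\<close>] w] pq.rel_mem [OF w] by simp
    qed
    then show ?thesis
      using r2.nondegenerate [of "y - y'"] pq.rel_mem that by simp
  qed
  have inj: "x = x'" if "pq.rel x y" "pq.rel x' y" for x x' y
  proof -
    have "r1.B (x - x') z = 0" if z: "z \<in> r1.V" for z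
    proof -
      obtain w where w: "pq.rel z w"
        using total z by blast
      then show ?thesis
        using pq.rel_form [OF diff [OF \<open>pq.rel x y\<close> \<open>pq.rel x' y\<close>] w] pq.rel_mem [OF w] by simp
    qed
    then show ?thesis
      using r1.nondegenerate [of "x - x'"] pq.rel_mem that by simp
  qed
  define S where "S x = (THE y. pq.rel x y)" for x
  have S: "pq.rel x (S x)" if "x \<in> r1.V" for x
    unfolding S_def using total [OF that] functional by (metis theI)
  have S_eq: "S x = y" if "pq.rel x y" for x y
    using functional S that pq.rel_mem by blast
  have "right_linear P Q S"
    unfolding right_linear_def
  proof (intro conjI ballI allI funcsetI)
    show "S a \<in> r2.V" if "a \<in> r1.V" for a
      using pq.rel_mem(2) [OF S [OF that]] .
    show "S (a + b) = S a + S b" if "a \<in> r1.V" "b \<in> r1.V" for a b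
      using S_eq [OF pq.rel_add [OF S [OF that(1)] S [OF that(2)]]] .
    show "S (r1.sm a p) = r2.sm (S a) p" if "a \<in> r1.V" for a p
      using S_eq [OF pq.rel_sm [OF S [OF that]]] .
  qed
  moreover have "bij_betw S r1.V r2.V"
  proof (rule bij_betw_imageI)
    show "inj_on S r1.V"
      using S inj by (metis inj_onI)
    show "S ` r1.V = r2.V"
      using S onto S_eq pq.rel_mem by (metis (no_types, lifting) equalityI image_subset_iff imageI subsetI)
  qed
  ultimately have "unitary_operator P Q S"
    using pq.rel_form [OF S S, symmetric]
    by (intro unitary_operatorI r1.pontryagin r2.pontryagin) auto
  moreover have "S (C c) = D c" for c
    using pq.rel_R [OF lincomb_gen, of "(0, c)"] by (simp add: r1.gen_def r2.gen_def S_eq)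
  moreover have "S (U a) = W (S a)" if "a \<in> r1.V" for a
    using S that pq.rel_isometry S_eq by blast
  ultimately show ?thesis
    by blast
qed

section \<open>Functional completion\<close>

text \<open>The completion of a possibly degenerate space \<open>X\<close> spanned by vectors \<open>t n a\<close> is
  realized by functions: a Cauchy sequence \<open>\<phi>\<close> is identified with the pointwise limit of the
  coefficients \<open>[\<phi> i, t n a]\<close>.\<close>

locale fcompletion = pre_pontryagin X I e for X :: "'a::ab_group_add qspace" and I :: "'i set" and e +
  fixes t :: "int \<Rightarrow> 's::finite \<Rightarrow> 'a"
  assumes t_mem [simp]: "t n a \<in> V"
    and t_span: "qsubspace X W \<Longrightarrow> (\<And>n a. t n a \<in> W) \<Longrightarrow> V \<subseteq> W"
begin

text \<open>Coefficients against the generators. Vectors orthogonal to everything are sent to 0,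
  which divides out the degeneracy.\<close>

definition ev :: "'a \<Rightarrow> int \<Rightarrow> quat ^ 's" where
  "ev x = (\<lambda>n. \<chi> a. B x (t n a))"

definition approx :: "(nat \<Rightarrow> 'a) \<Rightarrow> (int \<Rightarrow> quat ^ 's) \<Rightarrow> bool" where
  "approx \<phi> f \<longleftrightarrow> (\<forall>i. \<phi> i \<in> V) \<and> hCauchy \<phi> \<and> (\<forall>n a. (\<lambda>i. B (\<phi> i) (t n a)) \<longlonglongrightarrow> f n $ a)"

definition rep :: "(int \<Rightarrow> quat ^ 's) \<Rightarrow> nat \<Rightarrow> 'a" where
  "rep f = (SOME \<phi>. approx \<phi> f)"

text \<open>Uses representatives picked by choice; \<open>approx_form\<close> shows that any other
  Cauchy sequences with the same functions give the same limit.\<close>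

definition form :: "(int \<Rightarrow> quat ^ 's) \<Rightarrow> (int \<Rightarrow> quat ^ 's) \<Rightarrow> quat" where
  "form f g = lim (\<lambda>i. B (rep f i) (rep g i))"

definition fsm :: "(int \<Rightarrow> quat ^ 's) \<Rightarrow> quat \<Rightarrow> int \<Rightarrow> quat ^ 's" where
  "fsm f p = (\<lambda>n. \<chi> a. f n $ a * p)"

definition Comp :: "(int \<Rightarrow> quat ^ 's) set" where
  "Comp = {f. \<exists>\<phi>. approx \<phi> f}"

definition cspace :: "(int \<Rightarrow> quat ^ 's) qspace" where
  "cspace = \<lparr>qcarrier = Comp, qsmult = fsm, qform = form\<rparr>"

lemma approxD:
  assumes "approx \<phi> f"
  shows "\<phi> i \<in> V" "hCauchy \<phi>" "(\<lambda>i. B (\<phi> i) (t n a)) \<longlonglongrightarrow> f n $ a"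
  using assms unfolding approx_def by auto

lemma approx_add: "approx \<phi> f \<Longrightarrow> approx \<psi> g \<Longrightarrow> approx (\<lambda>i. \<phi> i + \<psi> i) (f + g)"
  unfolding approx_def by (auto simp: B_add_left intro: hCauchy_add tendsto_add)

lemma approx_sm: "approx \<phi> f \<Longrightarrow> approx (\<lambda>i. sm (\<phi> i) p) (fsm f p)"
proof -
  assume f: "approx \<phi> f"
  note D = approxD [OF f]
  have "hCauchy (\<lambda>i. sm (\<phi> i) p)"
  proof (rule hCauchy_bounded_map [OF D(1,2)])
    show "hn (sm (\<phi> i) p - sm (\<phi> j) p) \<le> norm p * hn (\<phi> i - \<phi> j)" for i j
      using D(1) by (simp add: sm_diff_left [symmetric] hn_sm)
  qed
  then show ?thesis
    unfolding approx_def fsm_def using D by (auto simp: B_sm_left intro: tendsto_mult_right)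
qed

lemma fsm_minus_one: "fsm f (- 1) = - f"
  unfolding fsm_def by (simp add: fun_eq_iff vec_eq_iff)

lemma approx_uminus: "approx \<phi> f \<Longrightarrow> approx (\<lambda>i. - \<phi> i) (- f)"
  using approx_sm [of \<phi> f "- 1"] approxD(1) [of \<phi> f]
  by (simp add: fsm_minus_one sm_uminus_right)

lemma approx_diff: "approx \<phi> f \<Longrightarrow> approx \<psi> g \<Longrightarrow> approx (\<lambda>i. \<phi> i - \<psi> i) (f - g)"
  using approx_add [OF _ approx_uminus, of \<phi> f \<psi> g] by simp

lemma approx_ev: "x \<in> V \<Longrightarrow> approx (\<lambda>_. x) (ev x)"
  unfolding approx_def ev_def hCauchy_def by simp

text \<open>The vectors \<open>y\<close> with this property form a subspace, so the generators
  decide.\<close>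

lemma weak_null:
  assumes "\<And>i. \<phi> i \<in> V" "\<And>n a. (\<lambda>i. B (\<phi> i) (t n a)) \<longlonglongrightarrow> 0" "y \<in> V"
  shows "(\<lambda>i. B (\<phi> i) y) \<longlonglongrightarrow> 0"
proof -
  have "V \<subseteq> {y \<in> V. (\<lambda>i. B (\<phi> i) y) \<longlonglongrightarrow> 0}"
  proof (rule t_span)
    show "qsubspace X {y \<in> V. (\<lambda>i. B (\<phi> i) y) \<longlonglongrightarrow> 0}"
      unfolding qsubspace_def using assms(1)
      by (auto simp: B_add_right B_sm_right intro: tendsto_add_zero tendsto_mult_right_zero)
  qed (use assms in auto)
  then show ?thesis
    using assms(3) by blast
qed

text \<open>This is what makes the identification with functions injective.\<close>

lemma approx_null:
  assumes "approx \<phi> 0"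
  shows "(\<lambda>i. hn (\<phi> i)) \<longlonglongrightarrow> 0"
proof -
  note D = approxD [OF assms]
  have weak: "(\<lambda>i. B (\<phi> i) y) \<longlonglongrightarrow> 0" if "y \<in> V" for y
    using D(3) by (intro weak_null [OF D(1) _ that]) simp
  \<comment> \<open>\<open>rip\<close> is built from finitely many form values, so weak convergence
    carries over to it.\<close>
  have rip_null: "(\<lambda>i. rip (\<phi> i) y) \<longlonglongrightarrow> 0" if "y \<in> V" for y
  proof -
    have "(\<lambda>i. rip (\<phi> i) y) \<longlonglongrightarrow> qRe 0 + 2 * (\<Sum>k\<in>I. inner 0 (B y (e k)))"
      unfolding rip_def
      using weak that by (intro tendsto_add tendsto_mult tendsto_const tendsto_sum tendsto_inner tendsto_qRe) auto
    then show ?thesis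
      by simp
  qed
  obtain M where M: "\<And>i. hn (\<phi> i) \<le> M"
    using hCauchy_bounded D by blast
  have "M \<ge> 0"
    using M [of 0] hn_nonneg [OF D(1), of 0] by simp
  show ?thesis
    unfolding LIMSEQ_iff
  proof (intro allI impI)
    fix \<epsilon> :: real assume "\<epsilon> > 0"
    \<comment> \<open>Chosen to give \<open>M * \<delta> \<le> \<epsilon>\<^sup>2 / 2\<close>;
      \<open>M + 1\<close> allows for \<open>M = 0\<close>.\<close>
    define \<delta> where "\<delta> = \<epsilon>\<^sup>2 / (2 * (M + 1))"
    have "\<delta> > 0"
      using \<open>\<epsilon> > 0\<close> \<open>M \<ge> 0\<close> by (simp add: \<delta>_def)
    then obtain N where N: "\<And>i. i \<ge> N \<Longrightarrow> hn (\<phi> i - \<phi> N) < \<delta>"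
      using D(2) unfolding hCauchy_def by blast
    have "\<epsilon>\<^sup>2 / 2 > 0"
      using \<open>\<epsilon> > 0\<close> by simp
    then obtain N' where N': "\<And>i. i \<ge> N' \<Longrightarrow> \<bar>rip (\<phi> i) (\<phi> N)\<bar> < \<epsilon>\<^sup>2 / 2"
      using rip_null [OF D(1), of N] unfolding LIMSEQ_iff real_norm_def diff_zero by blast
    have "hn (\<phi> i) < \<epsilon>" if "i \<ge> max N N'" for i
    proof -
      \<comment> \<open>With \<open>N\<close> fixed, the first summand is small by weak convergence,
        the second by the Cauchy property and boundedness.\<close>
      have "(hn (\<phi> i))\<^sup>2 = rip (\<phi> i) (\<phi> N) + rip (\<phi> i) (\<phi> i - \<phi> N)"
        using D(1) rip_add_right [of "\<phi> N" "\<phi> i - \<phi> N" "\<phi> i"]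
          rip_nonneg [of "\<phi> i"]
        by (simp add: hn_def)
      also have "rip (\<phi> i) (\<phi> i - \<phi> N) \<le> hn (\<phi> i) * hn (\<phi> i - \<phi> N)"
        using rip_le_hn [of "\<phi> i" "\<phi> i - \<phi> N"] D(1) by simp
      also have "\<dots> \<le> M * \<delta>"
        using M [of i] N [of i] that D(1) \<open>M \<ge> 0\<close> by (intro mult_mono) (auto simp: hn_nonneg)
      also have "M * \<delta> \<le> \<epsilon>\<^sup>2 / 2"
        using \<open>M \<ge> 0\<close> unfolding \<delta>_def by (simp add: field_simps)
      also have "rip (\<phi> i) (\<phi> N) < \<epsilon>\<^sup>2 / 2"
        using N' [of i] that by simp
      finally have "(hn (\<phi> i))\<^sup>2 < \<epsilon>\<^sup>2"
        by simp
      then show ?thesis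
        using \<open>\<epsilon> > 0\<close> by (simp add: power_less_imp_less_base)
    qed
    then show "\<exists>N. \<forall>i\<ge>N. norm (hn (\<phi> i) - 0) < \<epsilon>"
      using D(1) by (intro exI [of _ "max N N'"]) (simp add: hn_nonneg)
  qed
qed

lemma approx_rep: "f \<in> Comp \<Longrightarrow> approx (rep f) f"
  unfolding Comp_def rep_def mem_Collect_eq by (erule someI_ex)

lemma CompI: "approx \<phi> f \<Longrightarrow> f \<in> Comp"
  unfolding Comp_def by blast

text \<open>Two sequences with the same function differ by a sequence tending to 0 in
  \<open>hn\<close>, by \<open>approx_null\<close>; continuity of the form on bounded sequences then
  equates the limits.\<close>

lemma approx_form:
  assumes f: "approx \<phi> f" and g: "approx \<psi> g"
  shows "(\<lambda>i. B (\<phi> i) (\<psi> i)) \<longlonglongrightarrow> form f g"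
proof -
  have f': "approx (rep f) f" and g': "approx (rep g) g"
    using approx_rep CompI f g by blast+
  note mem = approxD(1) [OF f] approxD(1) [OF g] approxD(1) [OF f'] approxD(1) [OF g']
  have lim: "(\<lambda>i. B (rep f i) (rep g i)) \<longlonglongrightarrow> form f g"
    unfolding form_def
    using hCauchy_B [OF mem(3,4) approxD(2) [OF f'] approxD(2) [OF g']]
    by (simp add: convergent_LIMSEQ_iff)
  have null: "(\<lambda>i. hn (\<phi> i - rep f i)) \<longlonglongrightarrow> 0" "(\<lambda>i. hn (\<psi> i - rep g i)) \<longlonglongrightarrow> 0"
    using approx_null approx_diff [OF f f'] approx_diff [OF g g'] by simp_all
  obtain M where M: "\<And>i. hn (\<psi> i) \<le> M"
    using hCauchy_bounded [of \<psi>] mem(2) approxD(2) [OF g] by blast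
  obtain M' where M': "\<And>i. hn (rep f i) \<le> M'"
    using hCauchy_bounded [of "rep f"] mem(3) approxD(2) [OF f'] by blast
  have "(\<lambda>i. B (\<phi> i) (\<psi> i) - B (rep f i) (rep g i)) \<longlonglongrightarrow> 0"
  proof (rule Lim_null_comparison [OF always_eventually [OF allI]])
    fix i
    have "B (\<phi> i) (\<psi> i) - B (rep f i) (rep g i)
        = B (\<phi> i - rep f i) (\<psi> i) + B (rep f i) (\<psi> i - rep g i)"
      using mem by (simp add: B_diff_left B_diff_right)
    also have "norm \<dots> \<le> cB * hn (\<phi> i - rep f i) * hn (\<psi> i) + cB * hn (rep f i) * hn (\<psi> i - rep g i)"
      using mem by (intro order_trans [OF norm_triangle_ineq] add_mono norm_B_le) auto
    also have "\<dots> \<le> cB * hn (\<phi> i - rep f i) * M + cB * M' * hn (\<psi> i - rep g i)"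
      using mem M M' cB_pos
      by (intro add_mono mult_left_mono mult_right_mono) (auto simp: hn_nonneg)
    finally show "norm (B (\<phi> i) (\<psi> i) - B (rep f i) (rep g i))
        \<le> cB * hn (\<phi> i - rep f i) * M + cB * M' * hn (\<psi> i - rep g i)" .
  next
    have "(\<lambda>i. cB * hn (\<phi> i - rep f i) * M + cB * M' * hn (\<psi> i - rep g i))
        \<longlonglongrightarrow> cB * 0 * M + cB * M' * 0"
      using null by (intro tendsto_intros)
    then show "(\<lambda>i. cB * hn (\<phi> i - rep f i) * M + cB * M' * hn (\<psi> i - rep g i)) \<longlonglongrightarrow> 0"
      by (simp only: mult_zero_left mult_zero_right add_0)
  qed
  from tendsto_add [OF this lim] show ?thesis
    unfolding diff_add_cancel add_0 .
qed

lemma form_eq: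
  assumes "approx \<phi> f" "approx \<psi> g" "(\<lambda>i. B (\<phi> i) (\<psi> i)) \<longlonglongrightarrow> l"
  shows "form f g = l"
  by (rule LIMSEQ_unique [OF approx_form [OF assms(1,2)] assms(3)])

lemma form_ev: "approx \<phi> f \<Longrightarrow> y \<in> V \<Longrightarrow> (\<lambda>i. B (\<phi> i) y) \<longlonglongrightarrow> form f (ev y)"
  by (rule approx_form [OF _ approx_ev])

lemma form_ev_ev: "x \<in> V \<Longrightarrow> y \<in> V \<Longrightarrow> form (ev x) (ev y) = B x y"
  using form_ev [OF approx_ev, of x y] by (simp add: LIMSEQ_const_iff)

lemma ev_mem: "x \<in> V \<Longrightarrow> ev x \<in> Comp"
  using approx_ev CompI by blast

lemma qhermitian_cspace: "qhermitian cspace"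
proof
  have mem: "f + g \<in> Comp" "fsm f p \<in> Comp" "- f \<in> Comp" if "f \<in> Comp" "g \<in> Comp" for f g p
    using that approx_add approx_sm approx_uminus CompI unfolding Comp_def by blast+
  have "0 \<in> Comp"
  proof -
    have "ev 0 = 0"
      by (simp add: ev_def fun_eq_iff vec_eq_iff)
    then show ?thesis
      using ev_mem [OF zero_mem] by simp
  qed
  then show "right_qvector_space cspace"
    unfolding right_qvector_space_def cspace_def using mem
    by (auto simp: fsm_def fun_eq_iff vec_eq_iff algebra_simps)
  show "hermitian_form cspace"
    unfolding hermitian_form_def cspace_def qspace.simps
  proof (intro conjI ballI allI)
    fix f g h assume "f \<in> Comp" "g \<in> Comp" "h \<in> Comp"
    note r = this [THEN approx_rep]
    note m = r [THEN approxD(1)]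
    show "form (f + g) h = form f h + form g h"
      using approx_form [OF r(1,3)] approx_form [OF r(2,3)] m
      by (intro form_eq [OF approx_add [OF r(1,2)] r(3)]) (simp add: B_add_left tendsto_add)
    show "form f (g + h) = form f g + form f h"
      using approx_form [OF r(1,2)] approx_form [OF r(1,3)] m
      by (intro form_eq [OF r(1) approx_add [OF r(2,3)]]) (simp add: B_add_right tendsto_add)
  next
    fix f g assume "f \<in> Comp" "g \<in> Comp"
    note r = this [THEN approx_rep]
    note m = r [THEN approxD(1)]
    have "(\<lambda>i. qcnj (B (rep g i) (rep f i))) \<longlonglongrightarrow> qcnj (form g f)"
      by (intro tendsto_qcnj approx_form r)
    then show "form f g = qcnj (form g f)"
      using m by (intro form_eq [OF r]) (simp add: B_cnj)
  next
    fix f g p q assume "f \<in> Comp" "g \<in> Comp"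
    note r = this [THEN approx_rep]
    note m = r [THEN approxD(1)]
    have "(\<lambda>i. qcnj q * B (rep f i) (rep g i) * p) \<longlonglongrightarrow> qcnj q * form f g * p"
      by (intro tendsto_intros approx_form r)
    then show "form (fsm f p) (fsm g q) = qcnj q * form f g * p"
      using m by (intro form_eq [OF approx_sm [OF r(1)] approx_sm [OF r(2)]]) (simp add: B_sm)
  qed
qed

lemma approx_hn_square:
  assumes "approx \<phi> f"
  shows "(\<lambda>i. (hn (\<phi> i))\<^sup>2) \<longlonglongrightarrow> qRe (form f f) + 2 * (\<Sum>k\<in>I. (norm (form f (ev (e k))))\<^sup>2)"
  unfolding hn_power2 [OF approxD(1) [OF assms]]
  by (intro tendsto_intros tendsto_qRe approx_form form_ev assms) simp

text \<open>Along a representative, the squares of \<open>hn\<close> tend to \<open>form f f\<close>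
  plus twice the squared coefficients against the \<open>ev (e k)\<close>. When these coefficients
  vanish, \<open>form f f\<close> has a real part that is a limit of nonnegative numbers.\<close>

sublocale c: pre_pontryagin cspace I "\<lambda>k. ev (e k)"
  rewrites "qcarrier cspace = Comp" and "qform cspace = form" and "qsmult cspace = fsm"
proof -
  interpret h: qhermitian cspace
    by (rule qhermitian_cspace)
  show "pre_pontryagin cspace I (\<lambda>k. ev (e k))"
  proof
    show "ev (e k) \<in> qcarrier cspace" if "k \<in> I" for k
      using that by (simp add: cspace_def ev_mem)
    show "qform cspace (ev (e k)) (ev (e l)) = (if k = l then - 1 else 0)" if "k \<in> I" "l \<in> I" for k l
      using that by (simp add: cspace_def form_ev_ev e_orth)
    show "0 \<le> qRe (qform cspace f f)"
      if f: "f \<in> qcarrier cspace" "\<And>k. k \<in> I \<Longrightarrow> qform cspace f (ev (e k)) = 0" for f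
    proof -
      have "approx (rep f) f"
        using f(1) approx_rep by (simp add: cspace_def)
      then have "(\<lambda>i. (hn (rep f i))\<^sup>2) \<longlonglongrightarrow> qRe (form f f)"
        using approx_hn_square f(2) by (fastforce simp: cspace_def)
      then show ?thesis
        by (simp add: cspace_def) (rule LIMSEQ_le_const, auto)
    qed
  qed simp
qed (simp_all add: cspace_def)

lemma approx_hn: "approx \<phi> f \<Longrightarrow> (\<lambda>i. hn (\<phi> i)) \<longlonglongrightarrow> c.hn f"
proof -
  assume f: "approx \<phi> f"
  then have fC: "f \<in> Comp"
    by (rule CompI)
  have "(\<lambda>i. sqrt ((hn (\<phi> i))\<^sup>2)) \<longlonglongrightarrow> sqrt ((c.hn f)\<^sup>2)"
    using approx_hn_square [OF f] c.hn_power2 [OF fC] by (intro tendsto_real_sqrt) simp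
  then show ?thesis
    using hn_nonneg approxD(1) [OF f] c.hn_nonneg [OF fC] by simp
qed

lemma ev_diff: "x \<in> V \<Longrightarrow> y \<in> V \<Longrightarrow> ev (x - y) = ev x - ev y"
  unfolding ev_def by (simp add: B_diff_left fun_eq_iff vec_eq_iff)

lemma ev_add: "x \<in> V \<Longrightarrow> y \<in> V \<Longrightarrow> ev (x + y) = ev x + ev y"
  unfolding ev_def by (simp add: B_add_left fun_eq_iff vec_eq_iff)

lemma ev_sm: "x \<in> V \<Longrightarrow> ev (sm x p) = fsm (ev x) p"
  unfolding ev_def fsm_def by (simp add: B_sm_left fun_eq_iff vec_eq_iff)

lemma hn_ev: "x \<in> V \<Longrightarrow> c.hn (ev x) = hn x"
  using approx_hn [OF approx_ev, of x] by (simp add: LIMSEQ_const_iff)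

text \<open>The norm of \<open>ev (\<phi> i) - f\<close> is the limit in \<open>j\<close> of
  \<open>hn (\<phi> i - \<phi> j)\<close>. Consequently the image of \<open>ev\<close> is
  dense.\<close>

lemma approx_hconv:
  assumes f: "approx \<phi> f"
  shows "c.hconv (\<lambda>i. ev (\<phi> i)) f"
proof -
  note D = approxD [OF f]
  have fC: "f \<in> Comp" and eC: "\<And>i. ev (\<phi> i) \<in> Comp"
    using CompI f D ev_mem by blast+
  show ?thesis
    unfolding c.hconv_iff [OF eC fC]
  proof (intro allI impI)
    fix \<epsilon> :: real assume "\<epsilon> > 0"
    then obtain N where N: "\<And>i j. i \<ge> N \<Longrightarrow> j \<ge> N \<Longrightarrow> hn (\<phi> i - \<phi> j) < \<epsilon> / 2"
      using D(2) unfolding hCauchy_def by (meson half_gt_zero)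
    have "c.hn (ev (\<phi> i) - f) < \<epsilon>" if "i \<ge> N" for i
    proof -
      have "(\<lambda>j. hn (\<phi> i - \<phi> j)) \<longlonglongrightarrow> c.hn (ev (\<phi> i) - f)"
        using D(1) f by (intro approx_hn approx_diff approx_ev)
      moreover have "\<forall>j\<ge>N. hn (\<phi> i - \<phi> j) \<le> \<epsilon> / 2"
        using N [OF that] less_imp_le by blast
      ultimately have "c.hn (ev (\<phi> i) - f) \<le> \<epsilon> / 2"
        using LIMSEQ_le_const2 by blast
      then show ?thesis
        using \<open>\<epsilon> > 0\<close> by simp
    qed
    then show "\<exists>N. \<forall>i\<ge>N. c.hn (ev (\<phi> i) - f) < \<epsilon>"
      by blast
  qed
qed

text \<open>Definiteness: if \<open>c.hn f\<close> is 0, the coefficients along a representative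
  tend to 0, and they also tend to the values of \<open>f\<close>. Completeness: a Cauchy sequence
  is followed by vectors from the original space.\<close>

sublocale c: pontryagin_basis cspace I "\<lambda>k. ev (e k)"
  rewrites "qcarrier cspace = Comp" and "qform cspace = form" and "qsmult cspace = fsm"
proof -
  show "pontryagin_basis cspace I (\<lambda>k. ev (e k))"
  proof (intro pontryagin_basis.intro pontryagin_basis_axioms.intro, unfold cspace_def qspace.simps, fold cspace_def)
    show "pre_pontryagin cspace I (\<lambda>k. ev (e k))"
      by (rule c.pre_pontryagin_axioms)
    show "0 < qRe (form f f)"
      if f: "f \<in> Comp" "\<And>k. k \<in> I \<Longrightarrow> form f (ev (e k)) = 0" "f \<noteq> 0" for f
    proof (rule ccontr)
      assume "\<not> 0 < qRe (form f f)"
      moreover have "0 \<le> qRe (form f f)"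
        using c.orth_nonneg f by blast
      ultimately have "c.hn f = 0"
        using f c.hn_power2 [OF f(1)] by simp
      note r = approx_rep [OF f(1)]
      have "f n $ a = 0" for n a
      proof -
        have "(\<lambda>i. B (rep f i) (t n a)) \<longlonglongrightarrow> 0"
        proof (rule Lim_null_comparison [OF always_eventually [OF allI]])
          show "norm (B (rep f i) (t n a)) \<le> cB * hn (rep f i) * hn (t n a)" for i
            using approxD(1) [OF r] by (intro norm_B_le) auto
          have "(\<lambda>i. cB * hn (rep f i) * hn (t n a)) \<longlonglongrightarrow> cB * 0 * hn (t n a)"
            using approx_hn [OF r] \<open>c.hn f = 0\<close> by (intro tendsto_intros) simp
          then show "(\<lambda>i. cB * hn (rep f i) * hn (t n a)) \<longlonglongrightarrow> 0"
            by simp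
        qed
        then show ?thesis
          using approxD(3) [OF r, of n a] LIMSEQ_unique by blast
      qed
      then show False
        using f(3) by (simp add: fun_eq_iff vec_eq_iff)
    qed
    show "\<exists>f\<in>Comp. c.hconv s f" if s: "\<And>i. s i \<in> Comp" "c.hCauchy s" for s
    proof -
      \<comment> \<open>A diagonal choice: the errors tend to 0, so the chosen \<open>x i\<close>
        again form a Cauchy sequence, and the function it represents is the limit of
        \<open>s\<close>.\<close>
      have "\<exists>x. x \<in> V \<and> c.hn (s i - ev x) < inverse (real (Suc i))" for i
      proof -
        note r = approx_rep [OF s(1) [of i]]
        have "inverse (real (Suc i)) > 0"
          by simp
        then obtain j where "c.hn (ev (rep (s i) j) - s i) < inverse (real (Suc i))"
          using approx_hconv [OF r] ev_mem [OF approxD(1) [OF r]] s(1)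
            c.hconv_iff [of "\<lambda>j. ev (rep (s i) j)" "s i"] by (metis order_refl)
        then show ?thesis
          using approxD(1) [OF r] ev_mem s(1) c.hn_diff_commute by metis
      qed
      then obtain x where x: "\<And>i. x i \<in> V" "\<And>i. c.hn (s i - ev (x i)) < inverse (real (Suc i))"
        by metis
      have eC: "ev (x i) \<in> Comp" for i
        using x(1) by (rule ev_mem)
      have null: "c.hconv (\<lambda>i. s i - ev (x i)) 0"
        using x s(1) eC LIMSEQ_inverse_real_of_nat
        by (intro c.hconv_dominated [where f = "\<lambda>i. inverse (real (Suc i))"])
           (auto simp: less_imp_le)
      have "c.hCauchy (\<lambda>i. - (s i - ev (x i)))"
      proof (rule c.hconv_hCauchy)
        show "c.hconv (\<lambda>i. - (s i - ev (x i))) 0"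
          using null s(1) eC c.hn_diff_commute unfolding c.hconv_def by simp
      qed (use s(1) eC in auto)
      then have "c.hCauchy (\<lambda>i. s i + - (s i - ev (x i)))"
        using s eC by (intro c.hCauchy_add) auto
      then have "hCauchy x"
        unfolding c.hCauchy_def hCauchy_def using x(1)
        by (simp add: ev_diff [symmetric] hn_ev)
      define f where "f = (\<lambda>n. \<chi> a. lim (\<lambda>i. B (x i) (t n a)))"
      have "convergent (\<lambda>i. B (x i) (t n a))" for n a
        using hCauchy_B [OF x(1) _ \<open>hCauchy x\<close>, of "\<lambda>_. t n a"] hconv_hCauchy [OF _ _ hconv_const]
        by simp
      then have f: "approx x f"
        unfolding approx_def f_def using x(1) \<open>hCauchy x\<close> by (simp add: convergent_LIMSEQ_iff)
      then have fC: "f \<in> Comp"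
        by (rule CompI)
      have "c.hconv (\<lambda>i. (s i - ev (x i)) + ev (x i)) (0 + f)"
        using null approx_hconv [OF f] s(1) eC fC by (intro c.hconv_add) auto
      then show ?thesis
        using fC by auto
    qed
  qed
qed (simp_all add: cspace_def)

end

section \<open>The shift on the completion\<close>

locale fshift = fcompletion X I e t + qisometry X T
  for X :: "'a::ab_group_add qspace" and I :: "'i set" and e
    and t :: "int \<Rightarrow> 's::finite \<Rightarrow> 'a" and T :: "'a \<Rightarrow> 'a" +
  assumes T_t: "T (t n a) = t (n + 1) a"
begin

text \<open>The index drops by one because an isometry satisfies [T x, t n a] =
  [x, t (n-1) a].\<close>

definition forward :: "(int \<Rightarrow> quat ^ 's) \<Rightarrow> int \<Rightarrow> quat ^ 's" where
  "forward f = (\<lambda>n. f (n - 1))"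

definition Cin :: "quat ^ 's \<Rightarrow> int \<Rightarrow> quat ^ 's" where
  "Cin c = ev (\<Sum>b\<in>UNIV. sm (t 0 b) (c $ b))"

lemma B_T_t: "x \<in> V \<Longrightarrow> B (T x) (t n a) = B x (t (n - 1) a)"
  using U_form [of x "t (n - 1) a"] by (simp add: T_t)

lemma approx_forward:
  assumes f: "approx \<phi> f"
  shows "approx (\<lambda>i. T (\<phi> i)) (forward f)"
proof -
  note D = approxD [OF f]
  obtain M where M: "\<And>x. x \<in> V \<Longrightarrow> hn (T x) \<le> M * hn x"
    using qisometry_bounded [OF pre_pontryagin_axioms qisometry_axioms] by blast
  have "hCauchy (\<lambda>i. T (\<phi> i))"
  proof (rule hCauchy_bounded_map [OF D(1,2)])
    fix i j
    have "T (\<phi> i) - T (\<phi> j) = T (\<phi> i - \<phi> j)"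
      using U_add [of "\<phi> i - \<phi> j" "\<phi> j"] D(1) by (simp add: algebra_simps)
    then show "hn (T (\<phi> i) - T (\<phi> j)) \<le> M * hn (\<phi> i - \<phi> j)"
      using M [of "\<phi> i - \<phi> j"] D(1) by simp
  qed
  then show ?thesis
    unfolding approx_def forward_def using D by (simp add: B_T_t)
qed

text \<open>The inverse isometry is bounded by the same argument and so preserves Cauchy sequences;
  this makes \<open>forward\<close> surjective on the completion.\<close>

lemma approx_unshift:
  assumes f: "approx \<phi> f"
  shows "approx (\<lambda>i. inv_into V T (\<phi> i)) (\<lambda>n. f (n + 1))"
proof -
  note D = approxD [OF f]
  let ?S = "inv_into V T"
  have form: "B (?S x) (?S y) = B x y" if "x \<in> V" "y \<in> V" for x y
    using U_form [of "?S x" "?S y"] that by (simp add: U_inv)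
  have inv_T: "?S (T x) = x" if "x \<in> V" for x
    using U_inj [OF _ that, of "?S (T x)"] that by (simp add: U_inv)
  have "\<exists>M\<ge>0. \<forall>x\<in>V. hn (?S x) \<le> M * hn x"
  proof (rule isometry_bound [OF pre_pontryagin_axioms pre_pontryagin_axioms inv_mem form])
    show "\<exists>g\<in>V. ?S g = e k" if "k \<in> I" for k
      using inv_T [OF e_mem [OF that]] U_mem [OF e_mem [OF that]] by blast
  qed
  then obtain M where M: "\<And>x. x \<in> V \<Longrightarrow> hn (?S x) \<le> M * hn x"
    by blast
  have "hCauchy (\<lambda>i. ?S (\<phi> i))"
  proof (rule hCauchy_bounded_map [OF D(1,2)])
    fix i j
    have "T (?S (\<phi> i - \<phi> j) + ?S (\<phi> j)) = T (?S (\<phi> i))"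
      using D(1) by (simp add: U_add U_inv)
    then have "?S (\<phi> i - \<phi> j) + ?S (\<phi> j) = ?S (\<phi> i)"
      using D(1) by - (rule U_inj, auto)
    then have "?S (\<phi> i) - ?S (\<phi> j) = ?S (\<phi> i - \<phi> j)"
      by (metis add_diff_cancel_right')
    then show "hn (?S (\<phi> i) - ?S (\<phi> j)) \<le> M * hn (\<phi> i - \<phi> j)"
      using M [of "\<phi> i - \<phi> j"] D(1) by simp
  qed
  moreover have "B (?S (\<phi> i)) (t n a) = B (\<phi> i) (t (n + 1) a)" for i n a
    using form [of "\<phi> i" "t (n + 1) a"] D(1) inv_T [of "t n a"] by (simp add: T_t)
  ultimately show ?thesis
    unfolding approx_def using D by simp
qed

lemma qisometry_forward: "qisometry cspace forward"
proof -
  interpret h: qhermitian cspace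
    by (rule qhermitian_cspace)
  have mem: "forward f \<in> Comp" if "f \<in> Comp" for f
    using approx_forward [OF approx_rep [OF that]] CompI by blast
  have "bij_betw forward Comp Comp"
  proof (rule bij_betw_byWitness [where f' = "\<lambda>f n. f (n + 1)"])
    show "(\<lambda>f n. f (n + 1)) ` Comp \<subseteq> Comp"
      using approx_unshift [OF approx_rep] CompI by blast
  qed (use mem in \<open>auto simp: forward_def\<close>)
  moreover have "form (forward f) (forward g) = form f g" if f: "f \<in> Comp" "g \<in> Comp" for f g
  proof -
    note r = f [THEN approx_rep]
    show ?thesis
      using approx_form [OF r] approxD(1) [OF r(1)] approxD(1) [OF r(2)]
      by (intro form_eq [OF approx_forward [OF r(1)] approx_forward [OF r(2)]]) (simp add: U_form)
  qed
  moreover have "right_linear cspace cspace forward"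
    unfolding right_linear_def cspace_def using mem by (simp add: forward_def fsm_def fun_eq_iff)
  ultimately show ?thesis
    by unfold_locales (simp_all add: cspace_def)
qed

lemma forward_ev_t: "forward (ev (t n a)) = ev (t (n + 1) a)"
  unfolding forward_def ev_def using B_T_t [of "t n a"] by (simp add: T_t)

lemma int_power_forward: "int_power cspace forward n (ev (t 0 a)) = ev (t n a)"
proof -
  interpret s: qisometry cspace forward
    by (rule qisometry_forward)
  have mem: "ev (t n a) \<in> qcarrier cspace" for n
    by (simp add: cspace_def ev_mem)
  show ?thesis
  proof (induction n rule: int_induct [where k = 0])
    case (step1 n)
    then show ?case
      using s.pw_succ [OF mem, of n] by (simp add: forward_ev_t)
  next
    case (step2 n)
    have "forward (int_power cspace forward (n - 1) (ev (t 0 a))) = forward (ev (t (n - 1) a))"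
      using step2 s.pw_pred [OF mem, of n] forward_ev_t [of "n - 1" a] by simp
    then show ?case
      using mem by - (rule s.U_inj, auto)
  qed simp
qed

lemma right_linear_Cin: "right_linear Hspace cspace Cin"
proof -
  have S: "(\<Sum>b\<in>UNIV. sm (t 0 b) (c $ b)) \<in> V" for c :: "quat ^ 's"
    by simp
  show ?thesis
    unfolding right_linear_def
  proof (intro conjI ballI allI funcsetI)
    fix c d :: "quat ^ 's" and p
    show "Cin c \<in> qcarrier cspace"
      by (simp add: Cin_def cspace_def ev_mem)
    show "Cin (c + d) = Cin c + Cin d"
      unfolding Cin_def by (simp add: ev_add [symmetric] sm_add_right sum.distrib)
    show "Cin (qsmult Hspace c p) = qsmult cspace (Cin c) p"
      unfolding Cin_def cspace_def by (simp add: ev_sm [symmetric] sm_sum_left sm_mult)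
  qed
qed

lemma Cin_axis: "Cin (axis b 1) = ev (t 0 b)"
  unfolding Cin_def by (simp add: axis_def if_distrib [of "sm _"] cong: if_cong)

lemma realization_cspace:
  assumes "\<And>n i j. r n $ i $ j = B (t n j) (t 0 i)"
  shows "realization cspace forward Cin r"
proof (rule realizationI [OF _ qisometry_forward right_linear_Cin])
  show "pontryagin_space cspace"
    using c.pontryagin .
  show "r n $ i $ j = qform cspace (int_power cspace forward n (Cin (axis j 1))) (Cin (axis i 1))" for n i j
    unfolding Cin_axis int_power_forward assms by (simp add: cspace_def form_ev_ev)
qed

end

section \<open>The space of finitely supported sequences\<close>

definition supp :: "('i \<Rightarrow> quat) \<Rightarrow> 'i set" where
  "supp x = {i. x i \<noteq> 0}"

text \<open>Summation runs over the supports to stay finite. \<open>fsspace_form\<close> enlarges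
  them to any common finite set, through which the laws are inherited from
  \<open>mspace\<close>.\<close>

definition fsspace :: "('i \<Rightarrow> 'i \<Rightarrow> quat) \<Rightarrow> ('i \<Rightarrow> quat) qspace" where
  "fsspace T = \<lparr>qcarrier = {x. finite (supp x)}, qsmult = \<lambda>x p i. x i * p,
     qform = \<lambda>x y. \<Sum>i\<in>supp y. \<Sum>j\<in>supp x. qcnj (y i) * T i j * x j\<rparr>"

lemma fsspace_simps [simp]:
  "qcarrier (fsspace T) = {x. finite (supp x)}" "qsmult (fsspace T) x p = (\<lambda>i. x i * p)"
  by (simp_all add: fsspace_def)

lemma fsspace_form:
  assumes "finite A" "supp x \<subseteq> A" "supp y \<subseteq> A"
  shows "qform (fsspace T) x y = (\<Sum>i\<in>A. \<Sum>j\<in>A. qcnj (y i) * T i j * x j)"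
proof -
  have "(\<Sum>j\<in>supp x. qcnj (y i) * T i j * x j) = (\<Sum>j\<in>A. qcnj (y i) * T i j * x j)" for i
    using assms by (intro sum.mono_neutral_left) (auto simp: supp_def)
  then have "qform (fsspace T) x y = (\<Sum>i\<in>supp y. \<Sum>j\<in>A. qcnj (y i) * T i j * x j)"
    by (simp add: fsspace_def)
  also have "\<dots> = (\<Sum>i\<in>A. \<Sum>j\<in>A. qcnj (y i) * T i j * x j)"
    using assms by (intro sum.mono_neutral_left) (auto simp: supp_def)
  finally show ?thesis .
qed

lemma fsspace_form_mspace:
  assumes "finite A" "supp x \<subseteq> A" "supp y \<subseteq> A"
  shows "qform (fsspace T) x y = qform (mspace A T) x y"
  unfolding fsspace_form [OF assms] by (simp add: mspace_def)

lemma mspace_carrier: "qcarrier (mspace A T) = {x. supp x \<subseteq> A}"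
  unfolding mspace_def supp_def by auto

lemma mspace_smult: "qsmult (mspace A T) x p = (\<lambda>i. x i * p)"
  unfolding mspace_def by simp

lemma fsspace_form_reindex:
  assumes "finite A" "inj_on h A" "supp x \<subseteq> h ` A" "supp y \<subseteq> h ` A"
  shows "qform (fsspace T) x y = (\<Sum>i\<in>A. \<Sum>j\<in>A. qcnj (y (h i)) * T (h i) (h j) * x (h j))"
  using fsspace_form [OF finite_imageI [OF assms(1)] assms(3,4), of T] assms(2)
  by (simp add: sum.reindex)

lemma supp_add: "supp (x + y) \<subseteq> supp x \<union> supp y"
  and supp_uminus: "supp (- x) = supp x"
  and supp_smult: "supp (\<lambda>i. x i * p) \<subseteq> supp x"
  by (auto simp: supp_def)

lemma qhermitian_fsspace:
  assumes T: "\<And>i j. T i j = qcnj (T j i)"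
  shows "qhermitian (fsspace T)"
proof
  have fin: "finite (supp (x + y))" "finite (supp (- x))" "finite (supp (\<lambda>i. x i * p))"
    if "finite (supp x)" "finite (supp y)" for x y :: "'a \<Rightarrow> quat" and p
    using that supp_add [of x y] supp_uminus [of x] supp_smult [of x p]
    by (auto intro: finite_subset)
  have "finite (supp (0 :: 'a \<Rightarrow> quat))"
    by (simp add: supp_def)
  then show "right_qvector_space (fsspace T)"
    unfolding right_qvector_space_def using fin
    by (auto simp: fun_eq_iff distrib_left distrib_right mult.assoc)
  show "hermitian_form (fsspace T)"
    unfolding hermitian_form_def
  proof (intro conjI ballI allI)
    fix x y z :: "'a \<Rightarrow> quat"
    assume "x \<in> qcarrier (fsspace T)" "y \<in> qcarrier (fsspace T)" "z \<in> qcarrier (fsspace T)"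
    define A where "A = supp x \<union> supp y \<union> supp z"
    have A: "finite A" "supp x \<subseteq> A" "supp y \<subseteq> A" "supp z \<subseteq> A" "supp (x + y) \<subseteq> A" "supp (y + z) \<subseteq> A"
      using \<open>x \<in> _\<close> \<open>y \<in> _\<close> \<open>z \<in> _\<close> supp_add [of x y] supp_add [of y z] by (auto simp: A_def)
    interpret m: qhermitian "mspace A T"
      by (rule qhermitian_mspace) (rule T)
    show "qform (fsspace T) (x + y) z = qform (fsspace T) x z + qform (fsspace T) y z"
      "qform (fsspace T) x (y + z) = qform (fsspace T) x y + qform (fsspace T) x z"
      using A m.B_add_left m.B_add_right
      by (simp_all add: fsspace_form_mspace [OF A(1)] mspace_carrier)
  next
    fix x y :: "'a \<Rightarrow> quat"
    assume "x \<in> qcarrier (fsspace T)" "y \<in> qcarrier (fsspace T)"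
    define A where "A = supp x \<union> supp y"
    have A: "finite A" "supp x \<subseteq> A" "supp y \<subseteq> A"
      using \<open>x \<in> _\<close> \<open>y \<in> _\<close> by (auto simp: A_def)
    interpret m: qhermitian "mspace A T"
      by (rule qhermitian_mspace) (rule T)
    show "qform (fsspace T) x y = qcnj (qform (fsspace T) y x)"
      using A m.B_cnj [of y x] by (simp add: fsspace_form_mspace [OF A(1)] mspace_carrier)
    fix p q
    show "qform (fsspace T) (qsmult (fsspace T) x p) (qsmult (fsspace T) y q)
        = qcnj q * qform (fsspace T) x y * p"
      using A m.B_sm [of x y p q] supp_smult [of x p] supp_smult [of y q]
        fsspace_form_mspace [OF A(1), of "\<lambda>i. x i * p" "\<lambda>i. y i * q" T]
        fsspace_form_mspace [OF A, of T]
      by (simp add: mspace_carrier mspace_smult)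
  qed
qed

text \<open>In the coordinates W^* x the form is diagonal with the real weights
  \<open>d k\<close>.\<close>

lemma diagonalizes_quadratic:
  assumes "diagonalizes A T W d"
  shows "qform (mspace A T) x y =
    (\<Sum>k\<in>A. qcnj (\<Sum>p\<in>A. qcnj (W p k) * y p) * of_real (d k) * (\<Sum>p\<in>A. qcnj (W p k) * x p))"
proof -
  have T: "\<And>i j. i \<in> A \<Longrightarrow> j \<in> A \<Longrightarrow> T i j = (\<Sum>k\<in>A. W i k * of_real (d k) * qcnj (W j k))"
    using assms unfolding diagonalizes_def by auto
  have "qform (mspace A T) x y
      = (\<Sum>i\<in>A. \<Sum>j\<in>A. \<Sum>k\<in>A. qcnj (y i) * W i k * of_real (d k) * (qcnj (W j k) * x j))"
    unfolding mspace_def by (simp add: T sum_distrib_left sum_distrib_right mult.assoc)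
  also have "\<dots> = (\<Sum>i\<in>A. \<Sum>k\<in>A. \<Sum>j\<in>A. qcnj (y i) * W i k * of_real (d k) * (qcnj (W j k) * x j))"
    by (intro sum.cong refl sum.swap)
  also have "\<dots> = (\<Sum>k\<in>A. \<Sum>i\<in>A. \<Sum>j\<in>A. qcnj (y i) * W i k * of_real (d k) * (qcnj (W j k) * x j))"
    by (rule sum.swap)
  also have "\<dots> = (\<Sum>k\<in>A. (\<Sum>i\<in>A. qcnj (y i) * W i k) * of_real (d k) * (\<Sum>j\<in>A. qcnj (W j k) * x j))"
    by (simp add: sum_distrib_left sum_distrib_right, rule sum.cong [OF refl], rule sum.swap)
  finally show ?thesis
    by (simp add: qcnj_sum qcnj_mult)
qed

text \<open>Columns of \<open>W\<close> scaled so that, for \<open>d k < 0\<close>, the square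
  becomes -1.\<close>

definition neg_eigenvectors :: "'i set \<Rightarrow> ('i \<Rightarrow> 'i \<Rightarrow> quat) \<Rightarrow> ('i \<Rightarrow> real) \<Rightarrow> 'i \<Rightarrow> 'i \<Rightarrow> quat" where
  "neg_eigenvectors A W d k = (\<lambda>i. if i \<in> A then W i k * of_real (inverse (sqrt (- d k))) else 0)"

text \<open>Orthogonality to these eigenvectors says that the coordinates of W^* x with negative
  weight vanish; what is left of the diagonal form is nonnegative.\<close>

lemma (in hmatrix) mspace_pre_pontryagin:
  assumes W: "diagonalizes I T W d"
  shows "pre_pontryagin (mspace I T) {k \<in> I. d k < 0} (neg_eigenvectors I W d)"
proof -
  interpret q: qhermitian "mspace I T"
    by (rule qhermitian_mspace) (rule herm)
  let ?e = "neg_eigenvectors I W d"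
  define w where "w x k = (\<Sum>p\<in>I. qcnj (W p k) * x p)" for x k
  have form: "qform (mspace I T) x y = (\<Sum>k\<in>I. qcnj (w y k) * of_real (d k) * w x k)" for x y
    unfolding w_def by (rule diagonalizes_quadratic [OF W])
  have we: "w (?e l) k = (if k = l then of_real (inverse (sqrt (- d l))) else 0)"
    if "k \<in> I" "l \<in> I" for k l
  proof -
    have "w (?e l) k = (\<Sum>p\<in>I. qcnj (W p k) * W p l) * of_real (inverse (sqrt (- d l)))"
      unfolding w_def neg_eigenvectors_def by (simp add: sum_distrib_right mult.assoc)
    also have "(\<Sum>p\<in>I. qcnj (W p k) * W p l) = (if k = l then 1 else 0)"
      using W that unfolding diagonalizes_def unitary_qmatrix_def by blast
    finally show ?thesis
      by simp
  qed
  have form_e: "qform (mspace I T) x (?e l) = of_real (inverse (sqrt (- d l)) * d l) * w x l"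
    if "l \<in> I" for x l
  proof -
    have "qform (mspace I T) x (?e l)
        = (\<Sum>k\<in>I. if k = l then of_real (inverse (sqrt (- d l)) * d l) * w x l else 0)"
      unfolding form using that we by (intro sum.cong) auto
    then show ?thesis
      using that by simp
  qed
  show ?thesis
  proof
    show "finite {k \<in> I. d k < 0}"
      by simp
    show "?e k \<in> qcarrier (mspace I T)" for k
      by (auto simp: mspace_carrier supp_def neg_eigenvectors_def)
    show "qform (mspace I T) (?e k) (?e l) = (if k = l then - 1 else 0)"
      if "k \<in> {k \<in> I. d k < 0}" "l \<in> {k \<in> I. d k < 0}" for k l
    proof -
      have "inverse (sqrt (- d l)) * d l * inverse (sqrt (- d l)) = - 1"
        using that by (simp add: field_simps)
      then have "of_real (inverse (sqrt (- d l)) * d l) * of_real (inverse (sqrt (- d l))) = (- 1 :: quat)"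
        by (metis of_real_1 of_real_minus of_real_mult)
      then show ?thesis
        using that by (simp add: form_e we del: of_real_mult of_real_inverse)
    qed
    show "0 \<le> qRe (qform (mspace I T) x x)"
      if x: "\<And>k. k \<in> {k \<in> I. d k < 0} \<Longrightarrow> qform (mspace I T) x (?e k) = 0" for x
    proof -
      have "0 \<le> qRe (qcnj (w x k) * of_real (d k) * w x k)" if k: "k \<in> I" for k
      proof (cases "d k < 0")
        case True
        then have "w x k = 0"
          using x [of k] k form_e [OF k, of x] by simp
        then show ?thesis
          by simp
      next
        case False
        have "qcnj (w x k) * of_real (d k) * w x k = d k *\<^sub>R (qcnj (w x k) * w x k)"
          by (simp add: of_real_def)
        then show ?thesis
          using False by (simp add: mult_qcnj_norm del: times_quat.simps)
      qed
      then show ?thesis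
        unfolding form qRe_sum by (rule sum_nonneg)
    qed
  qed
qed

section \<open>The kernel form on sequences over the integers\<close>

definition kernel :: "(int \<Rightarrow> quat ^ 's ^ 's) \<Rightarrow> int \<times> 's \<Rightarrow> int \<times> 's \<Rightarrow> quat" where
  "kernel r = (\<lambda>(n, a) (m, b). r (m - n) $ a $ b)"

definition shift :: "int \<Rightarrow> (int \<times> 's \<Rightarrow> quat) \<Rightarrow> int \<times> 's \<Rightarrow> quat" where
  "shift k x = (\<lambda>(n, a). x (n - k, a))"

definition unit_vec :: "int \<Rightarrow> 's \<Rightarrow> int \<times> 's \<Rightarrow> quat" where
  "unit_vec n a = (\<lambda>p. if p = (n, a) then 1 else 0)"

text \<open>Embeds Toeplitz indices as a window of the integers starting at 0;
  \<open>finite_window\<close> moves any finite support into such a window.\<close>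

definition nat_index :: "nat \<times> 's \<Rightarrow> int \<times> 's" where
  "nat_index = (\<lambda>(j, a). (int j, a))"

lemma inj_nat_index: "inj_on nat_index A"
  unfolding nat_index_def inj_on_def by auto

lemma kernel_nat_index: "kernel r (nat_index p) (nat_index q) = block_toeplitz r p q"
  unfolding kernel_def nat_index_def block_toeplitz_def by (simp add: case_prod_beta)

lemma qhermitian_kernel:
  fixes r :: "int \<Rightarrow> quat ^ 's ^ 's"
  assumes "\<forall>n. r (- n) = conj_transpose (r n)"
  shows "qhermitian (fsspace (kernel r))"
proof (rule qhermitian_fsspace)
  show "kernel r p q = qcnj (kernel r q p)" for p q
    using assms [unfolded conj_transpose_component, rule_format, of "fst p - fst q"]
    unfolding kernel_def by (simp add: case_prod_beta)
qed

lemma kernel_form_toeplitz: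
  fixes r :: "int \<Rightarrow> quat ^ 's ^ 's"
  assumes "supp x \<subseteq> nat_index ` toeplitz_index N" "supp y \<subseteq> nat_index ` toeplitz_index N"
  shows "qform (fsspace (kernel r)) x y =
    qform (mspace (toeplitz_index N) (block_toeplitz r)) (x \<circ> nat_index) (y \<circ> nat_index)"
proof -
  have "finite (toeplitz_index N :: (nat \<times> 's) set)"
    unfolding toeplitz_index_def by simp
  then show ?thesis
    by (subst fsspace_form_reindex [OF _ inj_nat_index assms]) (simp_all add: mspace_def kernel_nat_index)
qed

lemma supp_shift: "supp (shift k x) = (\<lambda>(n, a). (n + k, a)) ` supp x"
proof -
  have "(n, a) \<in> supp (shift k x) \<longleftrightarrow> (n, a) \<in> (\<lambda>(n, a). (n + k, a)) ` supp x" for n a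
    unfolding supp_def shift_def by (auto intro!: image_eqI [of _ _ "(n - k, a)"])
  then show ?thesis
    by auto
qed

text \<open>The kernel depends only on the difference of the time indices, so reindexing both sums
  by the translation leaves every term unchanged.\<close>

lemma shift_form:
  assumes "finite (supp x)" "finite (supp y)"
  shows "qform (fsspace (kernel r)) (shift k x) (shift k y) = qform (fsspace (kernel r)) x y"
proof -
  let ?h = "\<lambda>(n, a). (n + k, a)" and ?A = "supp x \<union> supp y"
  have "qform (fsspace (kernel r)) (shift k x) (shift k y) =
    (\<Sum>i\<in>?A. \<Sum>j\<in>?A. qcnj (shift k y (?h i)) * kernel r (?h i) (?h j) * shift k x (?h j))"
    using assms by (intro fsspace_form_reindex) (auto simp: supp_shift inj_on_def)
  also have "\<dots> = (\<Sum>i\<in>?A. \<Sum>j\<in>?A. qcnj (y i) * kernel r i j * x j)"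
    by (simp add: shift_def kernel_def case_prod_beta)
  also have "\<dots> = qform (fsspace (kernel r)) x y"
    using assms by (intro fsspace_form [symmetric]) auto
  finally show ?thesis .
qed

lemma qisometry_shift:
  fixes r :: "int \<Rightarrow> quat ^ 's ^ 's"
  assumes "\<forall>n. r (- n) = conj_transpose (r n)"
  shows "qisometry (fsspace (kernel r)) (shift 1)"
proof -
  interpret qhermitian "fsspace (kernel r)"
    by (rule qhermitian_kernel [OF assms])
  have fin: "finite (supp (shift k x))" if "finite (supp x)" for k and x :: "int \<times> 's \<Rightarrow> quat"
    using that by (simp add: supp_shift)
  show ?thesis
  proof
    show "right_linear (fsspace (kernel r)) (fsspace (kernel r)) (shift 1)"
      unfolding right_linear_def using fin by (auto simp: shift_def fun_eq_iff)
    show "bij_betw (shift 1) V V"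
    proof (rule bij_betw_byWitness [where f' = "shift (- 1)"])
      have "shift (- 1) (shift 1 x) = x" "shift 1 (shift (- 1) x) = x" for x :: "int \<times> 's \<Rightarrow> quat"
        by (simp_all add: shift_def fun_eq_iff)
      then show "\<forall>x\<in>V. shift (- 1) (shift 1 x) = x" "\<forall>x\<in>V. shift 1 (shift (- 1) x) = x"
        by blast+
    qed (use fin in auto)
    show "B (shift 1 x) (shift 1 y) = B x y" if "x \<in> V" "y \<in> V" for x y
      using that by (simp add: shift_form)
  qed
qed

lemma sum_fun_apply: "(\<Sum>k\<in>A. f k) i = (\<Sum>k\<in>A. f k i)" for f :: "'k \<Rightarrow> 'i \<Rightarrow> 'b::ab_group_add"
  by (induction A rule: infinite_finite_induct) auto

lemma finite_window:
  fixes S :: "(int \<times> 's::finite) set"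
  assumes "finite S"
  shows "\<exists>k N. (\<lambda>(n, a). (n + k, a)) ` S \<subseteq> nat_index ` toeplitz_index N"
proof -
  have "bdd_above ((\<lambda>p. \<bar>fst p\<bar>) ` S)"
    using assms by (intro bdd_above_finite) simp
  then obtain b where b: "\<And>p. p \<in> S \<Longrightarrow> \<bar>fst p\<bar> \<le> b"
    unfolding bdd_above_def by auto
  \<comment> \<open>Times of absolute value at most \<open>b\<close>, shifted by \<open>b\<close>,
    lie between 0 and \<open>2 * b\<close>.\<close>
  have "(n + b, a) \<in> nat_index ` toeplitz_index (nat (2 * b))" if "(n, a) \<in> S" for n a
    using b [OF that] unfolding nat_index_def toeplitz_index_def
    by (intro image_eqI [of _ _ "(nat (n + b), a)"]) auto
  then show ?thesis
    by (intro exI [of _ b] exI [of _ "nat (2 * b)"]) auto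
qed

lemma negative_squares_pre_pontryagin:
  fixes r :: "int \<Rightarrow> quat ^ 's ^ 's"
  assumes "negative_squares r \<kappa>"
  shows "\<exists>(K :: (nat \<times> 's) set) E. pre_pontryagin (fsspace (kernel r)) K E"
proof -
  have herm: "\<forall>n. r (- n) = conj_transpose (r n)"
    and le: "\<And>N. negative_eigenvalues r N \<le> \<kappa>"
    using assms unfolding negative_squares_def by auto
  obtain N0 where N0: "negative_eigenvalues r N0 = \<kappa>"
    using assms unfolding negative_squares_def by auto
  have ex: "\<exists>W d. pre_pontryagin (mspace (toeplitz_index N) (block_toeplitz r))
      {k \<in> toeplitz_index N. d k < 0} (neg_eigenvectors (toeplitz_index N) W d) \<and>
      negative_eigenvalues r N = card {k \<in> (toeplitz_index N :: (nat \<times> 's) set). d k < 0}" for N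
  proof -
    interpret h: hmatrix "toeplitz_index N" "block_toeplitz r"
      by (rule hmatrix_block_toeplitz [OF herm])
    show ?thesis
      using h.negative_count h.mspace_pre_pontryagin unfolding negative_eigenvalues_def by blast
  qed
  let ?X = "fsspace (kernel r)"
  interpret X: qhermitian ?X
    by (rule qhermitian_kernel [OF herm])
  obtain W d where pre: "pre_pontryagin (mspace (toeplitz_index N0) (block_toeplitz r))
      {k \<in> toeplitz_index N0. d k < 0} (neg_eigenvectors (toeplitz_index N0) W d)"
    and card: "\<kappa> = card {k \<in> (toeplitz_index N0 :: (nat \<times> 's) set). d k < 0}"
    using ex [of N0] N0 by auto
  define K where "K = {k \<in> (toeplitz_index N0 :: (nat \<times> 's) set). d k < 0}"
  define e0 where "e0 = neg_eigenvectors (toeplitz_index N0) W d"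
  interpret m0: pre_pontryagin "mspace (toeplitz_index N0) (block_toeplitz r)" K e0
    using pre unfolding K_def e0_def .
  \<comment> \<open>Extension by zero to negative times; times beyond \<open>N0\<close> already
    carry the value 0.\<close>
  define E where "E k = (\<lambda>(n, a). if n \<ge> 0 then e0 k (nat n, a) else 0)" for k
  have E_nat: "E k \<circ> nat_index = e0 k" for k
    unfolding E_def nat_index_def by (simp add: fun_eq_iff)
  have E_supp: "supp (E k) \<subseteq> nat_index ` toeplitz_index N0" if "k \<in> K" for k
  proof
    fix p assume p: "p \<in> supp (E k)"
    obtain n a where na: "p = (n, a)"
      by (cases p)
    have "n \<ge> 0" "e0 k (nat n, a) \<noteq> 0"
      using p unfolding supp_def E_def na by (auto split: if_splits)
    then have "(nat n, a) \<in> toeplitz_index N0"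
      using m0.e_mem [OF that] unfolding mspace_carrier supp_def by blast
    then show "p \<in> nat_index ` toeplitz_index N0"
      using \<open>n \<ge> 0\<close> unfolding na nat_index_def by (intro image_eqI [of _ _ "(nat n, a)"]) auto
  qed
  have E_mem: "E k \<in> X.V" if "k \<in> K" for k
  proof -
    have "finite (nat_index ` toeplitz_index N0 :: (int \<times> 's) set)"
      unfolding toeplitz_index_def by simp
    then show ?thesis
      using E_supp [OF that] finite_subset by auto
  qed
  have E_orth: "X.B (E k) (E l) = (if k = l then - 1 else 0)" if "k \<in> K" "l \<in> K" for k l
    using kernel_form_toeplitz [OF E_supp [OF that(1)] E_supp [OF that(2)], of r] m0.e_orth [OF that]
    by (simp add: E_nat)
  have "pre_pontryagin ?X K E"
  proof
    show "0 \<le> qRe (X.B x x)" if x: "x \<in> X.V" "\<And>k. k \<in> K \<Longrightarrow> X.B x (E k) = 0" for x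
    proof (rule ccontr)
      assume neg: "\<not> 0 \<le> qRe (X.B x x)"
      \<comment> \<open>The offending vector joins the family under \<open>None\<close>, giving
        \<open>Suc \<kappa>\<close> orthogonal vectors of negative square.\<close>
      define J where "J = insert None (Some ` K)"
      define w where "w j = (case j of None \<Rightarrow> x | Some k \<Rightarrow> E k)" for j
      define c where "c j = (case j of None \<Rightarrow> qRe (X.B x x) | Some k \<Rightarrow> - 1)" for j :: "(nat \<times> 's) option"
      have finK: "finite K"
        by simp
      then have J: "finite J" "card J = Suc \<kappa>"
        using card by (simp_all add: J_def K_def card_insert_if card_image)
      have w_mem: "w j \<in> X.V" if "j \<in> J" for j
        using that x(1) E_mem by (auto simp: J_def w_def)
      have w_orth: "X.B (w j) (w l) = (if j = l then of_real (c j) else 0)" if "j \<in> J" "l \<in> J" for j l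
      proof -
        have "X.B (E k) x = 0" if "k \<in> K" for k
          using x E_mem [OF that] that X.B_eq_0_commute by blast
        moreover have "X.B x x = of_real (c None)"
          unfolding c_def option.case using x(1) by (rule X.B_self_real)
        moreover have "c (Some k) = - 1" for k
          by (simp add: c_def)
        ultimately show ?thesis
          using that x(2) E_orth by (auto simp: J_def w_def split: if_splits)
      qed
      \<comment> \<open>One translation serves all vectors of the family, so their mutual form
        values survive.\<close>
      obtain k N where kN: "(\<lambda>(n, a). (n + k, a)) ` (\<Union>j\<in>J. supp (w j)) \<subseteq> nat_index ` toeplitz_index N"
        using finite_window [of "\<Union>j\<in>J. supp (w j)"] J(1) w_mem by auto
      define y where "y j = shift k (w j) \<circ> nat_index" for j
      have y_supp: "supp (shift k (w j)) \<subseteq> nat_index ` toeplitz_index N" if "j \<in> J" for j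
        using kN that unfolding supp_shift by blast
      obtain W' d' where "pre_pontryagin (mspace (toeplitz_index N) (block_toeplitz r))
          {k \<in> toeplitz_index N. d' k < 0} (neg_eigenvectors (toeplitz_index N) W' d')"
        and card': "negative_eigenvalues r N = card {k \<in> (toeplitz_index N :: (nat \<times> 's) set). d' k < 0}"
        using ex [of N] by auto
      then interpret m: pre_pontryagin "mspace (toeplitz_index N) (block_toeplitz r)"
        "{k \<in> toeplitz_index N. d' k < 0}" "neg_eigenvectors (toeplitz_index N) W' d'"
        by simp
      \<comment> \<open>In the window of size \<open>N\<close>, more than \<open>\<kappa>\<close>
        orthogonal negative vectors would force more than \<open>\<kappa>\<close> negative
        eigenvalues.\<close>
      have "card J \<le> card {k \<in> (toeplitz_index N :: (nat \<times> 's) set). d' k < 0}"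
      proof (rule m.neg_count [OF J(1), of y c])
        show "y j \<in> m.V" if "j \<in> J" for j
        proof -
          have "supp (y j) \<subseteq> toeplitz_index N"
          proof
            fix p assume "p \<in> supp (y j)"
            then have "nat_index p \<in> nat_index ` toeplitz_index N"
              using y_supp [OF that] unfolding y_def supp_def by auto
            then show "p \<in> toeplitz_index N"
              by (simp add: inj_image_mem_iff [OF inj_nat_index])
          qed
          then show ?thesis
            by (simp add: mspace_carrier)
        qed
        show "m.B (y j) (y l) = (if j = l then of_real (c j) else 0)" if "j \<in> J" "l \<in> J" for j l
          using kernel_form_toeplitz [OF y_supp [OF that(1)] y_supp [OF that(2)], of r]
            shift_form [of "w j" "w l" r k] w_mem [OF that(1)] w_mem [OF that(2)] w_orth [OF that]
          by (simp add: y_def)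
        show "c j < 0" if "j \<in> J" for j
          using that neg by (auto simp: J_def c_def)
      qed
      then show False
        using J(2) card' le [of N] by simp
    qed
  qed (use E_mem E_orth in auto)
  then show ?thesis
    by blast
qed

lemma negative_squares_realization:
  fixes r :: "int \<Rightarrow> quat ^ 's ^ 's"
  assumes "negative_squares r \<kappa>"
  shows "\<exists>(P :: (int \<Rightarrow> quat ^ 's) qspace) U C. realization P U C r"
proof -
  have herm: "\<forall>n. r (- n) = conj_transpose (r n)"
    using assms unfolding negative_squares_def by auto
  obtain K :: "(nat \<times> 's) set" and E where "pre_pontryagin (fsspace (kernel r)) K E"
    using negative_squares_pre_pontryagin [OF assms] by blast
  then interpret X: pre_pontryagin "fsspace (kernel r)" K E .
  interpret s: qisometry "fsspace (kernel r)" "shift 1"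
    by (rule qisometry_shift [OF herm])
  have supp_unit: "supp (unit_vec n a) = {(n, a)}" for n and a :: 's
    by (auto simp: supp_def unit_vec_def)
  have span: "X.V \<subseteq> W" if W: "qsubspace (fsspace (kernel r)) W" "\<And>n a. unit_vec n a \<in> W" for W
  proof
    fix x assume x: "x \<in> X.V"
    have "(\<Sum>p\<in>supp x. X.sm (unit_vec (fst p) (snd p)) (x p)) \<in> W"
      using W by (intro X.qsubspace_sum [OF W(1)]) (auto simp: qsubspace_def)
    also have "(\<Sum>p\<in>supp x. X.sm (unit_vec (fst p) (snd p)) (x p)) = x"
    proof
      fix q
      have "(\<Sum>p\<in>supp x. X.sm (unit_vec (fst p) (snd p)) (x p)) q
          = (\<Sum>p\<in>supp x. if q = p then x p else 0)"
        unfolding sum_fun_apply by (intro sum.cong) (auto simp: unit_vec_def)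
      also have "\<dots> = x q"
        using x by (simp add: supp_def)
      finally show "(\<Sum>p\<in>supp x. X.sm (unit_vec (fst p) (snd p)) (x p)) q = x q" .
    qed
    finally show "x \<in> W" .
  qed
  interpret f: fshift "fsspace (kernel r)" K E unit_vec "shift 1"
  proof
    show "unit_vec n a \<in> X.V" for n a
      by (simp add: supp_unit)
    show "X.V \<subseteq> W" if "qsubspace (fsspace (kernel r)) W" "\<And>n a. unit_vec n a \<in> W" for W
      using span that .
    show "shift 1 (unit_vec n a) = unit_vec (n + 1) a" for n a
      by (auto simp: shift_def unit_vec_def fun_eq_iff)
  qed
  have "realization f.cspace f.forward f.Cin r"
  proof (rule f.realization_cspace)
    \<comment> \<open>Time \<open>n\<close> stands in the first argument and 0 in the second, so the
      kernel difference is \<open>n\<close>, with row \<open>i\<close> and column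
      \<open>j\<close>.\<close>
    show "r n $ i $ j = X.B (unit_vec n j) (unit_vec 0 i)" for n i j
      unfolding fsspace_def qspace.simps supp_unit by (simp add: unit_vec_def kernel_def)
  qed
  then show ?thesis
    by blast
qed

text \<open>A type cannot be quantified existentially, so the equivalence names one type able to
  carry a realization; the second conjunct extends the converse to spaces over any type.\<close>

theorem theorem1p4:
  fixes r :: "int \<Rightarrow> quat ^ 's ^ 's"
  shows
    "((\<exists>\<kappa>. negative_squares r \<kappa>) \<longleftrightarrow>
        (\<exists>(P :: (int \<Rightarrow> quat ^ 's) qspace) U C. realization P U C r))
     \<and> (\<forall>(P :: 'p::ab_group_add qspace) U C.
           realization P U C r \<longrightarrow> (\<exists>\<kappa>. negative_squares r \<kappa>))
     \<and> (\<forall>(P1 :: 'p1::ab_group_add qspace) U1 C1 (P2 :: 'p2::ab_group_add qspace) U2 C2.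
           minimal_realization P1 U1 C1 r \<and> minimal_realization P2 U2 C2 r \<longrightarrow>
           (\<exists>S. unitary_operator P1 P2 S \<and> (\<forall>c. S (C1 c) = C2 c) \<and>
                (\<forall>a\<in>qcarrier P1. S (U1 a) = U2 (S a))))"
proof (intro conjI allI impI)
  show "(\<exists>\<kappa>. negative_squares r \<kappa>) \<longleftrightarrow>
      (\<exists>(P :: (int \<Rightarrow> quat ^ 's) qspace) U C. realization P U C r)"
    using negative_squares_realization realization_negative_squares by blast
next
  fix P :: "'p::ab_group_add qspace" and U C
  assume "realization P U C r"
  then show "\<exists>\<kappa>. negative_squares r \<kappa>"
    by (rule realization_negative_squares)
next
  fix P1 :: "'p1::ab_group_add qspace" and U1 C1 and P2 :: "'p2::ab_group_add qspace" and U2 C2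
  assume "minimal_realization P1 U1 C1 r \<and> minimal_realization P2 U2 C2 r"
  then show "\<exists>S. unitary_operator P1 P2 S \<and> (\<forall>c. S (C1 c) = C2 c) \<and>
      (\<forall>a\<in>qcarrier P1. S (U1 a) = U2 (S a))"
    using minimal_realization_unique by blast
qed

end
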